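(* Let $(G_1,G_2)$ be a matched pair of affine algebraic groups and let $\mathfrak g_1$ be the Lie algebra of $G_1$. Then, with the action of $\mathfrak g_1$ on $\mathscr P(G_2)$ given by $X\triangleright f=f_{\langle0\rangle}X(f_{\langle1\rangle})$ and the coaction $\nabla_{\rm Pol}:\mathfrak g_1\to\mathfrak g_1\otimes\mathscr P(G_2)$, $\nabla_{\rm Pol}(X_i)=\sum_jX_j\otimes f_i^j$ (both extended to $U(\mathfrak g_1)$), the pair $(\mathscr P(G_2),U(\mathfrak g_1))$ is a matched pair of Hopf algebras.
   Context: Everything is over $\mathbb C$; affine algebraic groups are complex and connected; Sweedler notation is used ($\Delta(u)=u_{(1)}\otimes u_{(2)}$, right coactions $\nabla(u)=u_{\langle0\rangle}\otimes u_{\langle1\rangle}$). **$\mathscr P(G)$.** The commutative Hopf algebra of polynomial functions on an affine algebraic group $G$: pointwise product, $f_{(1)}(\psi)f_{(2)}(\varphi)=f(\psi\varphi)$, $\varepsilon(f)=f(1)$, $S(f)(\psi)=f(\psi^{-1})$. **Matched pair of affine algebraic groups.** $(G_1,G_2)$ with maps of affine algebraic sets $G_2\times G_1\to G_1$, $(\psi,\varphi)\mapsto\psi\triangleright\varphi$, and $G_2\times G_1\to G_2$, $(\psi,\varphi)\mapsto\psi\triangleleft\varphi$, such that $(\psi\psi')\triangleright\varphi=\psi\triangleright(\psi'\triangleright\varphi)$, $1\triangleright\varphi=\varphi$; $\psi\triangleleft(\varphi\varphi')=(\psi\triangleleft\varphi)\triangleleft\varphi'$, $\psi\triangleleft1=\psi$;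 $\psi\triangleright(\varphi\varphi')=(\psi\triangleright\varphi)((\psi\triangleleft\varphi)\triangleright\varphi')$, $\psi\triangleright1=1$; $(\psi\psi')\triangleleft\varphi=(\psi\triangleleft(\psi'\triangleright\varphi))(\psi'\triangleleft\varphi)$, $1\triangleleft\varphi=1$. **Action and coaction.** Elements $X\in\mathfrak g_1$ are regarded as derivations $\mathscr P(G_1)\to\mathbb C$ at the identity. For $f\in\mathscr P(G_2)$ write $f(\psi\triangleleft\varphi)=f_{\langle0\rangle}(\psi)f_{\langle1\rangle}(\varphi)$ with $f_{\langle0\rangle}\otimes f_{\langle1\rangle}\in\mathscr P(G_2)\otimes\mathscr P(G_1)$. For $\psi\in G_2$, $\psi\triangleright X\in\mathfrak g_1$ is the image of $X$ under the differential at the identity of $L_\psi:G_1\to G_1$, $\varphi\mapsto\psi\triangleright\varphi$, i.e. $(\psi\triangleright X)(f)=X(f\circ L_\psi)$. For a basis $X_1,\dots,X_N$ of $\mathfrak g_1$ the functions $f_i^j\in\mathscr P(G_2)$ are defined by $\psi\triangleright X_i=\sum_jf_i^j(\psi)X_j$. The coaction is extended to $\nabla:U(\mathfrak g_1)\to U(\mathfrak g_1)\otimes\mathscr P(G_2)$ by $\nabla(1)=1\otimes1$, $\nabla(uv)=u_{(1)\langle0\rangle}v_{\langle0\rangle}\otimes u_{(1)\langle1\rangle}(u_{(2)}\triangleright v_{\langle1\rangle})$. **Matched pair of Hopf algebras.** A pair $(\mathcal F,\mathcal U)$ of Hopf algebras, with a left action $\triangleright$ of $\mathcal U$ on $\mathcal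 F$ and a right coaction $\nabla:\mathcal U\to\mathcal U\otimes\mathcal F$, is a matched pair if $\mathcal F$ is a left $\mathcal U$-module algebra, $\mathcal U$ is a right $\mathcal F$-comodule coalgebra ($u_{\langle0\rangle(1)}\otimes u_{\langle0\rangle(2)}\otimes u_{\langle1\rangle}=u_{(1)\langle0\rangle}\otimes u_{(2)\langle0\rangle}\otimes u_{(1)\langle1\rangle}u_{(2)\langle1\rangle}$, $\varepsilon(u_{\langle0\rangle})u_{\langle1\rangle}=\varepsilon(u)1$), and for all $u,v\in\mathcal U$, $f\in\mathcal F$: $\varepsilon(u\triangleright f)=\varepsilon(u)\varepsilon(f)$; $\Delta(u\triangleright f)=u_{(1)\langle0\rangle}\triangleright f_{(1)}\otimes u_{(1)\langle1\rangle}(u_{(2)}\triangleright f_{(2)})$; $\nabla(1)=1\otimes1$; $\nabla(uv)=u_{(1)\langle0\rangle}v_{\langle0\rangle}\otimes u_{(1)\langle1\rangle}(u_{(2)}\triangleright v_{\langle1\rangle})$; $u_{(2)\langle0\rangle}\otimes(u_{(1)}\triangleright f)u_{(2)\langle1\rangle}=u_{(1)\langle0\rangle}\otimes u_{(1)\langle1\rangle}(u_{(2)}\triangleright f)$. *)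

theory Defs
  imports Complex_Main "HOL-Library.Poly_Mapping"
begin

section \<open>Complex vector spaces and algebras\<close>

class scaleC =
  fixes scaleC :: "complex \<Rightarrow> 'a \<Rightarrow> 'a"  (infixr \<open>*\<^sub>C\<close> 75)

class complex_vector = scaleC + ab_group_add +
  assumes scaleC_add_right: "a *\<^sub>C (x + y) = a *\<^sub>C x + a *\<^sub>C y"
    and scaleC_add_left: "(a + b) *\<^sub>C x = a *\<^sub>C x + b *\<^sub>C x"
    and scaleC_scaleC: "a *\<^sub>C (b *\<^sub>C x) = (a * b) *\<^sub>C x"
    and scaleC_one: "1 *\<^sub>C x = x"

class complex_algebra_1 = complex_vector + ring_1 +
  assumes mult_scaleC_left: "(a *\<^sub>C x) * y = a *\<^sub>C (x * y)"
    and mult_scaleC_right: "x * (a *\<^sub>C y) = a *\<^sub>C (x * y)"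

global_interpretation complex_vector: vector_space "scaleC :: complex \<Rightarrow> 'a \<Rightarrow> 'a::complex_vector"
  by unfold_locales (fact scaleC_add_right scaleC_add_left scaleC_scaleC scaleC_one)+

abbreviation clinear :: "('a::complex_vector \<Rightarrow> 'b::complex_vector) \<Rightarrow> bool"
  where "clinear \<equiv> Vector_Spaces.linear scaleC scaleC"

definition cbilinear :: "('a::complex_vector \<Rightarrow> 'b::complex_vector \<Rightarrow> 'c::complex_vector) \<Rightarrow> bool"
  where "cbilinear h \<longleftrightarrow> (\<forall>y. clinear (\<lambda>x. h x y)) \<and> (\<forall>x. clinear (h x))"

lemma clinearI:
  assumes "\<And>x y. f (x + y) = f x + f y" and "\<And>c x. f (c *\<^sub>C x) = c *\<^sub>C f x"
  shows "clinear f"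
  using assms by unfold_locales (auto simp: scaleC_add_right scaleC_add_left scaleC_scaleC scaleC_one)

lemma clinear_add: "clinear f \<Longrightarrow> f (x + y) = f x + f y"
  by (simp add: Vector_Spaces.linear_iff)

lemma clinear_scaleC: "clinear f \<Longrightarrow> f (c *\<^sub>C x) = c *\<^sub>C f x"
  by (simp add: Vector_Spaces.linear_iff)

instantiation complex :: complex_algebra_1
begin

definition scaleC_complex :: "complex \<Rightarrow> complex \<Rightarrow> complex"
  where "scaleC_complex c z = c * z"

instance
  by standard (simp_all add: scaleC_complex_def algebra_simps)

end

instantiation poly_mapping :: (type, complex_vector) complex_vector
begin

definition scaleC_poly_mapping :: "complex \<Rightarrow> ('a \<Rightarrow>\<^sub>0 'b) \<Rightarrow> ('a \<Rightarrow>\<^sub>0 'b)"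
  where "scaleC_poly_mapping c = Poly_Mapping.map (scaleC c)"

lemma lookup_scaleC: "Poly_Mapping.lookup (c *\<^sub>C p) k = c *\<^sub>C Poly_Mapping.lookup p k"
  by (simp add: scaleC_poly_mapping_def Poly_Mapping.map.rep_eq when_def)

instance
  by standard
    (auto intro!: poly_mapping_eqI
      simp: lookup_scaleC lookup_add scaleC_add_right scaleC_add_left scaleC_scaleC scaleC_one)

end


section \<open>Tensor products\<close>

text \<open>The tensor product over the complex numbers is the free vector space on pairs modulo the
  bilinearity relations.\<close>

definition tensor_relations :: "(('a::complex_vector \<times> 'b::complex_vector) \<Rightarrow>\<^sub>0 complex) set"
  where "tensor_relations =
    {Poly_Mapping.single (x + x', y) 1 - Poly_Mapping.single (x, y) 1
       - Poly_Mapping.single (x', y) 1 | x x' y. True} \<union>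
    {Poly_Mapping.single (x, y + y') 1 - Poly_Mapping.single (x, y) 1
       - Poly_Mapping.single (x, y') 1 | x y y'. True} \<union>
    {Poly_Mapping.single (c *\<^sub>C x, y) 1 - Poly_Mapping.single (x, y) c | c x y. True} \<union>
    {Poly_Mapping.single (x, c *\<^sub>C y) 1 - Poly_Mapping.single (x, y) c | c x y. True}"

definition tensor_eq :: "(('a::complex_vector \<times> 'b::complex_vector) \<Rightarrow>\<^sub>0 complex) \<Rightarrow>
    (('a \<times> 'b) \<Rightarrow>\<^sub>0 complex) \<Rightarrow> bool"
  where "tensor_eq p q \<longleftrightarrow> p - q \<in> complex_vector.span tensor_relations"

lemma span_diff_equivp: "equivp (\<lambda>p q :: 'a::complex_vector. p - q \<in> complex_vector.span R)"
proof (rule equivpI)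
  show "reflp (\<lambda>p q :: 'a. p - q \<in> complex_vector.span R)"
    by (simp add: reflp_def complex_vector.span_zero)
  show "symp (\<lambda>p q :: 'a. p - q \<in> complex_vector.span R)"
  proof (rule sympI)
    fix p q :: 'a assume "p - q \<in> complex_vector.span R"
    then show "q - p \<in> complex_vector.span R"
      using complex_vector.span_neg[of "p - q" R] by simp
  qed
  show "transp (\<lambda>p q :: 'a. p - q \<in> complex_vector.span R)"
  proof (rule transpI)
    fix p q r :: 'a assume "p - q \<in> complex_vector.span R" "q - r \<in> complex_vector.span R"
    then show "p - r \<in> complex_vector.span R"
      using complex_vector.span_add[of "p - q" R "q - r"] by simp
  qed
qed

lemma span_diff_ops:
  fixes p q p' q' :: "'a::complex_vector"
  assumes "p - q \<in> complex_vector.span R"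
  shows "p' - q' \<in> complex_vector.span R \<Longrightarrow> (p + p') - (q + q') \<in> complex_vector.span R"
    and "p' - q' \<in> complex_vector.span R \<Longrightarrow> (p - p') - (q - q') \<in> complex_vector.span R"
    and "- p - - q \<in> complex_vector.span R"
    and "c *\<^sub>C p - c *\<^sub>C q \<in> complex_vector.span R"
proof -
  show "(p + p') - (q + q') \<in> complex_vector.span R" if "p' - q' \<in> complex_vector.span R"
    using complex_vector.span_add[OF assms that] by (simp add: algebra_simps)
  show "(p - p') - (q - q') \<in> complex_vector.span R" if "p' - q' \<in> complex_vector.span R"
    using complex_vector.span_diff[OF assms that] by (simp add: algebra_simps)
  show "- p - - q \<in> complex_vector.span R"
    using complex_vector.span_neg[OF assms] by simp
  show "c *\<^sub>C p - c *\<^sub>C q \<in> complex_vector.span R"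
    using complex_vector.span_scale[OF assms, of c]
    by (simp add: complex_vector.scale_right_diff_distrib)
qed

quotient_type (overloaded) ('a, 'b) tensor (infixr \<open>\<otimes>\<close> 71) =
  "('a::complex_vector \<times> 'b::complex_vector) \<Rightarrow>\<^sub>0 complex" / tensor_eq
  unfolding tensor_eq_def by (rule span_diff_equivp)

instantiation tensor :: (complex_vector, complex_vector) complex_vector
begin

lift_definition zero_tensor :: "'a \<otimes> 'b" is 0 .

lift_definition plus_tensor :: "'a \<otimes> 'b \<Rightarrow> 'a \<otimes> 'b \<Rightarrow> 'a \<otimes> 'b" is "(+)"
  unfolding tensor_eq_def by (rule span_diff_ops)

lift_definition uminus_tensor :: "'a \<otimes> 'b \<Rightarrow> 'a \<otimes> 'b" is uminus
  unfolding tensor_eq_def by (rule span_diff_ops)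

lift_definition minus_tensor :: "'a \<otimes> 'b \<Rightarrow> 'a \<otimes> 'b \<Rightarrow> 'a \<otimes> 'b" is "(-)"
  unfolding tensor_eq_def by (rule span_diff_ops)

lift_definition scaleC_tensor :: "complex \<Rightarrow> 'a \<otimes> 'b \<Rightarrow> 'a \<otimes> 'b" is scaleC
  unfolding tensor_eq_def by (rule span_diff_ops)

instance
proof
  note tensor_eq_refl = equivp_reflp[OF tensor_equivp]
  fix x y z :: "'a \<otimes> 'b" and a b :: complex
  show "x + y + z = x + (y + z)" by transfer (simp add: add.assoc tensor_eq_refl)
  show "x + y = y + x" by transfer (simp add: add.commute tensor_eq_refl)
  show "0 + x = x" by transfer (simp add: tensor_eq_refl)
  show "- x + x = 0" by transfer (simp add: tensor_eq_refl)
  show "x - y = x + - y" by transfer (simp add: tensor_eq_refl)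
  show "a *\<^sub>C (x + y) = a *\<^sub>C x + a *\<^sub>C y"
    by transfer (simp add: scaleC_add_right tensor_eq_refl)
  show "(a + b) *\<^sub>C x = a *\<^sub>C x + b *\<^sub>C x"
    by transfer (simp add: scaleC_add_left tensor_eq_refl)
  show "a *\<^sub>C b *\<^sub>C x = (a * b) *\<^sub>C x"
    by transfer (simp add: scaleC_scaleC tensor_eq_refl)
  show "1 *\<^sub>C x = x" by transfer (simp add: scaleC_one tensor_eq_refl)
qed

end

lift_definition pure_tensor :: "'a::complex_vector \<Rightarrow> 'b::complex_vector \<Rightarrow> 'a \<otimes> 'b" (infixr \<open>\<otimes>\<close> 71)
  is "\<lambda>x y. Poly_Mapping.single (x, y) 1" .

text \<open>\<open>sweedler t (\<lambda>x y. h x y)\<close> is the Sweedler expression \<open>h t\<^sub>1 t\<^sub>2\<close>: it writes \<open>t\<close> as a finite sum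
  of pure tensors \<open>x\<^sub>k \<otimes> y\<^sub>k\<close> with coefficients \<open>c\<^sub>k\<close> and returns the sum of
  \<open>c\<^sub>k h x\<^sub>k y\<^sub>k\<close>. This depends on the choice of the representative unless \<open>h\<close> is bilinear,
  and it is only used for bilinear \<open>h\<close>.\<close>

definition sweedler :: "'a::complex_vector \<otimes> 'b::complex_vector \<Rightarrow> ('a \<Rightarrow> 'b \<Rightarrow> 'c::complex_vector) \<Rightarrow> 'c"
  where "sweedler t h = (let p = rep_tensor t in
    \<Sum>(x, y)\<in>Poly_Mapping.keys p. Poly_Mapping.lookup p (x, y) *\<^sub>C h x y)"

lemma sweedler_eval:
  assumes h: "cbilinear h" and t: "t = abs_tensor p"
  shows "sweedler t h =
    (\<Sum>(x, y)\<in>Poly_Mapping.keys p. Poly_Mapping.lookup p (x, y) *\<^sub>C h x y)"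
proof -
  define ext where "ext q = (\<Sum>k\<in>Poly_Mapping.keys q. Poly_Mapping.lookup q k *\<^sub>C h (fst k) (snd k))"
    for q
  have ext_superset: "ext q = (\<Sum>k\<in>K. Poly_Mapping.lookup q k *\<^sub>C h (fst k) (snd k))"
    if "finite K" "Poly_Mapping.keys q \<subseteq> K" for q K
    unfolding ext_def using that
    by (intro sum.mono_neutral_left)
      (auto simp: in_keys_iff complex_vector.scale_zero_left)
  have "ext (q + r) = ext q + ext r" for q r
  proof -
    let ?K = "Poly_Mapping.keys q \<union> Poly_Mapping.keys r"
    have "Poly_Mapping.keys (q + r) \<subseteq> ?K" by (rule Poly_Mapping.keys_add)
    then show ?thesis
      by (simp add: ext_superset[of ?K] lookup_add scaleC_add_left sum.distrib)
  qed
  moreover have "ext (c *\<^sub>C q) = c *\<^sub>C ext q" for c q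
  proof -
    have "Poly_Mapping.keys (c *\<^sub>C q) \<subseteq> Poly_Mapping.keys q"
      by (auto simp: in_keys_iff lookup_scaleC scaleC_complex_def)
    then show ?thesis
      by (simp add: ext_superset[of "Poly_Mapping.keys q"] lookup_scaleC scaleC_complex_def
          scaleC_scaleC complex_vector.scale_sum_right)
  qed
  ultimately have lin: "clinear ext" by (rule clinearI)
  then interpret ext: Vector_Spaces.linear scaleC scaleC ext .
  have single: "ext (Poly_Mapping.single k c) = c *\<^sub>C h (fst k) (snd k)" for k c
    by (simp add: ext_superset[of "{k}"])
  have h_left: "h (x + x') y = h x y + h x' y" "h (c *\<^sub>C x) y = c *\<^sub>C h x y" for x x' y c
    using h clinear_add[of "\<lambda>x. h x y" x x'] clinear_scaleC[of "\<lambda>x. h x y" c x]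
    by (simp_all add: cbilinear_def)
  have h_right: "h x (y + y') = h x y + h x y'" "h x (c *\<^sub>C y) = c *\<^sub>C h x y" for x y y' c
    using h by (simp_all add: cbilinear_def clinear_add clinear_scaleC)
  have rel: "ext r = 0" if "r \<in> tensor_relations" for r
    using that
    by (auto simp: tensor_relations_def single ext.diff scaleC_one h_left h_right)
  have "ext r = 0" if "r \<in> complex_vector.span tensor_relations" for r
    using that rel by (rule ext.eq_0_on_span[rotated])
  moreover have "tensor_eq (rep_tensor t) p"
    using t by (metis Quotient3_rep_abs Quotient3_tensor equivp_reflp tensor_equivp)
  ultimately have "ext (rep_tensor t) = ext p"
    unfolding tensor_eq_def using ext.diff by fastforce
  then show ?thesis
    by (simp add: sweedler_def ext_def case_prod_unfold)
qed

lemma sweedler_pure_tensor: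
  assumes "cbilinear h"
  shows "sweedler (x \<otimes> y) h = h x y"
  using sweedler_eval[OF assms, of "x \<otimes> y" "Poly_Mapping.single (x, y) 1"]
  by (simp add: pure_tensor.abs_eq scaleC_one)


section \<open>Hopf algebras and matched pairs of Hopf algebras\<close>

definition hopf_algebra ::
  "('h::complex_algebra_1 \<Rightarrow> 'h \<otimes> 'h) \<Rightarrow> ('h \<Rightarrow> complex) \<Rightarrow> ('h \<Rightarrow> 'h) \<Rightarrow> bool"
  where "hopf_algebra \<Delta> \<epsilon> S \<longleftrightarrow>
    clinear \<Delta> \<and> clinear \<epsilon> \<and> clinear S \<and>
    (\<forall>a. sweedler (\<Delta> a) (\<lambda>a1 a2. sweedler (\<Delta> a1) (\<lambda>b c. b \<otimes> c \<otimes> a2)) =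
         sweedler (\<Delta> a) (\<lambda>a1 a2. sweedler (\<Delta> a2) (\<lambda>b c. a1 \<otimes> b \<otimes> c))) \<and>
    (\<forall>a. sweedler (\<Delta> a) (\<lambda>a1 a2. \<epsilon> a1 *\<^sub>C a2) = a) \<and>
    (\<forall>a. sweedler (\<Delta> a) (\<lambda>a1 a2. \<epsilon> a2 *\<^sub>C a1) = a) \<and>
    \<Delta> 1 = 1 \<otimes> 1 \<and>
    (\<forall>a b. \<Delta> (a * b) =
         sweedler (\<Delta> a) (\<lambda>a1 a2. sweedler (\<Delta> b) (\<lambda>b1 b2. (a1 * b1) \<otimes> (a2 * b2)))) \<and>
    \<epsilon> 1 = 1 \<and>
    (\<forall>a b. \<epsilon> (a * b) = \<epsilon> a * \<epsilon> b) \<and>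
    (\<forall>a. sweedler (\<Delta> a) (\<lambda>a1 a2. S a1 * a2) = \<epsilon> a *\<^sub>C 1) \<and>
    (\<forall>a. sweedler (\<Delta> a) (\<lambda>a1 a2. a1 * S a2) = \<epsilon> a *\<^sub>C 1)"

definition left_module ::
  "('u::complex_algebra_1 \<Rightarrow> 'f::complex_vector \<Rightarrow> 'f) \<Rightarrow> bool"
  where "left_module act \<longleftrightarrow>
    cbilinear act \<and> (\<forall>f. act 1 f = f) \<and> (\<forall>u v f. act (u * v) f = act u (act v f))"

definition left_module_algebra ::
  "('u::complex_algebra_1 \<Rightarrow> 'u \<otimes> 'u) \<Rightarrow> ('u \<Rightarrow> complex) \<Rightarrow>
   ('u \<Rightarrow> 'f::complex_algebra_1 \<Rightarrow> 'f) \<Rightarrow> bool"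
  where "left_module_algebra \<Delta> \<epsilon> act \<longleftrightarrow>
    left_module act \<and>
    (\<forall>u f g. act u (f * g) = sweedler (\<Delta> u) (\<lambda>u1 u2. act u1 f * act u2 g)) \<and>
    (\<forall>u. act u 1 = \<epsilon> u *\<^sub>C 1)"

definition right_comodule ::
  "('f::complex_vector \<Rightarrow> 'f \<otimes> 'f) \<Rightarrow> ('f \<Rightarrow> complex) \<Rightarrow>
   ('u::complex_vector \<Rightarrow> 'u \<otimes> 'f) \<Rightarrow> bool"
  where "right_comodule \<Delta> \<epsilon> coact \<longleftrightarrow>
    clinear coact \<and>
    (\<forall>u. sweedler (coact u) (\<lambda>u0 u1. sweedler (coact u0) (\<lambda>v f. v \<otimes> f \<otimes> u1)) =
         sweedler (coact u) (\<lambda>u0 u1. sweedler (\<Delta> u1) (\<lambda>f g. u0 \<otimes> f \<otimes> g))) \<and>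
    (\<forall>u. sweedler (coact u) (\<lambda>u0 u1. \<epsilon> u1 *\<^sub>C u0) = u)"

definition right_comodule_coalgebra ::
  "('f::complex_algebra_1 \<Rightarrow> 'f \<otimes> 'f) \<Rightarrow> ('f \<Rightarrow> complex) \<Rightarrow>
   ('u::complex_vector \<Rightarrow> 'u \<otimes> 'u) \<Rightarrow> ('u \<Rightarrow> complex) \<Rightarrow>
   ('u \<Rightarrow> 'u \<otimes> 'f) \<Rightarrow> bool"
  where "right_comodule_coalgebra \<Delta>\<^sub>F \<epsilon>\<^sub>F \<Delta>\<^sub>U \<epsilon>\<^sub>U coact \<longleftrightarrow>
    right_comodule \<Delta>\<^sub>F \<epsilon>\<^sub>F coact \<and>
    (\<forall>u. sweedler (coact u) (\<lambda>u0 f. sweedler (\<Delta>\<^sub>U u0) (\<lambda>v w. v \<otimes> w \<otimes> f)) =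
         sweedler (\<Delta>\<^sub>U u) (\<lambda>u1 u2. sweedler (coact u1) (\<lambda>v f. sweedler (coact u2) (\<lambda>w g.
           v \<otimes> w \<otimes> (f * g))))) \<and>
    (\<forall>u. sweedler (coact u) (\<lambda>u0 f. \<epsilon>\<^sub>U u0 *\<^sub>C f) = \<epsilon>\<^sub>U u *\<^sub>C 1)"

definition coaction_multiplicative ::
  "('u::complex_algebra_1 \<Rightarrow> 'u \<otimes> 'u) \<Rightarrow> ('u \<Rightarrow> 'f::complex_algebra_1 \<Rightarrow> 'f) \<Rightarrow>
   ('u \<Rightarrow> 'u \<otimes> 'f) \<Rightarrow> bool"
  where "coaction_multiplicative \<Delta> act coact \<longleftrightarrow>
    coact 1 = 1 \<otimes> 1 \<and>
    (\<forall>u v. coact (u * v) =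
       sweedler (\<Delta> u) (\<lambda>u1 u2. sweedler (coact u1) (\<lambda>u10 u11. sweedler (coact v) (\<lambda>v0 v1.
         (u10 * v0) \<otimes> (u11 * act u2 v1)))))"

definition matched_pair_of_hopf_algebras ::
  "('f::complex_algebra_1 \<Rightarrow> 'f \<otimes> 'f) \<Rightarrow> ('f \<Rightarrow> complex) \<Rightarrow> ('f \<Rightarrow> 'f) \<Rightarrow>
   ('u::complex_algebra_1 \<Rightarrow> 'u \<otimes> 'u) \<Rightarrow> ('u \<Rightarrow> complex) \<Rightarrow> ('u \<Rightarrow> 'u) \<Rightarrow>
   ('u \<Rightarrow> 'f \<Rightarrow> 'f) \<Rightarrow> ('u \<Rightarrow> 'u \<otimes> 'f) \<Rightarrow> bool"
  where "matched_pair_of_hopf_algebras \<Delta>\<^sub>F \<epsilon>\<^sub>F S\<^sub>F \<Delta>\<^sub>U \<epsilon>\<^sub>U S\<^sub>U act coact \<longleftrightarrow>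
    hopf_algebra \<Delta>\<^sub>F \<epsilon>\<^sub>F S\<^sub>F \<and>
    hopf_algebra \<Delta>\<^sub>U \<epsilon>\<^sub>U S\<^sub>U \<and>
    left_module_algebra \<Delta>\<^sub>U \<epsilon>\<^sub>U act \<and>
    right_comodule_coalgebra \<Delta>\<^sub>F \<epsilon>\<^sub>F \<Delta>\<^sub>U \<epsilon>\<^sub>U coact \<and>
    (\<forall>u f. \<epsilon>\<^sub>F (act u f) = \<epsilon>\<^sub>U u * \<epsilon>\<^sub>F f) \<and>
    (\<forall>u f. \<Delta>\<^sub>F (act u f) =
       sweedler (\<Delta>\<^sub>U u) (\<lambda>u1 u2. sweedler (coact u1) (\<lambda>u10 u11. sweedler (\<Delta>\<^sub>F f) (\<lambda>f1 f2.
         act u10 f1 \<otimes> (u11 * act u2 f2))))) \<and>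
    coaction_multiplicative \<Delta>\<^sub>U act coact \<and>
    (\<forall>u f. sweedler (\<Delta>\<^sub>U u) (\<lambda>u1 u2. sweedler (coact u2) (\<lambda>u20 u21. u20 \<otimes> (act u1 f * u21))) =
           sweedler (\<Delta>\<^sub>U u) (\<lambda>u1 u2. sweedler (coact u1) (\<lambda>u10 u11. u10 \<otimes> (u11 * act u2 f))))"


section \<open>Universal enveloping algebras\<close>

class complex_lie_algebra = complex_vector +
  fixes lie_bracket :: "'a \<Rightarrow> 'a \<Rightarrow> 'a"
  assumes lie_bracket_add_left: "lie_bracket (x + y) z = lie_bracket x z + lie_bracket y z"
    and lie_bracket_add_right: "lie_bracket x (y + z) = lie_bracket x y + lie_bracket x z"
    and lie_bracket_scaleC_left: "lie_bracket (c *\<^sub>C x) y = c *\<^sub>C lie_bracket x y"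
    and lie_bracket_scaleC_right: "lie_bracket x (c *\<^sub>C y) = c *\<^sub>C lie_bracket x y"
    and lie_bracket_self: "lie_bracket x x = 0"
    and lie_bracket_jacobi:
      "lie_bracket x (lie_bracket y z) + lie_bracket y (lie_bracket z x)
         + lie_bracket z (lie_bracket x y) = 0"

text \<open>\<open>'g free_monoid \<Rightarrow>\<^sub>0 complex\<close> with convolution is the free associative unital algebra on the
  set \<open>'g\<close>. Dividing it by linearity of the generators gives the tensor algebra of \<open>'g\<close>, so the
  quotient by all of \<open>uea_relations\<close> is the tensor algebra modulo \<open>x \<otimes> y - y \<otimes> x - [x, y]\<close>.\<close>

datatype 'a free_monoid = Word "'a list"

instantiation free_monoid :: (type) monoid_add
begin

definition zero_free_monoid :: "'a free_monoid"
  where "zero_free_monoid = Word []"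

fun plus_free_monoid :: "'a free_monoid \<Rightarrow> 'a free_monoid \<Rightarrow> 'a free_monoid"
  where "plus_free_monoid (Word v) (Word w) = Word (v @ w)"

instance
proof
  fix a b c :: "'a free_monoid"
  show "a + b + c = a + (b + c)" by (cases a; cases b; cases c) simp
  show "0 + a = a" by (cases a) (simp add: zero_free_monoid_def)
  show "a + 0 = a" by (cases a) (simp add: zero_free_monoid_def)
qed

end

definition free_gen :: "'g \<Rightarrow> ('g free_monoid \<Rightarrow>\<^sub>0 complex)"
  where "free_gen x = Poly_Mapping.single (Word [x]) 1"

definition uea_relations :: "('g::complex_lie_algebra free_monoid \<Rightarrow>\<^sub>0 complex) set"
  where "uea_relations =
    {free_gen (x + y) - free_gen x - free_gen y | x y. True} \<union>
    {free_gen (c *\<^sub>C x) - c *\<^sub>C free_gen x | c x. True} \<union>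
    {free_gen x * free_gen y - free_gen y * free_gen x - free_gen (lie_bracket x y) | x y. True}"

definition uea_ideal :: "('g::complex_lie_algebra free_monoid \<Rightarrow>\<^sub>0 complex) set"
  where "uea_ideal = complex_vector.span {a * r * b | a r b. r \<in> uea_relations}"

definition uea_eq :: "('g::complex_lie_algebra free_monoid \<Rightarrow>\<^sub>0 complex) \<Rightarrow>
    ('g free_monoid \<Rightarrow>\<^sub>0 complex) \<Rightarrow> bool"
  where "uea_eq p q \<longleftrightarrow> p - q \<in> uea_ideal"

quotient_type (overloaded) 'g uea = "'g::complex_lie_algebra free_monoid \<Rightarrow>\<^sub>0 complex" / uea_eq
  unfolding uea_eq_def uea_ideal_def by (rule span_diff_equivp)

lemma scaleC_free_algebra_left:
  fixes p q :: "'m::monoid_add \<Rightarrow>\<^sub>0 complex"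
  shows "(c *\<^sub>C p) * q = c *\<^sub>C (p * q)"
proof -
  have "c *\<^sub>C r = Poly_Mapping.single 0 c * r" for r :: "'m \<Rightarrow>\<^sub>0 complex"
  proof -
    have "c *\<^sub>C r = Poly_Mapping.map ((*) c) r"
      by (intro poly_mapping_eqI) (simp add: lookup_scaleC Poly_Mapping.map.rep_eq when_def scaleC_complex_def)
    then show ?thesis by (simp add: mult_map_scale_conv_mult)
  qed
  then show ?thesis by (simp add: mult.assoc)
qed

lemma scaleC_free_algebra_right:
  fixes p q :: "'m::monoid_add \<Rightarrow>\<^sub>0 complex"
  shows "p * (c *\<^sub>C q) = c *\<^sub>C (p * q)"
proof (induction p rule: update_induct)
  case const
  show ?case by simp
next
  case (update p m d)
  have upd: "Poly_Mapping.update m d p = p + Poly_Mapping.single m d"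
    using update by (auto intro!: poly_mapping_eqI simp: lookup_update lookup_add lookup_single when_def
        in_keys_iff)
  have "Poly_Mapping.single m d * (c *\<^sub>C q) = c *\<^sub>C (Poly_Mapping.single m d * q)"
  proof (induction q rule: update_induct)
    case const
    show ?case by simp
  next
    case (update q n e)
    have upd: "Poly_Mapping.update n e q = q + Poly_Mapping.single n e"
      using update by (auto intro!: poly_mapping_eqI simp: lookup_update lookup_add lookup_single when_def
          in_keys_iff)
    have sc: "c *\<^sub>C Poly_Mapping.single k a = Poly_Mapping.single k (c * a)" for k :: 'm and a
      by (intro poly_mapping_eqI) (simp add: lookup_scaleC lookup_single when_def scaleC_complex_def)
    show ?case
      using update.IH
      by (simp add: upd distrib_left scaleC_add_right sc mult_single mult.left_commute)
  qed
  with update.IH show ?case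
    by (simp add: upd distrib_right scaleC_add_right)
qed

lemma uea_ideal_mult:
  assumes "r \<in> uea_ideal"
  shows "a * r \<in> uea_ideal" and "r * a \<in> uea_ideal"
proof -
  let ?R = "{a * r * b | a r b. r \<in> uea_relations}"
  from assms have r: "r \<in> complex_vector.span ?R" by (simp add: uea_ideal_def)
  have "a * r \<in> complex_vector.span ?R"
    using r
  proof (induction rule: complex_vector.span_induct_alt)
    case base
    show ?case by (simp add: complex_vector.span_zero)
  next
    case (step c x y)
    then obtain d s b where "x = d * s * b" "s \<in> uea_relations" by blast
    then have "a * x = (a * d) * s * b" "s \<in> uea_relations" by (simp_all add: mult.assoc)
    then have "a * x \<in> ?R" by blast
    with step show ?case
      by (simp add: distrib_left scaleC_free_algebra_right complex_vector.span_add
          complex_vector.span_scale complex_vector.span_base)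
  qed
  then show "a * r \<in> uea_ideal" by (simp add: uea_ideal_def)
  have "r * a \<in> complex_vector.span ?R"
    using r
  proof (induction rule: complex_vector.span_induct_alt)
    case base
    show ?case by (simp add: complex_vector.span_zero)
  next
    case (step c x y)
    then obtain d s b where "x = d * s * b" "s \<in> uea_relations" by blast
    then have "x * a = d * s * (b * a)" "s \<in> uea_relations" by (simp_all add: mult.assoc)
    then have "x * a \<in> ?R" by blast
    with step show ?case
      by (simp add: distrib_right scaleC_free_algebra_left complex_vector.span_add
          complex_vector.span_scale complex_vector.span_base)
  qed
  then show "r * a \<in> uea_ideal" by (simp add: uea_ideal_def)
qed


lemma uea_eq_refl: "uea_eq p p"
  by (rule equivp_reflp[OF uea_equivp])

lemma lookup_mult_zero:
  fixes p q :: "'a free_monoid \<Rightarrow>\<^sub>0 complex"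
  shows "Poly_Mapping.lookup (p * q) 0 = Poly_Mapping.lookup p 0 * Poly_Mapping.lookup q 0"
proof -
  have iff: "0 = v + w \<longleftrightarrow> v = 0 \<and> w = 0" for v w :: "'a free_monoid"
    by (cases v; cases w) (auto simp: zero_free_monoid_def)
  have 1: "(\<Sum>w. Poly_Mapping.lookup q w when 0 = v + w) = (Poly_Mapping.lookup q 0 when v = 0)" for v
    unfolding iff by (cases "v = 0") (simp_all add: Sum_any_when_equal)
  have "Poly_Mapping.lookup (p * q) 0 =
      (\<Sum>v. (Poly_Mapping.lookup p v * Poly_Mapping.lookup q 0) when v = 0)"
    unfolding lookup_mult 1 by (simp add: mult_when)
  then show ?thesis by (simp add: Sum_any_when_equal)
qed

lemma uea_ideal_lookup_zero:
  assumes "r \<in> uea_ideal"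
  shows "Poly_Mapping.lookup r 0 = 0"
  using assms unfolding uea_ideal_def
proof (induction rule: complex_vector.span_induct_alt)
  case base
  show ?case by simp
next
  case (step c x y)
  have gen: "Poly_Mapping.lookup (free_gen z) 0 = 0" for z :: 'a
    by (simp add: free_gen_def lookup_single zero_free_monoid_def)
  from step.hyps obtain a s b where x: "x = a * s * b" and s: "s \<in> uea_relations" by blast
  from s have "Poly_Mapping.lookup s 0 = 0"
    by (auto simp: uea_relations_def lookup_minus lookup_scaleC lookup_mult_zero gen
        complex_vector.scale_zero_right)
  with step.IH show ?case
    by (simp add: x lookup_add lookup_scaleC lookup_mult_zero complex_vector.scale_zero_right)
qed

instantiation uea :: (complex_lie_algebra) complex_algebra_1
begin

lift_definition zero_uea :: "'a uea" is 0 .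

lift_definition one_uea :: "'a uea" is 1 .

lift_definition plus_uea :: "'a uea \<Rightarrow> 'a uea \<Rightarrow> 'a uea" is "(+)"
  unfolding uea_eq_def uea_ideal_def by (rule span_diff_ops)

lift_definition uminus_uea :: "'a uea \<Rightarrow> 'a uea" is uminus
  unfolding uea_eq_def uea_ideal_def by (rule span_diff_ops)

lift_definition minus_uea :: "'a uea \<Rightarrow> 'a uea \<Rightarrow> 'a uea" is "(-)"
  unfolding uea_eq_def uea_ideal_def by (rule span_diff_ops)

lift_definition scaleC_uea :: "complex \<Rightarrow> 'a uea \<Rightarrow> 'a uea" is scaleC
  unfolding uea_eq_def uea_ideal_def by (rule span_diff_ops)

lift_definition times_uea :: "'a uea \<Rightarrow> 'a uea \<Rightarrow> 'a uea" is "(*)"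
proof -
  fix p1 p2 q1 q2 :: "'a free_monoid \<Rightarrow>\<^sub>0 complex"
  assume "uea_eq p1 p2" "uea_eq q1 q2"
  moreover have "p1 * q1 - p2 * q2 = (p1 - p2) * q1 + p2 * (q1 - q2)"
    by (simp add: algebra_simps)
  moreover have "x + y \<in> uea_ideal" if "x \<in> uea_ideal" "y \<in> uea_ideal"
    for x y :: "'a free_monoid \<Rightarrow>\<^sub>0 complex"
    using that unfolding uea_ideal_def by (rule complex_vector.span_add)
  ultimately show "uea_eq (p1 * q1) (p2 * q2)"
    unfolding uea_eq_def by (simp add: uea_ideal_mult)
qed

instance
proof
  fix x y z :: "'a uea" and a b :: complex
  show "x + y + z = x + (y + z)" by transfer (simp add: add.assoc uea_eq_refl)
  show "x + y = y + x" by transfer (simp add: add.commute uea_eq_refl)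
  show "0 + x = x" by transfer (simp add: uea_eq_refl)
  show "- x + x = 0" by transfer (simp add: uea_eq_refl)
  show "x - y = x + - y" by transfer (simp add: uea_eq_refl)
  show "a *\<^sub>C (x + y) = a *\<^sub>C x + a *\<^sub>C y"
    by transfer (simp add: scaleC_add_right uea_eq_refl)
  show "(a + b) *\<^sub>C x = a *\<^sub>C x + b *\<^sub>C x"
    by transfer (simp add: scaleC_add_left uea_eq_refl)
  show "a *\<^sub>C b *\<^sub>C x = (a * b) *\<^sub>C x"
    by transfer (simp add: scaleC_scaleC uea_eq_refl)
  show "1 *\<^sub>C x = x" by transfer (simp add: scaleC_one uea_eq_refl)
  show "x * y * z = x * (y * z)" by transfer (simp add: mult.assoc uea_eq_refl)
  show "1 * x = x" by transfer (simp add: uea_eq_refl)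
  show "x * 1 = x" by transfer (simp add: uea_eq_refl)
  show "(x + y) * z = x * z + y * z" by transfer (simp add: distrib_right uea_eq_refl)
  show "x * (y + z) = x * y + x * z" by transfer (simp add: distrib_left uea_eq_refl)
  show "a *\<^sub>C x * y = a *\<^sub>C (x * y)"
    by transfer (simp add: scaleC_free_algebra_left uea_eq_refl)
  show "x * a *\<^sub>C y = a *\<^sub>C (x * y)"
    by transfer (simp add: scaleC_free_algebra_right uea_eq_refl)
  show "(0 :: 'a uea) \<noteq> 1"
    by transfer (auto simp: uea_eq_def lookup_one dest: uea_ideal_lookup_zero)
qed

end

lift_definition uea_inj :: "'g::complex_lie_algebra \<Rightarrow> 'g uea" (\<open>\<iota>\<close>) is free_gen .

definition uea_comult :: "'g::complex_lie_algebra uea \<Rightarrow> 'g uea \<otimes> 'g uea"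
  where "uea_comult = (THE \<Delta>. clinear \<Delta> \<and> \<Delta> 1 = 1 \<otimes> 1 \<and>
    (\<forall>u v. \<Delta> (u * v) =
      sweedler (\<Delta> u) (\<lambda>u1 u2. sweedler (\<Delta> v) (\<lambda>v1 v2. (u1 * v1) \<otimes> (u2 * v2)))) \<and>
    (\<forall>x. \<Delta> (\<iota> x) = \<iota> x \<otimes> 1 + 1 \<otimes> \<iota> x))"

definition uea_counit :: "'g::complex_lie_algebra uea \<Rightarrow> complex"
  where "uea_counit = (THE \<epsilon>. clinear \<epsilon> \<and> \<epsilon> 1 = 1 \<and> (\<forall>u v. \<epsilon> (u * v) = \<epsilon> u * \<epsilon> v) \<and>
    (\<forall>x. \<epsilon> (\<iota> x) = 0))"

definition uea_antipode :: "'g::complex_lie_algebra uea \<Rightarrow> 'g uea"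
  where "uea_antipode = (THE S. clinear S \<and> S 1 = 1 \<and> (\<forall>u v. S (u * v) = S v * S u) \<and>
    (\<forall>x. S (\<iota> x) = - \<iota> x))"


section \<open>Affine algebraic groups\<close>

text \<open>The subalgebra of functions generated by a set of functions.\<close>

inductive_set polynomials_in :: "('x \<Rightarrow> complex) set \<Rightarrow> ('x \<Rightarrow> complex) set"
  for X :: "('x \<Rightarrow> complex) set" where
  polynomials_in_const: "(\<lambda>_. c) \<in> polynomials_in X"
| polynomials_in_gen: "f \<in> X \<Longrightarrow> f \<in> polynomials_in X"
| polynomials_in_add:
    "f \<in> polynomials_in X \<Longrightarrow> g \<in> polynomials_in X \<Longrightarrow> (\<lambda>x. f x + g x) \<in> polynomials_in X"
| polynomials_in_mult:
    "f \<in> polynomials_in X \<Longrightarrow> g \<in> polynomials_in X \<Longrightarrow> (\<lambda>x. f x * g x) \<in> polynomials_in X"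

text \<open>\<open>coord\<close> embeds the type as a Zariski closed subset of complex affine \<open>n\<close>-space, whose points
  are encoded as sequences vanishing from index \<open>n\<close> on.\<close>

class affine_algebraic_set =
  fixes coord :: "'a \<Rightarrow> nat \<Rightarrow> complex"
  assumes coord_inject: "coord x = coord y \<Longrightarrow> x = y"
    and range_coord: "\<exists>n S. S \<subseteq> polynomials_in {\<lambda>z. z i | i. i < n} \<and>
      range coord = {z. (\<forall>i\<ge>n. z i = 0) \<and> (\<forall>p\<in>S. p z = 0)}"

context affine_algebraic_set
begin

definition polynomial_functions :: "('a \<Rightarrow> complex) set"
  where "polynomial_functions = polynomials_in {\<lambda>x. coord x i | i. True}"

definition zariski_closed :: "'a set \<Rightarrow> bool"
  where "zariski_closed A \<longleftrightarrow> (\<exists>S\<subseteq>polynomial_functions. A = {x. \<forall>f\<in>S. f x = 0})"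

end

text \<open>A map from a product is regular if its coordinates are polynomials in the coordinates of both
  arguments. In the class below this condition on the multiplication is written out, because the
  type of the product is not available there.\<close>

definition regular_map2 ::
  "('a::affine_algebraic_set \<Rightarrow> 'b::affine_algebraic_set \<Rightarrow> 'c::affine_algebraic_set) \<Rightarrow> bool"
  where "regular_map2 h \<longleftrightarrow> (\<forall>i. (\<lambda>(x, y). coord (h x y) i) \<in>
    polynomials_in ({\<lambda>(x, y). coord x j | j. True} \<union> {\<lambda>(x, y). coord y j | j. True}))"

class affine_algebraic_group = affine_algebraic_set + monoid_mult +
  fixes ginv :: "'a \<Rightarrow> 'a"
  assumes ginv_left: "ginv x * x = 1"
    and regular_mult: "(\<lambda>(x, y). coord (x * y) i) \<in>
      polynomials_in ({\<lambda>(x, y). coord x j | j. True} \<union> {\<lambda>(x, y). coord y j | j. True})"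
    and regular_ginv: "(\<lambda>x. coord (ginv x) i) \<in> polynomial_functions"
    and connected: "zariski_closed A \<Longrightarrow> zariski_closed B \<Longrightarrow> A \<union> B = UNIV \<Longrightarrow>
      A \<inter> B = {} \<Longrightarrow> A = {} \<or> B = {}"

lemma regular_map2_mult: "regular_map2 ((*) :: 'a \<Rightarrow> 'a \<Rightarrow> 'a::affine_algebraic_group)"
  unfolding regular_map2_def by (intro allI regular_mult)


subsection \<open>The Hopf algebra of polynomial functions\<close>

typedef (overloaded) 'a polyfun = "polynomial_functions :: ('a::affine_algebraic_set \<Rightarrow> complex) set"
  morphisms pf_eval Abs_polyfun
  by (auto simp: polynomial_functions_def intro: polynomials_in_const)

setup_lifting type_definition_polyfun

instantiation polyfun :: (affine_algebraic_set) "{comm_ring_1, complex_algebra_1}"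
begin

lift_definition zero_polyfun :: "'a polyfun" is "\<lambda>_. 0"
  unfolding polynomial_functions_def by (rule polynomials_in_const)

lift_definition one_polyfun :: "'a polyfun" is "\<lambda>_. 1"
  unfolding polynomial_functions_def by (rule polynomials_in_const)

lift_definition plus_polyfun :: "'a polyfun \<Rightarrow> 'a polyfun \<Rightarrow> 'a polyfun" is "\<lambda>f g x. f x + g x"
  unfolding polynomial_functions_def by (rule polynomials_in_add)

lift_definition times_polyfun :: "'a polyfun \<Rightarrow> 'a polyfun \<Rightarrow> 'a polyfun" is "\<lambda>f g x. f x * g x"
  unfolding polynomial_functions_def by (rule polynomials_in_mult)

lift_definition scaleC_polyfun :: "complex \<Rightarrow> 'a polyfun \<Rightarrow> 'a polyfun" is "\<lambda>c f x. c * f x"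
  unfolding polynomial_functions_def by (intro polynomials_in_mult polynomials_in_const)

lift_definition uminus_polyfun :: "'a polyfun \<Rightarrow> 'a polyfun" is "\<lambda>f x. - 1 * f x"
  unfolding polynomial_functions_def by (intro polynomials_in_mult polynomials_in_const)

lift_definition minus_polyfun :: "'a polyfun \<Rightarrow> 'a polyfun \<Rightarrow> 'a polyfun"
  is "\<lambda>f g x. f x + - 1 * g x"
  unfolding polynomial_functions_def
  by (intro polynomials_in_add polynomials_in_mult polynomials_in_const)

instance
  by standard (transfer; simp add: algebra_simps fun_eq_iff)+

end

text \<open>The tensor with \<open>\<Sum>\<^sub>k a\<^sub>k x b\<^sub>k y = h x y\<close>, i.e. the preimage of \<open>h\<close> under the isomorphism from
  the tensor product of the two coordinate rings to the coordinate ring of the product.\<close>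

definition split_function :: "('a::affine_algebraic_set \<Rightarrow> 'b::affine_algebraic_set \<Rightarrow> complex) \<Rightarrow>
    'a polyfun \<otimes> 'b polyfun"
  where "split_function h =
    (THE t. \<forall>x y. sweedler t (\<lambda>a b. pf_eval a x * pf_eval b y) = h x y)"

definition pf_comult :: "'a::affine_algebraic_group polyfun \<Rightarrow> 'a polyfun \<otimes> 'a polyfun"
  where "pf_comult f = split_function (\<lambda>x y. pf_eval f (x * y))"

definition pf_counit :: "'a::affine_algebraic_group polyfun \<Rightarrow> complex"
  where "pf_counit f = pf_eval f 1"

definition pf_antipode :: "'a::affine_algebraic_group polyfun \<Rightarrow> 'a polyfun"
  where "pf_antipode f = Abs_polyfun (\<lambda>x. pf_eval f (ginv x))"


subsection \<open>The Lie algebra\<close>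

definition derivation_at_one :: "('a::affine_algebraic_group polyfun \<Rightarrow> complex) \<Rightarrow> bool"
  where "derivation_at_one X \<longleftrightarrow> clinear X \<and>
    (\<forall>f g. X (f * g) = pf_eval f 1 * X g + X f * pf_eval g 1)"

typedef (overloaded) 'a lie_algebra =
  "{X :: 'a::affine_algebraic_group polyfun \<Rightarrow> complex. derivation_at_one X}"
  morphisms lie_apply Abs_lie_algebra
proof
  show "(\<lambda>_. 0) \<in> {X :: 'a polyfun \<Rightarrow> complex. derivation_at_one X}"
    by (auto simp: derivation_at_one_def scaleC_complex_def intro: clinearI)
qed

setup_lifting type_definition_lie_algebra

lemma lie_apply_derivation: "derivation_at_one (lie_apply X)"
  using lie_apply by auto

lemma pf_eval_simps [simp]:
  "pf_eval (0 :: 'a::affine_algebraic_set polyfun) x = 0"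
  "pf_eval (1 :: 'a polyfun) x = 1"
  "pf_eval (f + g) x = pf_eval f x + pf_eval g x"
  "pf_eval (f * g) x = pf_eval f x * pf_eval g x"
  "pf_eval (c *\<^sub>C f) x = c * pf_eval f x"
  "pf_eval (- f) x = - pf_eval f x"
  "pf_eval (f - g) x = pf_eval f x - pf_eval g x"
  by (transfer; simp)+

lemma polyfun_eqI:
  fixes f g :: "'a::affine_algebraic_set polyfun"
  shows "(\<And>x. pf_eval f x = pf_eval g x) \<Longrightarrow> f = g"
  by transfer auto

lemma pf_eval_sum_list:
  fixes f :: "'i \<Rightarrow> 'a::affine_algebraic_set polyfun"
  shows "pf_eval (\<Sum>i\<leftarrow>is. f i) x = (\<Sum>i\<leftarrow>is. pf_eval (f i) x)"
  by (induction "is") auto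

lemma pf_eval_Abs_eq:
  fixes f :: "'a::affine_algebraic_set polyfun"
  assumes "\<And>x. h x = pf_eval f x"
  shows "Abs_polyfun h = f"
proof -
  have "h = pf_eval f" using assms by auto
  then show ?thesis by (simp add: pf_eval_inverse)
qed

lemma sum_list_mult_sum_list:
  fixes f :: "'i \<Rightarrow> complex"
  shows "(\<Sum>i\<leftarrow>is. f i) * (\<Sum>j\<leftarrow>js. g j) = (\<Sum>(i, j)\<leftarrow>List.product is js. f i * g j)"
proof (induction "is")
  case (Cons i "is")
  have "(\<Sum>j\<leftarrow>js. f i * g j) = f i * (\<Sum>j\<leftarrow>js. g j)"
    by (rule sum_list_const_mult)
  with Cons show ?case by (simp add: distrib_right comp_def)
qed simp

lemma polynomials_in_product_split:
  fixes h :: "'a::affine_algebraic_set \<times> 'b::affine_algebraic_set \<Rightarrow> complex"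
  assumes "h \<in> polynomials_in ({\<lambda>(x, y). coord x j | j. True} \<union> {\<lambda>(x, y). coord y j | j. True})"
  shows "\<exists>ps :: ('a polyfun \<times> 'b polyfun) list.
    \<forall>x y. h (x, y) = (\<Sum>p\<leftarrow>ps. pf_eval (fst p) x * pf_eval (snd p) y)"
  using assms
proof induction
  case (polynomials_in_const c)
  show ?case by (rule exI[of _ "[(c *\<^sub>C 1, 1)]"]) simp
next
  case (polynomials_in_gen f)
  have ev: "pf_eval (Abs_polyfun (\<lambda>x. coord x j)) x = coord x j"
    for j and x :: "'c::affine_algebraic_set"
    by (subst Abs_polyfun_inverse)
      (auto simp: polynomial_functions_def intro: polynomials_in.polynomials_in_gen)
  from polynomials_in_gen consider j where "f = (\<lambda>(x, y). coord x j)"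
    | j where "f = (\<lambda>(x, y). coord y j)" by blast
  then show ?case
  proof cases
    case 1
    then show ?thesis by (intro exI[of _ "[(Abs_polyfun (\<lambda>x. coord x j), 1)]"]) (simp add: ev)
  next
    case 2
    then show ?thesis by (intro exI[of _ "[(1, Abs_polyfun (\<lambda>x. coord x j))]"]) (simp add: ev)
  qed
next
  case (polynomials_in_add f g)
  then obtain ps qs :: "('a polyfun \<times> 'b polyfun) list"
    where "\<forall>x y. f (x, y) = (\<Sum>p\<leftarrow>ps. pf_eval (fst p) x * pf_eval (snd p) y)"
      and "\<forall>x y. g (x, y) = (\<Sum>p\<leftarrow>qs. pf_eval (fst p) x * pf_eval (snd p) y)" by blast
  then show ?case by (intro exI[of _ "ps @ qs"]) simp
next
  case (polynomials_in_mult f g)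
  then obtain ps qs :: "('a polyfun \<times> 'b polyfun) list"
    where "\<forall>x y. f (x, y) = (\<Sum>p\<leftarrow>ps. pf_eval (fst p) x * pf_eval (snd p) y)"
      and "\<forall>x y. g (x, y) = (\<Sum>p\<leftarrow>qs. pf_eval (fst p) x * pf_eval (snd p) y)" by blast
  then show ?case
    by (intro exI[of _ "map (\<lambda>(p, q). (fst p * fst q, snd p * snd q)) (List.product ps qs)"])
      (simp add: sum_list_mult_sum_list comp_def case_prod_unfold mult_ac)
qed

definition left_translate :: "'a::affine_algebraic_group \<Rightarrow> 'a polyfun \<Rightarrow> 'a polyfun"
  where "left_translate x f = Abs_polyfun (\<lambda>y. pf_eval f (x * y))"

text \<open>The action on functions of the left invariant vector field with value \<open>X\<close> at the
  identity.\<close>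

definition left_invariant_field :: "'a::affine_algebraic_group lie_algebra \<Rightarrow> 'a polyfun \<Rightarrow> 'a polyfun"
  where "left_invariant_field X f = Abs_polyfun (\<lambda>x. lie_apply X (left_translate x f))"

lemma polynomial_functions_closed:
  "(\<lambda>_. c) \<in> polynomial_functions"
  "f \<in> polynomial_functions \<Longrightarrow> g \<in> polynomial_functions \<Longrightarrow> (\<lambda>x. f x + g x) \<in> polynomial_functions"
  "f \<in> polynomial_functions \<Longrightarrow> g \<in> polynomial_functions \<Longrightarrow> (\<lambda>x. f x * g x) \<in> polynomial_functions"
  by (auto simp: polynomial_functions_def intro: polynomials_in.intros)

lemma polynomials_in_compose:
  assumes "f \<in> polynomials_in X" and "\<And>g. g \<in> X \<Longrightarrow> (\<lambda>y. g (h y)) \<in> polynomials_in Y"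
  shows "(\<lambda>y. f (h y)) \<in> polynomials_in Y"
  using assms(1) by induction (auto intro: assms(2) polynomials_in.intros)

lemma regular_map2_pullback:
  assumes "regular_map2 (h :: 'a::affine_algebraic_set \<Rightarrow> 'b::affine_algebraic_set \<Rightarrow>
    'c::affine_algebraic_set)"
  shows "\<exists>ps :: ('a polyfun \<times> 'b polyfun) list.
    \<forall>x y. pf_eval f (h x y) = (\<Sum>p\<leftarrow>ps. pf_eval (fst p) x * pf_eval (snd p) y)"
proof -
  have "pf_eval f \<in> polynomials_in {\<lambda>z. coord z i | i. True}"
    using pf_eval[of f] by (simp add: polynomial_functions_def)
  then have "(\<lambda>p. pf_eval f (case p of (x, y) \<Rightarrow> h x y)) \<in> polynomials_in
      ({\<lambda>(x, y). coord x j | j. True} \<union> {\<lambda>(x, y). coord y j | j. True})"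
  proof (rule polynomials_in_compose)
    fix g :: "'c \<Rightarrow> complex" assume "g \<in> {\<lambda>z. coord z i | i. True}"
    then obtain i where "g = (\<lambda>z. coord z i)" by blast
    then show "(\<lambda>p. g (case p of (x, y) \<Rightarrow> h x y)) \<in> polynomials_in
        ({\<lambda>(x, y). coord x j | j. True} \<union> {\<lambda>(x, y). coord y j | j. True})"
      using assms by (simp add: regular_map2_def case_prod_unfold)
  qed
  from polynomials_in_product_split[OF this] show ?thesis by simp
qed

lemma clinear_lie_apply: "clinear (lie_apply X)"
  using lie_apply_derivation[of X] by (simp add: derivation_at_one_def)

lemma lie_apply_simps [simp]:
  "lie_apply X (f + g) = lie_apply X f + lie_apply X g"
  "lie_apply X (c *\<^sub>C f) = c * lie_apply X f"
  "lie_apply X (f * g) = pf_eval f 1 * lie_apply X g + lie_apply X f * pf_eval g 1"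
  using lie_apply_derivation[of X] clinear_add[OF clinear_lie_apply]
    clinear_scaleC[OF clinear_lie_apply]
  by (simp_all add: derivation_at_one_def scaleC_complex_def)

lemma lie_apply_diff [simp]: "lie_apply X (f - g) = lie_apply X f - lie_apply X g"
  using lie_apply_simps(1)[of X "f - g" g] by simp

lemma lie_apply_zero [simp]: "lie_apply X 0 = 0"
  using lie_apply_simps(1)[of X 0 0] by simp

lemma lie_apply_sum_list: "lie_apply X (\<Sum>i\<leftarrow>is. f i) = (\<Sum>i\<leftarrow>is. lie_apply X (f i))"
by (induction "is") simp_all

lemma pf_eval_left_translate [simp]: "pf_eval (left_translate x f) y = pf_eval f (x * y)"
proof -
  obtain ps where ps: "\<forall>x y. pf_eval f (x * y) = (\<Sum>p\<leftarrow>ps. pf_eval (fst p) x * pf_eval (snd p) y)"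
    using regular_map2_pullback[OF regular_map2_mult] by blast
  have "left_translate x f = (\<Sum>p\<leftarrow>ps. pf_eval (fst p) x *\<^sub>C snd p)"
    unfolding left_translate_def by (rule pf_eval_Abs_eq) (simp add: ps pf_eval_sum_list)
  then show ?thesis by (simp add: ps pf_eval_sum_list)
qed

lemma pf_eval_left_invariant_field [simp]:
  "pf_eval (left_invariant_field X f) x = lie_apply X (left_translate x f)"
proof -
  obtain ps where ps: "\<forall>x y. pf_eval f (x * y) = (\<Sum>p\<leftarrow>ps. pf_eval (fst p) x * pf_eval (snd p) y)"
    using regular_map2_pullback[OF regular_map2_mult] by blast
  have tr: "left_translate x f = (\<Sum>p\<leftarrow>ps. pf_eval (fst p) x *\<^sub>C snd p)" for x
    unfolding left_translate_def by (rule pf_eval_Abs_eq) (simp add: ps pf_eval_sum_list)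
  have "left_invariant_field X f = (\<Sum>p\<leftarrow>ps. lie_apply X (snd p) *\<^sub>C fst p)"
    unfolding left_invariant_field_def
    by (rule pf_eval_Abs_eq) (simp add: tr pf_eval_sum_list lie_apply_sum_list mult.commute)
  then show ?thesis by (simp add: tr pf_eval_sum_list lie_apply_sum_list mult.commute)
qed

lemma left_translate_simps [simp]:
  "left_translate x (f + g) = left_translate x f + left_translate x g"
  "left_translate x (f * g) = left_translate x f * left_translate x g"
  "left_translate x (c *\<^sub>C f) = c *\<^sub>C left_translate x f"
  "left_translate x (left_translate y f) = left_translate (y * x) f"
  "left_translate 1 f = f"
  by (auto intro!: polyfun_eqI simp: mult.assoc)

lemma left_invariant_field_simps [simp]:
  "left_invariant_field X (f + g) = left_invariant_field X f + left_invariant_field X g"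
  "left_invariant_field X (c *\<^sub>C f) = c *\<^sub>C left_invariant_field X f"
  "left_invariant_field X (f * g) = f * left_invariant_field X g + left_invariant_field X f * g"
  "left_invariant_field X (left_translate x f) = left_translate x (left_invariant_field X f)"
  by (auto intro!: polyfun_eqI)

instantiation lie_algebra :: (affine_algebraic_group) complex_lie_algebra
begin

lift_definition zero_lie_algebra :: "'a lie_algebra" is "\<lambda>_. 0"
  by (auto simp: derivation_at_one_def scaleC_complex_def intro: clinearI)

lift_definition plus_lie_algebra :: "'a lie_algebra \<Rightarrow> 'a lie_algebra \<Rightarrow> 'a lie_algebra"
  is "\<lambda>X Y f. X f + Y f"
  by (auto simp: derivation_at_one_def clinear_add clinear_scaleC scaleC_add_right algebra_simps
      intro!: clinearI)

lift_definition minus_lie_algebra :: "'a lie_algebra \<Rightarrow> 'a lie_algebra \<Rightarrow> 'a lie_algebra"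
  is "\<lambda>X Y f. X f - Y f"
  by (auto simp: derivation_at_one_def clinear_add clinear_scaleC
      complex_vector.scale_right_diff_distrib algebra_simps intro!: clinearI)

lift_definition uminus_lie_algebra :: "'a lie_algebra \<Rightarrow> 'a lie_algebra"
  is "\<lambda>X f. - X f"
  by (auto simp: derivation_at_one_def clinear_add clinear_scaleC algebra_simps intro!: clinearI)

lift_definition scaleC_lie_algebra :: "complex \<Rightarrow> 'a lie_algebra \<Rightarrow> 'a lie_algebra"
  is "\<lambda>c X f. c * X f"
  by (auto simp: derivation_at_one_def clinear_add clinear_scaleC scaleC_complex_def algebra_simps
      intro!: clinearI)

definition lie_bracket_lie_algebra :: "'a lie_algebra \<Rightarrow> 'a lie_algebra \<Rightarrow> 'a lie_algebra"
  where "lie_bracket_lie_algebra X Y = Abs_lie_algebra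
    (\<lambda>f. lie_apply X (left_invariant_field Y f) - lie_apply Y (left_invariant_field X f))"

lemma lie_algebra_eqI:
  fixes X Y :: "'a lie_algebra"
  shows "(\<And>f. lie_apply X f = lie_apply Y f) \<Longrightarrow> X = Y"
  by transfer auto

lemma lie_apply_ops [simp]:
  fixes X Y :: "'a lie_algebra"
  shows "lie_apply 0 f = 0" "lie_apply (X + Y) f = lie_apply X f + lie_apply Y f"
    "lie_apply (c *\<^sub>C X) f = c * lie_apply X f"
  by (transfer; simp)+

lemma lie_apply_lie_bracket [simp]:
  fixes X Y :: "'a lie_algebra"
  shows "lie_apply (lie_bracket X Y) f =
    lie_apply X (left_invariant_field Y f) - lie_apply Y (left_invariant_field X f)"
proof -
  have "derivation_at_one
      (\<lambda>f. lie_apply X (left_invariant_field Y f) - lie_apply Y (left_invariant_field X f))"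
    unfolding derivation_at_one_def
    by (auto intro!: clinearI simp: scaleC_complex_def algebra_simps)
  then show ?thesis
    unfolding lie_bracket_lie_algebra_def by (simp add: Abs_lie_algebra_inverse)
qed

lemma left_invariant_field_ops [simp]:
  fixes X Y :: "'a lie_algebra"
  shows "left_invariant_field (X + Y) f = left_invariant_field X f + left_invariant_field Y f"
    and "left_invariant_field (c *\<^sub>C X) f = c *\<^sub>C left_invariant_field X f"
    and "left_invariant_field (lie_bracket X Y) f =
      left_invariant_field X (left_invariant_field Y f)
      - left_invariant_field Y (left_invariant_field X f)"
  by (auto intro!: polyfun_eqI simp flip: left_invariant_field_simps(4))

instance
proof
  fix X Y Z :: "'a lie_algebra" and a b c :: complex
  show "X + Y + Z = X + (Y + Z)" by transfer (simp add: add.assoc)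
  show "X + Y = Y + X" by transfer (simp add: add.commute)
  show "0 + X = X" by transfer simp
  show "- X + X = 0" by transfer simp
  show "X - Y = X + - Y" by transfer simp
  show "a *\<^sub>C (X + Y) = a *\<^sub>C X + a *\<^sub>C Y" by transfer (simp add: distrib_left)
  show "(a + b) *\<^sub>C X = a *\<^sub>C X + b *\<^sub>C X" by transfer (simp add: distrib_right)
  show "a *\<^sub>C b *\<^sub>C X = (a * b) *\<^sub>C X" by transfer (simp add: mult.assoc)
  show "1 *\<^sub>C X = X" by transfer simp
  show "lie_bracket (X + Y) Z = lie_bracket X Z + lie_bracket Y Z"
    by (rule lie_algebra_eqI) simp
  show "lie_bracket X (Y + Z) = lie_bracket X Y + lie_bracket X Z"
    by (rule lie_algebra_eqI) simp
  show "lie_bracket (c *\<^sub>C X) Y = c *\<^sub>C lie_bracket X Y"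
    by (rule lie_algebra_eqI) (simp add: algebra_simps)
  show "lie_bracket X (c *\<^sub>C Y) = c *\<^sub>C lie_bracket X Y"
    by (rule lie_algebra_eqI) (simp add: algebra_simps)
  show "lie_bracket X X = 0"
    by (rule lie_algebra_eqI) simp
  show "lie_bracket X (lie_bracket Y Z) + lie_bracket Y (lie_bracket Z X)
      + lie_bracket Z (lie_bracket X Y) = 0"
    by (rule lie_algebra_eqI) simp
qed

end

text \<open>A basis of the Lie algebra is finite, so sums over a basis are genuine.\<close>

lemma lie_apply_eq_zero:
  fixes X :: "'a::affine_algebraic_group lie_algebra"
  assumes "\<And>i. lie_apply X (Abs_polyfun (\<lambda>x. coord x i)) = 0"
  shows "lie_apply X f = 0"
proof -
  have one: "lie_apply X 1 = 0"
    using lie_apply_simps(3)[of X 1 1] by simp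
  have "f \<in> polynomials_in {\<lambda>x. coord x i | i. True} \<Longrightarrow> lie_apply X (Abs_polyfun f) = 0" for f
  proof (induction rule: polynomials_in.induct)
    case (polynomials_in_const c)
    have "(Abs_polyfun (\<lambda>_. c) :: 'a polyfun) = c *\<^sub>C 1" by (rule pf_eval_Abs_eq) simp
    then show ?case by (simp add: one)
  next
    case (polynomials_in_gen f)
    then show ?case using assms by auto
  next
    case (polynomials_in_add f g)
    then have "Abs_polyfun (\<lambda>x. f x + g x) = Abs_polyfun f + Abs_polyfun g"
      by (intro pf_eval_Abs_eq) (simp add: Abs_polyfun_inverse polynomial_functions_def)
    with polynomials_in_add show ?case by simp
  next
    case (polynomials_in_mult f g)
    then have "Abs_polyfun (\<lambda>x. f x * g x) = Abs_polyfun f * Abs_polyfun g"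
      by (intro pf_eval_Abs_eq) (simp add: Abs_polyfun_inverse polynomial_functions_def)
    with polynomials_in_mult show ?case by simp
  qed
  from this[of "pf_eval f"] show ?thesis
    using pf_eval[of f] by (simp add: polynomial_functions_def pf_eval_inverse)
qed

lemma finite_lie_algebra_basis:
  assumes "complex_vector.independent (B :: 'a::affine_algebraic_group lie_algebra set)"
  shows "finite B"
proof -
  obtain n where n: "\<And>x :: 'a. \<And>i. i \<ge> n \<Longrightarrow> coord x i = 0"
    using range_coord[where 'a = 'a] by blast
  define c :: "nat \<Rightarrow> 'a polyfun" where "c i = Abs_polyfun (\<lambda>x. coord x i)" for i
  have c0: "c i = 0" if "i \<ge> n" for i
    unfolding c_def using n that by (intro pf_eval_Abs_eq) simp
  define T :: "'a lie_algebra \<Rightarrow> nat \<Rightarrow>\<^sub>0 complex"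
    where "T X = (\<Sum>i<n. Poly_Mapping.single i (lie_apply X (c i)))" for X
  have lookup_T: "Poly_Mapping.lookup (T X) i = (if i < n then lie_apply X (c i) else 0)" for X i
    by (simp add: T_def lookup_sum lookup_single when_def sum.delta)
  have lin: "clinear T"
    by (intro clinearI poly_mapping_eqI)
      (simp_all add: lookup_T lookup_add lookup_scaleC scaleC_complex_def)
  then interpret T: Vector_Spaces.linear scaleC scaleC T .
  have inj: "inj T"
  proof (subst T.inj_iff_eq_0, safe)
    fix X assume TX: "T X = 0"
    have "lie_apply X (c i) = 0" for i
    proof (cases "i < n")
      case True
      with lookup_T[of X i] TX show ?thesis by simp
    next
      case False
      with c0[of i] show ?thesis by simp
    qed
    then have "lie_apply X f = 0" for f
      unfolding c_def by (rule lie_apply_eq_zero)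
    then show "X = 0" by (intro lie_algebra_eqI) simp
  qed
  have "T X \<in> complex_vector.span ((\<lambda>i. Poly_Mapping.single i 1) ` {..<n})" for X
  proof -
    have scaled: "Poly_Mapping.single i a = a *\<^sub>C (Poly_Mapping.single i 1 :: nat \<Rightarrow>\<^sub>0 complex)" for i a
      by (intro poly_mapping_eqI) (simp add: lookup_scaleC lookup_single when_def scaleC_complex_def)
    have "Poly_Mapping.single i a \<in> complex_vector.span ((\<lambda>i. Poly_Mapping.single i 1) ` {..<n})"
      if "i < n" for i and a :: complex
      using that by (subst scaled) (blast intro: complex_vector.span_scale complex_vector.span_base)
    then show ?thesis
      unfolding T_def by (intro complex_vector.span_sum) simp
  qed
  then have "T ` B \<subseteq> complex_vector.span ((\<lambda>i. Poly_Mapping.single i 1) ` {..<n})" by blast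
  moreover have "complex_vector.independent (T ` B)"
    using T.independent_injective_image[OF assms] inj by (simp add: inj_on_subset)
  ultimately have "finite (T ` B)"
    using complex_vector.independent_span_bound[of "(\<lambda>i. Poly_Mapping.single i 1) ` {..<n}"] by blast
  then show ?thesis using inj by (meson finite_imageD inj_on_subset subset_UNIV)
qed


section \<open>Matched pairs of affine algebraic groups\<close>

definition matched_pair_of_groups ::
  "('g2::affine_algebraic_group \<Rightarrow> 'g1::affine_algebraic_group \<Rightarrow> 'g1) \<Rightarrow>
   ('g2 \<Rightarrow> 'g1 \<Rightarrow> 'g2) \<Rightarrow> bool"
  where "matched_pair_of_groups lact ract \<longleftrightarrow>
    regular_map2 lact \<and> regular_map2 ract \<and>
    (\<forall>\<psi> \<psi>' \<phi>. lact (\<psi> * \<psi>') \<phi> = lact \<psi> (lact \<psi>' \<phi>)) \<and>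
    (\<forall>\<phi>. lact 1 \<phi> = \<phi>) \<and>
    (\<forall>\<psi> \<phi> \<phi>'. ract \<psi> (\<phi> * \<phi>') = ract (ract \<psi> \<phi>) \<phi>') \<and>
    (\<forall>\<psi>. ract \<psi> 1 = \<psi>) \<and>
    (\<forall>\<psi> \<phi> \<phi>'. lact \<psi> (\<phi> * \<phi>') = lact \<psi> \<phi> * lact (ract \<psi> \<phi>) \<phi>') \<and>
    (\<forall>\<psi>. lact \<psi> 1 = 1) \<and>
    (\<forall>\<psi> \<psi>' \<phi>. ract (\<psi> * \<psi>') \<phi> = ract \<psi> (lact \<psi>' \<phi>) * ract \<psi>' \<phi>) \<and>
    (\<forall>\<phi>. ract 1 \<phi> = 1)"

definition lie_action_on_functions ::
  "('g2::affine_algebraic_group \<Rightarrow> 'g1::affine_algebraic_group \<Rightarrow> 'g2) \<Rightarrow>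
   'g1 lie_algebra \<Rightarrow> 'g2 polyfun \<Rightarrow> 'g2 polyfun"
  where "lie_action_on_functions ract X f =
    sweedler (split_function (\<lambda>\<psi> \<phi>. pf_eval f (ract \<psi> \<phi>))) (\<lambda>f0 f1. lie_apply X f1 *\<^sub>C f0)"

text \<open>The differential at the identity of \<open>lact \<psi>\<close>.\<close>

definition group_action_on_lie ::
  "('g2::affine_algebraic_group \<Rightarrow> 'g1::affine_algebraic_group \<Rightarrow> 'g1) \<Rightarrow>
   'g2 \<Rightarrow> 'g1 lie_algebra \<Rightarrow> 'g1 lie_algebra"
  where "group_action_on_lie lact \<psi> X =
    Abs_lie_algebra (\<lambda>f. lie_apply X (Abs_polyfun (\<lambda>\<phi>. pf_eval f (lact \<psi> \<phi>))))"

text \<open>The functions with \<open>\<psi> \<triangleright> X = (\<Sum>Y\<in>B. matrix_coefficient lact B X Y \<psi> *\<^sub>C Y)\<close> for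
  \<open>X \<in> B\<close>.\<close>

definition matrix_coefficient ::
  "('g2::affine_algebraic_group \<Rightarrow> 'g1::affine_algebraic_group \<Rightarrow> 'g1) \<Rightarrow>
   'g1 lie_algebra set \<Rightarrow> 'g1 lie_algebra \<Rightarrow> 'g1 lie_algebra \<Rightarrow> 'g2 polyfun"
  where "matrix_coefficient lact B X Y =
    Abs_polyfun (\<lambda>\<psi>. complex_vector.representation B (group_action_on_lie lact \<psi> X) Y)"

definition extends_lie_action ::
  "('g2::affine_algebraic_group \<Rightarrow> 'g1::affine_algebraic_group \<Rightarrow> 'g2) \<Rightarrow>
   ('g1 lie_algebra uea \<Rightarrow> 'g2 polyfun \<Rightarrow> 'g2 polyfun) \<Rightarrow> bool"
  where "extends_lie_action ract act \<longleftrightarrow>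
    left_module act \<and> (\<forall>X f. act (\<iota> X) f = lie_action_on_functions ract X f)"

definition extends_lie_coaction ::
  "('g2::affine_algebraic_group \<Rightarrow> 'g1::affine_algebraic_group \<Rightarrow> 'g1) \<Rightarrow>
   'g1 lie_algebra set \<Rightarrow> ('g1 lie_algebra uea \<Rightarrow> 'g2 polyfun \<Rightarrow> 'g2 polyfun) \<Rightarrow>
   ('g1 lie_algebra uea \<Rightarrow> 'g1 lie_algebra uea \<otimes> 'g2 polyfun) \<Rightarrow> bool"
  where "extends_lie_coaction lact B act coact \<longleftrightarrow>
    clinear coact \<and>
    (\<forall>X\<in>B. coact (\<iota> X) = (\<Sum>Y\<in>B. \<iota> Y \<otimes> matrix_coefficient lact B X Y)) \<and>
    coaction_multiplicative uea_comult act coact"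

end

theory Submission
  imports Defs
begin

text \<open>An element of \<open>V \<otimes> \<P>(G\<^sub>2)\<close> is determined by its values at the points of \<open>G\<^sub>2\<close>
  (\<open>eval_at_eqI\<close>), so a coaction \<open>\<nabla>\<close> on \<open>U = U(\<gg>\<^sub>1)\<close> amounts to a family of linear maps \<open>u \<mapsto> \<psi> \<triangleright>
  u\<close> on \<open>U\<close>, one for each \<open>\<psi>\<close>. In this form the comodule coalgebra axioms say that \<open>\<psi> \<triangleright> (\<psi>' \<triangleright> u) =
  (\<psi> \<psi>') \<triangleright> u\<close>, \<open>1 \<triangleright> u = u\<close>, \<open>\<Delta>(\<psi> \<triangleright> u) = (\<psi> \<triangleright> u\<^sub>1) \<otimes> (\<psi> \<triangleright> u\<^sub>2)\<close> and \<open>\<epsilon>(\<psi> \<triangleright> u) = \<epsilon>(u)\<close>.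

  The enveloping algebra enters through two facts only: it is generated by \<open>\<gg>\<^sub>1\<close>, and every
  representation of \<open>\<gg>\<^sub>1\<close> extends to a module over it (\<open>uea_action\<close>). The second fact yields the
  structure maps of \<open>U\<close>, the action and the coaction. For the coaction, the rule for \<open>\<nabla>(u v)\<close> with
  a generator \<open>u = X\<close> reads \<open>\<nabla>(X v) = T\<^sub>X(\<nabla> v)\<close> with \<open>T\<^sub>X(v \<otimes> f) = \<Sum>\<^sub>j X\<^sub>j v \<otimes> f\<^sup>j f + v \<otimes> X \<triangleright> f\<close>,
  where \<open>\<psi> \<triangleright> X = \<Sum>\<^sub>j f\<^sup>j(\<psi>) X\<^sub>j\<close>. This forces uniqueness, and it defines \<open>\<nabla>\<close> as soon as \<open>X \<mapsto> T\<^sub>X\<close>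
  is a representation. Evaluated at \<open>\<psi>\<close>, that is the formula for \<open>\<psi> \<triangleright> [X, Y]\<close> in
  \<open>group_act_lie_bracket\<close>, which comes from differentiating \<open>\<psi> \<triangleright> (\<phi> \<phi>') = (\<psi> \<triangleright> \<phi>) ((\<psi> \<triangleleft> \<phi>) \<triangleright> \<phi>')\<close>
  twice.

  The axioms that mention \<open>u\<close> are then proved by induction on \<open>u\<close>. In the step from \<open>u\<close> to \<open>X u\<close>
  one has \<open>\<psi> \<triangleright> (X u) = (\<psi> \<triangleright> X) (\<psi> \<triangleright> u) + D\<close>, where \<open>D\<close> is the derivative of \<open>\<psi> \<triangleright> u\<close> with respect
  to \<open>\<psi>\<close> along the vector field of \<open>X\<close> (\<open>act_on_gen\<close>). The induction hypothesis is an identity of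
  polynomial functions of \<open>\<psi>\<close>, so it may be differentiated along that field. For the two axioms
  that involve products in \<open>G\<^sub>2\<close> the derivative is computed with \<open>lie_act_product\<close>, the
  infinitesimal form of \<open>(\<psi> \<psi>') \<triangleleft> \<phi> = (\<psi> \<triangleleft> (\<psi>' \<triangleright> \<phi>)) (\<psi>' \<triangleleft> \<phi>)\<close>. The last compatibility axiom only
  needs that \<open>U\<close> is cocommutative and \<open>\<P>(G\<^sub>2)\<close> commutative.\<close>

section \<open>Linear maps and Sweedler sums\<close>

text \<open>Sweedler expressions are meaningful for bilinear maps only, so most rewriting steps with
  them have a linearity side condition. These rules discharge such conditions, both as
  introduction rules and as conditional rewrite rules.\<close>

named_theorems clinear_intros

lemma clinear_id [clinear_intros]: "clinear (\<lambda>x. x)"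
  by (rule clinearI) simp_all

lemma clinear_zero [clinear_intros]: "clinear (\<lambda>x. 0)"
  by (rule clinearI) (simp_all add: complex_vector.scale_zero_right)

lemma clinear_compose: "clinear g \<Longrightarrow> clinear f \<Longrightarrow> clinear (\<lambda>x. g (f x))"
  by (rule clinearI) (simp_all add: clinear_add clinear_scaleC)

lemma clinear_plus [clinear_intros]:
  "clinear f \<Longrightarrow> clinear g \<Longrightarrow> clinear (\<lambda>x. f x + g x)"
  by (rule clinearI) (simp_all add: clinear_add clinear_scaleC scaleC_add_right)

lemma clinear_sum_fun [clinear_intros]:
  "(\<And>i. i \<in> I \<Longrightarrow> clinear (f i)) \<Longrightarrow> clinear (\<lambda>x. \<Sum>i\<in>I. f i x)"
  by (induction I rule: infinite_finite_induct) (auto intro: clinear_zero clinear_plus)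

lemma clinear_scaleC_right [clinear_intros]: "clinear f \<Longrightarrow> clinear (\<lambda>x. c *\<^sub>C f x)"
  by (rule clinearI) (simp_all add: clinear_add clinear_scaleC scaleC_add_right scaleC_scaleC
      mult.commute)

lemma clinear_minus [clinear_intros]: "clinear f \<Longrightarrow> clinear (\<lambda>x. - f x)"
  using clinear_scaleC_right[of f "- 1"] by (simp add: complex_vector.scale_minus_left scaleC_one)

lemma clinear_diff_fun [clinear_intros]:
  "clinear f \<Longrightarrow> clinear g \<Longrightarrow> clinear (\<lambda>x. f x - g x)"
  using clinear_plus[of f "\<lambda>x. - g x"] by (simp add: clinear_minus)

lemma clinear_scaleC_left [clinear_intros]: "clinear f \<Longrightarrow> clinear (\<lambda>x. f x *\<^sub>C v)"
  by (rule clinearI) (simp_all add: clinear_add clinear_scaleC scaleC_add_left scaleC_scaleC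
      scaleC_complex_def)

lemma clinear_mult_left [clinear_intros]:
  fixes f :: "'a::complex_vector \<Rightarrow> 'b::complex_algebra_1"
  shows "clinear f \<Longrightarrow> clinear (\<lambda>x. f x * b)"
  by (rule clinearI) (simp_all add: clinear_add clinear_scaleC distrib_right mult_scaleC_left)

lemma clinear_mult_right [clinear_intros]:
  fixes f :: "'a::complex_vector \<Rightarrow> 'b::complex_algebra_1"
  shows "clinear f \<Longrightarrow> clinear (\<lambda>x. b * f x)"
  by (rule clinearI) (simp_all add: clinear_add clinear_scaleC distrib_left mult_scaleC_right)

lemma clinear_0: "clinear f \<Longrightarrow> f 0 = 0"
  using clinear_scaleC[of f 0 0] by (simp add: complex_vector.scale_zero_left)

lemma clinear_sum: "clinear f \<Longrightarrow> f (\<Sum>i\<in>I. g i) = (\<Sum>i\<in>I. f (g i))"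
  by (induction I rule: infinite_finite_induct) (simp_all add: clinear_0 clinear_add)

lemma clinear_diff: "clinear f \<Longrightarrow> f (x - y) = f x - f y"
  using clinear_add[of f "x - y" y] by (simp add: algebra_simps)

lemma cbilinearI [clinear_intros]:
  "(\<And>y. clinear (\<lambda>x. h x y)) \<Longrightarrow> (\<And>x. clinear (\<lambda>y. h x y)) \<Longrightarrow> cbilinear h"
  by (simp add: cbilinear_def)

definition linear_extension :: "('k \<Rightarrow> 'v::complex_vector) \<Rightarrow> ('k \<Rightarrow>\<^sub>0 complex) \<Rightarrow> 'v"
  where "linear_extension g p = (\<Sum>k\<in>Poly_Mapping.keys p. Poly_Mapping.lookup p k *\<^sub>C g k)"

lemma linear_extension_superset:
  assumes "finite K" "Poly_Mapping.keys p \<subseteq> K"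
  shows "linear_extension g p = (\<Sum>k\<in>K. Poly_Mapping.lookup p k *\<^sub>C g k)"
  unfolding linear_extension_def using assms
  by (intro sum.mono_neutral_left) (auto simp: in_keys_iff complex_vector.scale_zero_left)

lemma clinear_linear_extension: "clinear (linear_extension g)"
proof (rule clinearI)
  fix p q :: "'a \<Rightarrow>\<^sub>0 complex" and c :: complex
  let ?K = "Poly_Mapping.keys p \<union> Poly_Mapping.keys q"
  have "Poly_Mapping.keys (p + q) \<subseteq> ?K" by (rule Poly_Mapping.keys_add)
  then show "linear_extension g (p + q) = linear_extension g p + linear_extension g q"
    by (simp add: linear_extension_superset[of ?K] lookup_add scaleC_add_left sum.distrib)
  have "Poly_Mapping.keys (c *\<^sub>C p) \<subseteq> Poly_Mapping.keys p"
    by (auto simp: in_keys_iff lookup_scaleC scaleC_complex_def)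
  then show "linear_extension g (c *\<^sub>C p) = c *\<^sub>C linear_extension g p"
    by (simp add: linear_extension_superset[of "Poly_Mapping.keys p"] lookup_scaleC
        scaleC_complex_def scaleC_scaleC complex_vector.scale_sum_right)
qed

lemma linear_extension_single:
  "linear_extension g (Poly_Mapping.single k c) = c *\<^sub>C g k"
  by (simp add: linear_extension_superset[of "{k}"])

lemma poly_mapping_sum_single:
  "linear_extension (\<lambda>k. Poly_Mapping.single k 1) p = (p :: 'k \<Rightarrow>\<^sub>0 complex)"
  by (rule poly_mapping_eqI)
    (simp add: linear_extension_def lookup_sum lookup_scaleC lookup_single when_def
      scaleC_complex_def if_distrib sum.delta in_keys_iff cong: if_cong)

lemma sweedler_abs: "cbilinear h \<Longrightarrow> sweedler (abs_tensor p) h = linear_extension (case_prod h) p"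
  by (subst sweedler_eval[of h _ p]) (auto simp: linear_extension_def intro!: sum.cong)

lemma clinear_sweedler:
  assumes "cbilinear h" shows "clinear (\<lambda>t. sweedler t h)"
proof (rule clinearI)
  fix s t :: "'a \<otimes> 'b" and c :: complex
  obtain p q where "s = abs_tensor p" "t = abs_tensor q"
    by (metis Quotient3_abs_rep Quotient3_tensor)
  then show "sweedler (s + t) h = sweedler s h + sweedler t h"
    and "sweedler (c *\<^sub>C s) h = c *\<^sub>C sweedler s h"
    using assms by (simp_all add: plus_tensor.abs_eq scaleC_tensor.abs_eq sweedler_abs
        clinear_add[OF clinear_linear_extension] clinear_scaleC[OF clinear_linear_extension])
qed

lemma clinear_sweedler_left [clinear_intros]:
  "cbilinear h \<Longrightarrow> clinear t \<Longrightarrow> clinear (\<lambda>x. sweedler (t x) h)"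
  by (rule clinear_compose[OF clinear_sweedler])

lemma sweedler_add: "cbilinear h \<Longrightarrow> sweedler (s + t) h = sweedler s h + sweedler t h"
  by (rule clinear_add[OF clinear_sweedler])

lemma sweedler_scaleC: "cbilinear h \<Longrightarrow> sweedler (c *\<^sub>C t) h = c *\<^sub>C sweedler t h"
  by (rule clinear_scaleC[OF clinear_sweedler])

text \<open>A Sweedler expression is a finite linear combination of values of the map under it, hence
  every linear map can be moved into it.\<close>

lemma clinear_apply_sweedler:
  "clinear L \<Longrightarrow> L (sweedler t h) = sweedler t (\<lambda>x y. L (h x y))"
  by (simp add: sweedler_def Let_def case_prod_unfold clinear_sum clinear_scaleC)

lemma clinear_sweedler_right [clinear_intros]:
  "(\<And>a b. clinear (\<lambda>x. h x a b)) \<Longrightarrow> clinear (\<lambda>x. sweedler t (\<lambda>a b. h x a b))"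
  unfolding sweedler_def Let_def case_prod_unfold
  by (intro clinear_sum_fun clinear_scaleC_right)

lemma sweedler_sweedler:
  "cbilinear h \<Longrightarrow> sweedler (sweedler t g) h = sweedler t (\<lambda>x y. sweedler (g x y) h)"
  by (rule clinear_apply_sweedler[OF clinear_sweedler])

lemma sweedler_fun_add: "sweedler t (\<lambda>a b. g a b + h a b) = sweedler t g + sweedler t h"
  by (simp add: sweedler_def Let_def case_prod_unfold scaleC_add_right sum.distrib)

lemma sweedler_fun_scaleC: "sweedler t (\<lambda>a b. c *\<^sub>C h a b) = c *\<^sub>C sweedler t h"
  by (simp add: sweedler_def Let_def case_prod_unfold complex_vector.scale_sum_right scaleC_scaleC
      mult.commute)

lemma sweedler_fun_minus: "sweedler t (\<lambda>a b. - h a b) = - sweedler t h"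
  by (simp add: sweedler_def Let_def case_prod_unfold complex_vector.scale_minus_right sum_negf)

lemma sweedler_fun_zero: "sweedler t (\<lambda>a b. 0) = 0"
  by (simp add: sweedler_def Let_def case_prod_unfold complex_vector.scale_zero_right)

lemma sweedler_sum: "cbilinear h \<Longrightarrow> sweedler (\<Sum>i\<in>I. t i) h = (\<Sum>i\<in>I. sweedler (t i) h)"
  by (rule clinear_sum[OF clinear_sweedler])

lemma sweedler_fun_sum: "sweedler t (\<lambda>a b. \<Sum>i\<in>I. h i a b) = (\<Sum>i\<in>I. sweedler t (h i))"
  by (induction I rule: infinite_finite_induct) (simp_all add: sweedler_fun_zero sweedler_fun_add)

lemmas sweedler_simps = sweedler_sweedler sweedler_pure_tensor sweedler_add sweedler_fun_add
  sweedler_scaleC sweedler_fun_scaleC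

lemma cbilinear_pure_tensor: "cbilinear (pure_tensor :: 'a::complex_vector \<Rightarrow> 'b::complex_vector \<Rightarrow>
    _)"
proof -
  have *: "abs_tensor p = abs_tensor q" if "p - q \<in> tensor_relations"
    for p q :: "('a \<times> 'b) \<Rightarrow>\<^sub>0 complex"
    using that by (metis Quotient3_rel_abs Quotient3_tensor tensor_eq_def complex_vector.span_base)
  have sc: "c *\<^sub>C Poly_Mapping.single k 1 = Poly_Mapping.single k (c :: complex)" for c and k ::
      "'a \<times> 'b"
    by (intro poly_mapping_eqI) (simp add: lookup_scaleC lookup_single when_def scaleC_complex_def)
  show ?thesis
    unfolding cbilinear_def
    by (intro conjI allI clinearI;
      simp add: pure_tensor.abs_eq plus_tensor.abs_eq scaleC_tensor.abs_eq sc;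
      rule *; simp add: tensor_relations_def diff_diff_eq2 diff_diff_add[symmetric]; blast)
qed

lemma cbilinearD:
  assumes "cbilinear h"
  shows "clinear f \<Longrightarrow> clinear (\<lambda>x. h (f x) y)" "clinear g \<Longrightarrow> clinear (\<lambda>y. h x (g y))"
    "h (x + x') y = h x y + h x' y" "h (c *\<^sub>C x) y = c *\<^sub>C h x y"
    "h x (y + y') = h x y + h x y'" "h x (c *\<^sub>C y) = c *\<^sub>C h x y"
proof -
  have l: "clinear (\<lambda>x. h x y)" for y
    using assms by (simp add: cbilinear_def)
  have r: "clinear (h x)" for x
    using assms by (simp add: cbilinear_def)
  show "clinear f \<Longrightarrow> clinear (\<lambda>x. h (f x) y)" by (rule clinear_compose[OF l])
  show "clinear g \<Longrightarrow> clinear (\<lambda>y. h x (g y))" by (rule clinear_compose[OF r])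
  show "h (x + x') y = h x y + h x' y" by (rule clinear_add[OF l])
  show "h (c *\<^sub>C x) y = c *\<^sub>C h x y" by (rule clinear_scaleC[OF l])
  show "h x (y + y') = h x y + h x y'" by (rule clinear_add[OF r])
  show "h x (c *\<^sub>C y) = c *\<^sub>C h x y" by (rule clinear_scaleC[OF r])
qed

lemmas clinear_pure_tensor [clinear_intros] = cbilinearD(1,2)[OF cbilinear_pure_tensor]

text \<open>The rules for the first factor are stated for partial applications, which is the form that
  Sweedler sums have after eta contraction.\<close>

lemma pure_tensor_simps:
  "(\<otimes>) (x + y) = (\<lambda>b. x \<otimes> b + y \<otimes> b)" "(\<otimes>) (c *\<^sub>C x) = (\<lambda>b. c *\<^sub>C (x \<otimes> b))"
  "a \<otimes> (v + w) = a \<otimes> v + a \<otimes> w" "a \<otimes> (c *\<^sub>C v) = c *\<^sub>C (a \<otimes> v)"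
  by (simp_all add: fun_eq_iff cbilinearD(3-6)[OF cbilinear_pure_tensor])

lemma sweedler_pure [simp]: "sweedler t (\<lambda>x y. x \<otimes> y) = t"
proof -
  obtain p where t: "t = abs_tensor p" by (metis Quotient3_abs_rep Quotient3_tensor)
  have "clinear (abs_tensor :: _ \<Rightarrow> 'a \<otimes> 'b)"
    by (rule clinearI) (simp_all add: plus_tensor.abs_eq scaleC_tensor.abs_eq)
  then have "linear_extension (\<lambda>(x, y). x \<otimes> y) p =
      abs_tensor (linear_extension (\<lambda>k. Poly_Mapping.single k 1) p)"
    by (simp add: linear_extension_def clinear_sum clinear_scaleC pure_tensor.abs_eq
        case_prod_unfold)
  then show ?thesis
    by (simp only: t sweedler_abs[OF cbilinear_pure_tensor] poly_mapping_sum_single)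
qed

lemma tensor_linear_eqI:
  assumes "clinear f" "clinear g" "\<And>x y. f (x \<otimes> y) = g (x \<otimes> y)"
  shows "f t = g t"
proof -
  have "f (sweedler t (\<lambda>x y. x \<otimes> y)) = g (sweedler t (\<lambda>x y. x \<otimes> y))"
    by (simp only: clinear_apply_sweedler[OF assms(1)] clinear_apply_sweedler[OF assms(2)] assms(3))
  then show ?thesis by simp
qed

text \<open>A basis of the first factor writes a tensor as a sum of basis vectors tensored with its
  coefficients, and each coefficient is obtained by applying a linear functional to the first
  factor.\<close>

lemma tensor_eqI_functional:
  fixes s t :: "'v::complex_vector \<otimes> 'w::complex_vector"
  assumes "\<And>\<phi>. clinear \<phi> \<Longrightarrow> sweedler s (\<lambda>v w. \<phi> v *\<^sub>C w) = sweedler t (\<lambda>v w. \<phi> v *\<^sub>C w)"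
  shows "s = t"
proof -
  define E :: "'v set" where "E = complex_vector.extend_basis {}"
  have ind: "complex_vector.independent E" and sp: "complex_vector.span E = UNIV"
    unfolding E_def by (auto simp: complex_vector.independent_extend_basis
        complex_vector.span_extend_basis complex_vector.independent_empty)
  define r where "r b v = complex_vector.representation E v b" for b v
  have lin: "clinear (r b)" for b
    unfolding r_def using ind sp
    by (intro clinearI) (simp_all add: complex_vector.representation_add
        complex_vector.representation_scale scaleC_complex_def)
  have bil: "cbilinear (\<lambda>v w. r b v *\<^sub>C w)" for b
    using lin by (intro clinear_intros)
  have expand: "\<exists>S. finite S \<and> (\<forall>S'. finite S' \<longrightarrow> S \<subseteq> S' \<longrightarrow>
      (\<Sum>b\<in>S'. b \<otimes> sweedler t (\<lambda>v w. r b v *\<^sub>C w)) = t)" for t :: "'v \<otimes> 'w"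
  proof -
    define K where "K = Poly_Mapping.keys (rep_tensor t)"
    define S where "S = (\<Union>(v, w)\<in>K. {b. r b v \<noteq> 0})"
    have fin: "finite S"
      unfolding S_def K_def r_def by (auto simp: complex_vector.finite_representation)
    have "(\<Sum>b\<in>S'. b \<otimes> sweedler t (\<lambda>v w. r b v *\<^sub>C w)) = t" if S': "finite S'" "S \<subseteq> S'" for S'
    proof -
      have v: "(\<Sum>b\<in>S'. r b v *\<^sub>C b) = v" if "(v, w) \<in> K" for v w
      proof -
        have "(\<Sum>b\<in>S'. r b v *\<^sub>C b) = (\<Sum>b | r b v \<noteq> 0. r b v *\<^sub>C b)"
          using S' that by (intro sum.mono_neutral_right)
            (auto simp: S_def complex_vector.scale_zero_left)
        also have "\<dots> = v"
          unfolding r_def using complex_vector.sum_nonzero_representation_eq[OF ind] sp by simp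
        finally show ?thesis .
      qed
      have "(\<Sum>b\<in>S'. b \<otimes> sweedler t (\<lambda>v w. r b v *\<^sub>C w)) =
          (\<Sum>b\<in>S'. sweedler t (\<lambda>v w. (r b v *\<^sub>C b) \<otimes> w))"
        by (simp add: clinear_apply_sweedler[OF clinear_pure_tensor(2)[OF clinear_id]]
            pure_tensor_simps)
      also have "\<dots> = (\<Sum>k\<in>K. Poly_Mapping.lookup (rep_tensor t) k *\<^sub>C
          ((\<Sum>b\<in>S'. r b (fst k) *\<^sub>C b) \<otimes> snd k))"
        unfolding sweedler_def Let_def K_def[symmetric]
        by (subst sum.swap) (simp add: case_prod_unfold
            clinear_sum[OF clinear_pure_tensor(1)[OF clinear_id]]
            complex_vector.scale_sum_right)
      also have "\<dots> = sweedler t (\<lambda>v w. v \<otimes> w)"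
        unfolding sweedler_def Let_def K_def[symmetric]
        by (intro sum.cong refl) (auto simp: v)
      finally show ?thesis by simp
    qed
    with fin show ?thesis by blast
  qed
  from expand[of s] obtain S where S: "finite S" "\<And>S'. finite S' \<Longrightarrow> S \<subseteq> S' \<Longrightarrow>
      (\<Sum>b\<in>S'. b \<otimes> sweedler s (\<lambda>v w. r b v *\<^sub>C w)) = s" by blast
  from expand[of t] obtain T where T: "finite T" "\<And>S'. finite S' \<Longrightarrow> T \<subseteq> S' \<Longrightarrow>
      (\<Sum>b\<in>S'. b \<otimes> sweedler t (\<lambda>v w. r b v *\<^sub>C w)) = t" by blast
  have "s = (\<Sum>b\<in>S \<union> T. b \<otimes> sweedler s (\<lambda>v w. r b v *\<^sub>C w))"
    by (rule S(2)[symmetric]) (use S(1) T(1) in auto)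
  also have "\<dots> = (\<Sum>b\<in>S \<union> T. b \<otimes> sweedler t (\<lambda>v w. r b v *\<^sub>C w))"
    by (intro sum.cong refl arg_cong2[where f = "(\<otimes>)"] assms lin)
  also have "\<dots> = t"
    by (rule T(2)) (use S(1) T(1) in auto)
  finally show "s = t" .
qed

text \<open>Applying a functional to the first factor commutes with applying \<open>M i\<close> to the second one. So
  maps that jointly separate the points of a space still do so after tensoring with another space.\<close>

lemma tensor_eqI_right:
  fixes s t :: "'v::complex_vector \<otimes> 'w::complex_vector" and M :: "'i \<Rightarrow> 'w \<Rightarrow> 'e::complex_vector"
  assumes M: "\<And>i. clinear (M i)" and sep: "\<And>x y. (\<And>i. M i x = M i y) \<Longrightarrow> x = y"
    and eq: "\<And>i. sweedler s (\<lambda>v w. v \<otimes> M i w) = sweedler t (\<lambda>v w. v \<otimes> M i w)"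
  shows "s = t"
proof (rule tensor_eqI_functional, rule sep)
  fix \<phi> :: "'v \<Rightarrow> complex" and i assume \<phi>: "clinear \<phi>"
  have "M i (sweedler r (\<lambda>v w. \<phi> v *\<^sub>C w)) =
      sweedler (sweedler r (\<lambda>v w. v \<otimes> M i w)) (\<lambda>v e. \<phi> v *\<^sub>C e)" for r
  proof -
    have b: "cbilinear (\<lambda>v (e::'e). \<phi> v *\<^sub>C e)" using \<phi> by (intro clinear_intros)
    show ?thesis
      by (simp add: clinear_apply_sweedler[OF M] sweedler_sweedler[OF b] sweedler_pure_tensor[OF b]
          clinear_scaleC[OF M])
  qed
  then show "M i (sweedler s (\<lambda>v w. \<phi> v *\<^sub>C w)) = M i (sweedler t (\<lambda>v w. \<phi> v *\<^sub>C w))"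
    by (simp add: eq)
qed

section \<open>Tensors with polynomial functions\<close>

lemma clinear_pf_eval [clinear_intros]: "clinear f \<Longrightarrow> clinear (\<lambda>a. pf_eval (f a) x)"
  by (rule clinearI) (simp_all add: clinear_add clinear_scaleC scaleC_complex_def)

lemma clinear_lie_apply_compose [clinear_intros]: "clinear f \<Longrightarrow> clinear (\<lambda>a. lie_apply X (f a))"
  by (rule clinear_compose[OF clinear_lie_apply])

lemma clinear_lie_apply_arg [clinear_intros]: "clinear f \<Longrightarrow> clinear (\<lambda>a. lie_apply (f a) g)"
  by (rule clinearI) (simp_all add: clinear_add clinear_scaleC scaleC_complex_def)

lemmas pf_eval_sweedler = clinear_apply_sweedler[OF clinear_pf_eval[OF clinear_id]]
lemmas lie_apply_sweedler = clinear_apply_sweedler[OF clinear_lie_apply]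

lemma tensor_eqI_scalar:
  fixes s t :: "'v::complex_vector \<otimes> 'w::complex_vector" and M :: "'i \<Rightarrow> 'w \<Rightarrow> complex"
  assumes M: "\<And>i. clinear (M i)" and sep: "\<And>x y. (\<And>i. M i x = M i y) \<Longrightarrow> x = y"
    and eq: "\<And>i. sweedler s (\<lambda>v w. M i w *\<^sub>C v) = sweedler t (\<lambda>v w. M i w *\<^sub>C v)"
  shows "s = t"
proof (rule tensor_eqI_right[OF M sep])
  fix i
  have scalar: "v \<otimes> c = (c *\<^sub>C v) \<otimes> (1 :: complex)" for v :: 'v and c
    using pure_tensor_simps(4)[of v c "1 :: complex"]
    by (simp add: pure_tensor_simps(2) scaleC_complex_def)
  have "sweedler r (\<lambda>v w. v \<otimes> M i w) = sweedler r (\<lambda>v w. M i w *\<^sub>C v) \<otimes> (1 :: complex)"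
    for r :: "'v \<otimes> 'w"
    by (simp only: scalar[of v "M i w" for v w]
        clinear_apply_sweedler[OF clinear_pure_tensor(1)[OF clinear_id]])
  then show "sweedler s (\<lambda>v w. v \<otimes> M i w) = sweedler t (\<lambda>v w. v \<otimes> M i w)"
    by (simp add: eq)
qed

text \<open>An element of \<open>V \<otimes> \<P>(G)\<close> is treated as a \<open>V\<close>-valued function on \<open>G\<close>; this is its value at a
  point.\<close>

definition eval_at :: "'g::affine_algebraic_set \<Rightarrow> 'v::complex_vector \<otimes> 'g polyfun \<Rightarrow> 'v"
  where "eval_at x t = sweedler t (\<lambda>v f. pf_eval f x *\<^sub>C v)"

lemma clinear_eval_at [clinear_intros]: "clinear f \<Longrightarrow> clinear (\<lambda>a. eval_at x (f a))"
  unfolding eval_at_def by (intro clinear_intros)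

lemma eval_at_pure [simp]: "eval_at x (v \<otimes> f) = pf_eval f x *\<^sub>C v"
  unfolding eval_at_def by (intro sweedler_pure_tensor clinear_intros)

lemmas eval_at_sweedler = clinear_apply_sweedler[OF clinear_eval_at[OF clinear_id]]

lemma eval_at_simps [simp]:
  "eval_at x (s + t) = eval_at x s + eval_at x t"
  "eval_at x (c *\<^sub>C t) = c *\<^sub>C eval_at x t"
  "eval_at x (\<Sum>i\<in>I. h i) = (\<Sum>i\<in>I. eval_at x (h i))"
  by (rule clinear_add clinear_scaleC clinear_sum, rule clinear_eval_at[OF clinear_id])+

lemma eval_at_eqI: "(\<And>x. eval_at x s = eval_at x t) \<Longrightarrow> s = t"
  by (rule tensor_eqI_scalar[of "\<lambda>x f. pf_eval f x"])
    (auto intro: clinear_intros polyfun_eqI simp: eval_at_def)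

lemma eval_at_eqI2:
  fixes s t :: "'v::complex_vector \<otimes> 'a::affine_algebraic_set polyfun \<otimes> 'b::affine_algebraic_set
      polyfun"
  assumes "\<And>x y. sweedler s (\<lambda>v w. pf_eval (eval_at y w) x *\<^sub>C v) =
    sweedler t (\<lambda>v w. pf_eval (eval_at y w) x *\<^sub>C v)"
  shows "s = t"
  by (rule tensor_eqI_scalar[of "\<lambda>(x, y) w. pf_eval (eval_at y w) x"])
    (auto intro!: clinear_intros polyfun_eqI eval_at_eqI simp: assms)

lemma eval_at_eqI_inner:
  fixes s t :: "'v::complex_vector \<otimes> 'w::complex_vector \<otimes> 'a::affine_algebraic_set polyfun"
  assumes "\<And>x. sweedler s (\<lambda>v w. v \<otimes> eval_at x w) = sweedler t (\<lambda>v w. v \<otimes> eval_at x w)"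
  shows "s = t"
  by (rule tensor_eqI_right[of eval_at]) (auto intro!:
      clinear_eval_at[OF clinear_id] eval_at_eqI assms)

lemma sweedler_pf_eval:
  "sweedler t (\<lambda>a b. pf_eval a x * pf_eval b y) = pf_eval (eval_at y t) x"
  by (simp add: eval_at_def pf_eval_sweedler mult.commute)

text \<open>The definite description in \<open>split_function\<close> denotes: a suitable tensor can be written down
  from the assumed decomposition of \<open>h\<close>, and a tensor is determined by its values at pairs of
  points.\<close>

lemma eval_at_split_function:
  fixes h :: "'a::affine_algebraic_set \<Rightarrow> 'b::affine_algebraic_set \<Rightarrow> complex"
  assumes "\<exists>ps :: ('a polyfun \<times> 'b polyfun) list.
    \<forall>x y. h x y = (\<Sum>p\<leftarrow>ps. pf_eval (fst p) x * pf_eval (snd p) y)"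
  shows "pf_eval (eval_at y (split_function h)) x = h x y"
proof -
  obtain ps :: "('a polyfun \<times> 'b polyfun) list"
    where ps: "\<And>x y. h x y = (\<Sum>p\<leftarrow>ps. pf_eval (fst p) x * pf_eval (snd p) y)"
    using assms by blast
  define t where "t = (\<Sum>p\<leftarrow>ps. fst p \<otimes> snd p)"
  have "pf_eval (eval_at y (\<Sum>p\<leftarrow>qs. fst p \<otimes> snd p)) x =
      (\<Sum>p\<leftarrow>qs. pf_eval (fst p) x * pf_eval (snd p) y)"
    for x y and qs :: "('a polyfun \<times> 'b polyfun) list"
    by (induction qs) (simp_all add: clinear_0[OF clinear_eval_at[OF clinear_id]] mult.commute)
  then have t: "pf_eval (eval_at y t) x = h x y" for x y
    by (simp add: t_def ps)
  have "split_function h = t"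
    unfolding split_function_def sweedler_pf_eval
    by (rule the_equality) (auto simp: t intro!: eval_at_eqI polyfun_eqI)
  with t show ?thesis by simp
qed

lemma split_function_slice:
  fixes h :: "'a::affine_algebraic_set \<Rightarrow> 'b::affine_algebraic_set \<Rightarrow> complex"
  assumes "\<exists>ps :: ('a polyfun \<times> 'b polyfun) list.
    \<forall>x y. h x y = (\<Sum>p\<leftarrow>ps. pf_eval (fst p) x * pf_eval (snd p) y)"
  shows "Abs_polyfun (h x) = sweedler (split_function h) (\<lambda>a b. pf_eval a x *\<^sub>C b)"
  by (rule pf_eval_Abs_eq)
    (simp add: pf_eval_sweedler sweedler_pf_eval eval_at_split_function[OF assms])

lemma sweedler_mult:
  fixes c :: "'c::complex_algebra_1"
  shows "sweedler t (\<lambda>a b. c * h a b) = c * sweedler t h"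
    "sweedler t (\<lambda>a b. h a b * c) = sweedler t h * c"
    "sweedler t (\<lambda>a b. h a b * (k a b * c)) = sweedler t (\<lambda>a b. h a b * k a b) * c"
  by (simp_all add: clinear_apply_sweedler[OF clinear_mult_left[OF clinear_id]]
      clinear_apply_sweedler[OF clinear_mult_right[OF clinear_id]] mult.assoc)

lemma sweedler_mult_middle:
  fixes c :: "'c::{complex_algebra_1, comm_ring_1}"
  shows "sweedler t (\<lambda>a b. h a b * (c * k a b)) = c * sweedler t (\<lambda>a b. h a b * k a b)"
  by (simp add: mult.left_commute[of _ c] sweedler_mult)

section \<open>The Hopf algebra of polynomial functions\<close>

lemma eval_at_pf_comult [simp]: "pf_eval (eval_at y (pf_comult f)) x = pf_eval f (x * y)"
  unfolding pf_comult_def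
  by (rule eval_at_split_function[OF regular_map2_pullback[OF regular_map2_mult]])

lemma sweedler_pf_comult [simp]:
  "sweedler (pf_comult f) (\<lambda>a b. pf_eval a x * pf_eval b y) = pf_eval f (x * y)"
  "sweedler (pf_comult f) (\<lambda>a b. pf_eval b y * pf_eval a x) = pf_eval f (x * y)"
  by (simp_all add: sweedler_pf_eval mult.commute[of "pf_eval _ y"])

definition right_translate :: "'a::affine_algebraic_group \<Rightarrow> 'a polyfun \<Rightarrow> 'a polyfun"
  where "right_translate y f = eval_at y (pf_comult f)"

lemma pf_eval_right_translate [simp]: "pf_eval (right_translate y f) x = pf_eval f (x * y)"
  by (simp add: right_translate_def)

lemma clinear_pf_comult [clinear_intros]: "clinear f \<Longrightarrow> clinear (\<lambda>a. pf_comult (f a))"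
  by (rule clinearI) (auto intro!: eval_at_eqI polyfun_eqI simp: clinear_add clinear_scaleC)

lemma clinear_pf_counit [clinear_intros]: "clinear f \<Longrightarrow> clinear (\<lambda>a. pf_counit (f a))"
  unfolding pf_counit_def by (intro clinear_intros)

lemma pf_eval_pf_antipode [simp]: "pf_eval (pf_antipode f) x = pf_eval f (ginv x)"
proof -
  have "(\<lambda>x. pf_eval f (ginv x)) \<in> polynomial_functions"
    unfolding polynomial_functions_def
  proof (rule polynomials_in_compose[where f = "pf_eval f" and h = ginv])
    show "pf_eval f \<in> polynomials_in {\<lambda>x. coord x i | i. True}"
      using pf_eval[of f] by (simp add: polynomial_functions_def)
    show "(\<lambda>y. g (ginv y)) \<in> polynomials_in {\<lambda>x. coord x i | i. True}"
      if "g \<in> {\<lambda>x. coord x i | i. True}" for g :: "'a \<Rightarrow> complex"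
      using that regular_ginv by (auto simp: polynomial_functions_def)
  qed
  then show ?thesis by (simp add: pf_antipode_def Abs_polyfun_inverse)
qed

lemma clinear_pf_antipode [clinear_intros]: "clinear f \<Longrightarrow> clinear (\<lambda>a. pf_antipode (f a))"
  by (rule clinearI) (auto intro!: polyfun_eqI simp: clinear_add clinear_scaleC)

lemma ginv_right: "x * ginv x = (1 :: 'a::affine_algebraic_group)"
proof -
  have "x * ginv x = (ginv (ginv x) * ginv x) * (x * ginv x)" by (simp add: ginv_left)
  also have "\<dots> = ginv (ginv x) * (ginv x * x) * ginv x" by (simp only: mult.assoc)
  also have "\<dots> = 1" by (simp add: ginv_left)
  finally show ?thesis .
qed

theorem hopf_algebra_polyfun:
  "hopf_algebra (pf_comult :: 'a::affine_algebraic_group polyfun \<Rightarrow> _) pf_counit pf_antipode"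
  unfolding hopf_algebra_def
proof (intro conjI allI)
  show "clinear (pf_comult :: 'a polyfun \<Rightarrow> _)" "clinear (pf_counit :: 'a polyfun \<Rightarrow> _)"
    "clinear (pf_antipode :: 'a polyfun \<Rightarrow> _)"
    by (rule clinear_pf_comult[OF clinear_id] clinear_pf_counit[OF clinear_id]
        clinear_pf_antipode[OF clinear_id])+
  fix a b :: "'a polyfun"
  show "sweedler (pf_comult a) (\<lambda>a1 a2. sweedler (pf_comult a1) (\<lambda>b c. b \<otimes> c \<otimes> a2)) =
      sweedler (pf_comult a) (\<lambda>a1 a2. sweedler (pf_comult a2) (\<lambda>b c. a1 \<otimes> b \<otimes> c))"
    by (intro eval_at_eqI2 polyfun_eqI)
      (simp add: sweedler_sweedler sweedler_pure_tensor clinear_intros pf_eval_sweedler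
        sweedler_mult sweedler_mult_middle mult_ac)
  show "sweedler (pf_comult a) (\<lambda>a1 a2. pf_counit a1 *\<^sub>C a2) = a"
    "sweedler (pf_comult a) (\<lambda>a1 a2. pf_counit a2 *\<^sub>C a1) = a"
    by (intro polyfun_eqI; simp add: pf_eval_sweedler pf_counit_def)+
  show "pf_comult (1 :: 'a polyfun) = 1 \<otimes> 1"
    by (intro eval_at_eqI polyfun_eqI) simp
  show "pf_comult (a * b) = sweedler (pf_comult a) (\<lambda>a1 a2. sweedler (pf_comult b) (\<lambda>b1 b2.
      (a1 * b1) \<otimes> (a2 * b2)))"
    by (intro eval_at_eqI polyfun_eqI)
      (simp add: eval_at_sweedler pf_eval_sweedler sweedler_mult sweedler_mult_middle mult_ac)
  show "pf_counit (1 :: 'a polyfun) = 1" "pf_counit (a * b) = pf_counit a * pf_counit b"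
    by (simp_all add: pf_counit_def)
  show "sweedler (pf_comult a) (\<lambda>a1 a2. pf_antipode a1 * a2) = pf_counit a *\<^sub>C 1"
    "sweedler (pf_comult a) (\<lambda>a1 a2. a1 * pf_antipode a2) = pf_counit a *\<^sub>C 1"
    by (intro polyfun_eqI; simp add: pf_eval_sweedler pf_counit_def ginv_left ginv_right)+
qed

section \<open>Modules over universal enveloping algebras\<close>

definition lie_representation ::
  "('g::complex_lie_algebra \<Rightarrow> 'v::complex_vector \<Rightarrow> 'v) \<Rightarrow> bool"
  where "lie_representation T \<longleftrightarrow> cbilinear T \<and>
    (\<forall>x y v. T (lie_bracket x y) v = T x (T y v) - T y (T x v))"

fun word_action :: "('g \<Rightarrow> 'v \<Rightarrow> 'v) \<Rightarrow> 'g free_monoid \<Rightarrow> 'v \<Rightarrow> 'v"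
  where "word_action T (Word xs) v = foldr T xs v"

definition free_action ::
  "('g \<Rightarrow> 'v \<Rightarrow> 'v::complex_vector) \<Rightarrow> ('g free_monoid \<Rightarrow>\<^sub>0 complex) \<Rightarrow> 'v \<Rightarrow> 'v"
  where "free_action T p v = linear_extension (\<lambda>w. word_action T w v) p"

text \<open>The value is computed from a chosen representative, so this is a module structure only if
  \<open>T\<close> is a representation of the Lie algebra.\<close>

definition uea_action ::
  "('g::complex_lie_algebra \<Rightarrow> 'v \<Rightarrow> 'v::complex_vector) \<Rightarrow> 'g uea \<Rightarrow> 'v \<Rightarrow> 'v"
  where "uea_action T u = free_action T (rep_uea u)"

lemma poly_mapping_linear_eqI:
  assumes "clinear f" "clinear g" "\<And>k. f (Poly_Mapping.single k 1) = g (Poly_Mapping.single k 1)"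
  shows "f p = g (p :: 'k \<Rightarrow>\<^sub>0 complex)"
proof -
  have "f (linear_extension (\<lambda>k. Poly_Mapping.single k 1) p) =
      g (linear_extension (\<lambda>k. Poly_Mapping.single k 1) p)"
    using assms by (simp add: linear_extension_def clinear_sum clinear_scaleC)
  then show ?thesis by (simp add: poly_mapping_sum_single)
qed

lemma clinear_free_mult:
  fixes q :: "'m::monoid_add \<Rightarrow>\<^sub>0 complex"
  shows "clinear (\<lambda>p. p * q)" "clinear (\<lambda>p. q * p)"
  by (auto intro!: clinearI simp: distrib_right distrib_left scaleC_free_algebra_left
      scaleC_free_algebra_right)

lemma clinear_free_action_left: "clinear (\<lambda>p. free_action T p v)"
  unfolding free_action_def by (rule clinear_linear_extension)

context
  fixes T :: "'g \<Rightarrow> 'v::complex_vector \<Rightarrow> 'v"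
  assumes T: "\<And>x. clinear (T x)"
begin

lemma clinear_word_action: "clinear (word_action T w)"
proof (cases w)
  case (Word xs)
  have "clinear (foldr T xs)"
  proof (induction xs)
    case Nil
    show ?case using clinear_id by (simp add: id_def)
  next
    case (Cons x xs)
    then show ?case using clinear_compose[OF T] by (simp add: comp_def)
  qed
  moreover have "word_action T w = foldr T xs" using Word by (simp add: fun_eq_iff)
  ultimately show ?thesis by simp
qed

lemma clinear_free_action_right: "clinear (free_action T p)"
  unfolding free_action_def linear_extension_def
  by (intro clinear_sum_fun clinear_scaleC_right clinear_compose[OF clinear_word_action clinear_id])

lemma free_action_single: "free_action T (Poly_Mapping.single w c) v = c *\<^sub>C word_action T w v"
  by (simp add: free_action_def linear_extension_single)

lemma free_action_mult: "free_action T (p * q) v = free_action T p (free_action T q v)"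
proof (rule poly_mapping_linear_eqI[where p = p])
  show "clinear (\<lambda>p. free_action T (p * q) v)"
    by (rule clinear_compose[OF clinear_free_action_left clinear_free_mult(1)])
  show "clinear (\<lambda>p. free_action T p (free_action T q v))"
    by (rule clinear_free_action_left)
  fix w
  show "free_action T (Poly_Mapping.single w 1 * q) v =
      free_action T (Poly_Mapping.single w 1) (free_action T q v)"
  proof (rule poly_mapping_linear_eqI[where p = q])
    show "clinear (\<lambda>q. free_action T (Poly_Mapping.single w 1 * q) v)"
      by (rule clinear_compose[OF clinear_free_action_left clinear_free_mult(2)])
    show "clinear (\<lambda>q. free_action T (Poly_Mapping.single w 1) (free_action T q v))"
      by (rule clinear_compose[OF clinear_free_action_right clinear_free_action_left])
    fix w'
    show "free_action T (Poly_Mapping.single w 1 * Poly_Mapping.single w' 1) v =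
        free_action T (Poly_Mapping.single w 1) (free_action T (Poly_Mapping.single w' 1) v)"
      by (cases w; cases w') (simp add: mult_single free_action_single scaleC_one)
  qed
qed

lemma free_action_gen: "free_action T (free_gen x) v = T x v"
  by (simp add: free_gen_def free_action_single scaleC_one)

end

text \<open>A representation is linear in the Lie algebra and turns brackets into commutators, which
  makes each defining relation act by zero. A product \<open>a * r * b\<close> acts by a composition of maps of
  which the one in the middle is zero.\<close>

lemma free_action_uea_ideal:
  assumes T: "lie_representation T" and r: "r \<in> uea_ideal"
  shows "free_action T r v = 0"
proof -
  from T have bil: "cbilinear T"
    and bracket: "T (lie_bracket x y) v = T x (T y v) - T y (T x v)" for x y v
    by (simp_all add: lie_representation_def)
  note lin = cbilinearD(2)[OF bil clinear_id]
  note [simp] = clinear_diff[OF clinear_free_action_left] clinear_scaleC[OF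
      clinear_free_action_left]
    clinear_0[OF clinear_free_action_right[OF lin]] free_action_mult[OF lin] free_action_gen[OF lin]
  have "free_action T s v = 0" if "s \<in> uea_relations" for s v
    using that by (auto simp: uea_relations_def cbilinearD(3-6)[OF bil] bracket)
  then have gen: "free_action T s v = 0" if "s \<in> {a * r * b | a r b. r \<in> uea_relations}" for s v
    using that by auto
  show ?thesis
    using r unfolding uea_ideal_def
  proof (induction rule: complex_vector.span_induct_alt)
    case base
    show ?case by (rule clinear_0[OF clinear_free_action_left])
  next
    case (step c x y)
    then show ?case
      by (simp add: clinear_add[OF clinear_free_action_left] gen complex_vector.scale_zero_right)
  qed
qed

lemma uea_action_abs:
  assumes "lie_representation T"
  shows "uea_action T (abs_uea p) = free_action T p"
proof
  fix v
  have "uea_eq (rep_uea (abs_uea p)) p"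
    by (metis Quotient3_rep_abs Quotient3_uea equivp_reflp uea_equivp)
  then have "free_action T (rep_uea (abs_uea p) - p) v = 0"
    by (intro free_action_uea_ideal[OF assms]) (simp add: uea_eq_def)
  then show "uea_action T (abs_uea p) v = free_action T p v"
    by (simp add: uea_action_def clinear_diff[OF clinear_free_action_left])
qed

lemma uea_cases: obtains p where "u = abs_uea p"
  by (metis Quotient3_abs_rep Quotient3_uea)

text \<open>This form of the universal property avoids algebra structures on tensor products and on
  endomorphisms: a linear map on the enveloping algebra that is prescribed recursively on products
  with a generator is obtained by letting the enveloping algebra act on the image of the unit.\<close>

theorem uea_action:
  assumes "lie_representation T"
  shows "left_module (uea_action T)" and "uea_action T (\<iota> x) v = T x v"
proof -
  from assms have bil: "cbilinear T" by (simp add: lie_representation_def)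
  note lin = cbilinearD(2)[OF bil clinear_id]
  show "uea_action T (\<iota> x) v = T x v"
    by (simp add: uea_inj.abs_eq uea_action_abs[OF assms] free_action_gen[OF lin])
  have "clinear (\<lambda>u. uea_action T u v)" for v
  proof (rule clinearI)
    fix u w :: "'a uea" and c
    obtain p q where "u = abs_uea p" "w = abs_uea q" by (metis uea_cases)
    then show "uea_action T (u + w) v = uea_action T u v + uea_action T w v"
      "uea_action T (c *\<^sub>C u) v = c *\<^sub>C uea_action T u v"
      by (simp_all add: plus_uea.abs_eq scaleC_uea.abs_eq uea_action_abs[OF assms]
          clinear_add[OF clinear_free_action_left] clinear_scaleC[OF clinear_free_action_left])
  qed
  moreover have "clinear (uea_action T u)" for u
    unfolding uea_action_def by (rule clinear_free_action_right[OF lin])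
  moreover have "uea_action T 1 v = v" for v
    by (simp add: one_uea.abs_eq uea_action_abs[OF assms] single_one[symmetric]
        free_action_single[OF lin] zero_free_monoid_def scaleC_one del: single_one)
  moreover have "uea_action T (u * w) v = uea_action T u (uea_action T w v)" for u w v
  proof -
    obtain p q where "u = abs_uea p" "w = abs_uea q" by (metis uea_cases)
    then show ?thesis
      by (simp add: times_uea.abs_eq uea_action_abs[OF assms] free_action_mult[OF lin])
  qed
  ultimately show "left_module (uea_action T)"
    by (simp add: left_module_def cbilinear_def)
qed

lemma uea_induct [case_names add scale one gen]:
  assumes add: "\<And>u v. P u \<Longrightarrow> P v \<Longrightarrow> P (u + v)" and scale: "\<And>c u. P u \<Longrightarrow> P (c *\<^sub>C u)"
    and one: "P 1" and gen: "\<And>x u. P u \<Longrightarrow> P (\<iota> x * u)"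
  shows "P (u :: 'g::complex_lie_algebra uea)"
proof -
  have lin: "clinear (abs_uea :: _ \<Rightarrow> 'g uea)"
    by (rule clinearI) (simp_all add: plus_uea.abs_eq scaleC_uea.abs_eq)
  have zero: "P 0" using scale[OF one, of 0] by (simp add: complex_vector.scale_zero_left)
  have word: "P (abs_uea (Poly_Mapping.single (Word xs) 1))" for xs
  proof (induction xs)
    case Nil
    show ?case using one by (simp add: one_uea.abs_eq flip: zero_free_monoid_def)
  next
    case (Cons x xs)
    have "abs_uea (Poly_Mapping.single (Word (x # xs)) 1) =
        \<iota> x * abs_uea (Poly_Mapping.single (Word xs) 1)"
      by (simp add: uea_inj.abs_eq times_uea.abs_eq free_gen_def mult_single)
    then show ?case using gen[OF Cons] by simp
  qed
  have single: "P (abs_uea (Poly_Mapping.single w 1))" for w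
    using word by (cases w) simp
  obtain p where "u = abs_uea (linear_extension (\<lambda>k. Poly_Mapping.single k 1) p)"
    by (metis uea_cases poly_mapping_sum_single)
  also have "\<dots> = (\<Sum>k\<in>Poly_Mapping.keys p. Poly_Mapping.lookup p k *\<^sub>C
      abs_uea (Poly_Mapping.single k 1))"
    by (simp add: linear_extension_def clinear_sum[OF lin] clinear_scaleC[OF lin])
  also have "P (\<Sum>k\<in>K. Poly_Mapping.lookup p k *\<^sub>C abs_uea (Poly_Mapping.single k 1))" for K
    by (induction K rule: infinite_finite_induct) (simp_all add: zero add scale single)
  finally show ?thesis .
qed

text \<open>The index makes the induction hypothesis available for the whole family. With points of a
  group as indices it becomes an identity of functions on the group, which can be differentiated.\<close>

lemma uea_linear_family_eqI:
  fixes f g :: "'i \<Rightarrow> 'g::complex_lie_algebra uea \<Rightarrow> 'v::complex_vector"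
  assumes lin: "\<And>i. clinear (f i)" "\<And>i. clinear (g i)" and one: "\<And>i. f i 1 = g i 1"
    and gen: "\<And>x u i. (\<And>i. f i u = g i u) \<Longrightarrow> f i (\<iota> x * u) = g i (\<iota> x * u)"
  shows "f i u = g i u"
proof -
  have "\<forall>i. f i u = g i u"
    by (induction u rule: uea_induct)
      (auto simp: one gen clinear_add[OF lin(1)] clinear_add[OF lin(2)]
        clinear_scaleC[OF lin(1)] clinear_scaleC[OF lin(2)])
  then show ?thesis by blast
qed

lemma uea_linear_eqI:
  fixes f g :: "'g::complex_lie_algebra uea \<Rightarrow> 'v::complex_vector"
  assumes "clinear f" "clinear g" "f 1 = g 1"
    and "\<And>x u. f u = g u \<Longrightarrow> f (\<iota> x * u) = g (\<iota> x * u)"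
  shows "f u = g u"
  by (rule uea_linear_family_eqI[where i = "()"]) (use assms in auto)

lemma uea_inj_simps:
  "\<iota> (x + y) = \<iota> x + \<iota> y" "\<iota> (c *\<^sub>C x) = c *\<^sub>C \<iota> x"
  "\<iota> (lie_bracket x y) = \<iota> x * \<iota> y - \<iota> y * \<iota> x"
proof -
  have *: "abs_uea p = abs_uea q" if "p - q \<in> uea_relations"
    for p q :: "'a free_monoid \<Rightarrow>\<^sub>0 complex"
  proof -
    have "1 * (p - q) * 1 \<in> uea_ideal"
      unfolding uea_ideal_def using that by (intro complex_vector.span_base) blast
    then show ?thesis
      by (metis Quotient3_rel_abs Quotient3_uea uea_eq_def mult_1_left mult_1_right)
  qed
  show "\<iota> (x + y) = \<iota> x + \<iota> y"
    unfolding uea_inj.abs_eq plus_uea.abs_eq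
    by (rule *) (auto simp: uea_relations_def diff_diff_add[symmetric])
  show "\<iota> (c *\<^sub>C x) = c *\<^sub>C \<iota> x"
    unfolding uea_inj.abs_eq scaleC_uea.abs_eq
    by (rule *) (auto simp: uea_relations_def)
  show "\<iota> (lie_bracket x y) = \<iota> x * \<iota> y - \<iota> y * \<iota> x"
    unfolding uea_inj.abs_eq times_uea.abs_eq minus_uea.abs_eq
    by (rule *[symmetric]) (auto simp: uea_relations_def)
qed

lemma clinear_uea_inj [clinear_intros]: "clinear f \<Longrightarrow> clinear (\<lambda>a. \<iota> (f a))"
  by (rule clinearI) (simp_all add: clinear_add clinear_scaleC uea_inj_simps)

lemma uea_inj_sum: "\<iota> (\<Sum>i\<in>I. x i) = (\<Sum>i\<in>I. \<iota> (x i))"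
  by (rule clinear_sum[OF clinear_uea_inj[OF clinear_id]])

lemma left_moduleD:
  assumes "left_module act"
  shows "cbilinear act" "act 1 v = v" "act (u * w) v = act u (act w v)"
  using assms by (simp_all add: left_module_def)

section \<open>The Hopf algebra structure of universal enveloping algebras\<close>

lemma uea_comult:
  shows clinear_uea_comult': "clinear (uea_comult :: 'g::complex_lie_algebra uea \<Rightarrow> _)"
    and uea_comult_one [simp]: "uea_comult (1 :: 'g uea) = 1 \<otimes> 1"
    and uea_comult_mult: "uea_comult (u * v :: 'g uea) = sweedler (uea_comult u) (\<lambda>u1 u2.
      sweedler (uea_comult v) (\<lambda>v1 v2. (u1 * v1) \<otimes> (u2 * v2)))"
    and uea_comult_gen: "uea_comult (\<iota> (x :: 'g)) = \<iota> x \<otimes> 1 + 1 \<otimes> \<iota> x"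
proof -
  let ?P = "\<lambda>\<Delta> :: 'g uea \<Rightarrow> 'g uea \<otimes> 'g uea. clinear \<Delta> \<and> \<Delta> 1 = 1 \<otimes> 1 \<and>
    (\<forall>u v. \<Delta> (u * v) =
      sweedler (\<Delta> u) (\<lambda>u1 u2. sweedler (\<Delta> v) (\<lambda>v1 v2. (u1 * v1) \<otimes> (u2 * v2)))) \<and>
    (\<forall>x. \<Delta> (\<iota> x) = \<iota> x \<otimes> 1 + 1 \<otimes> \<iota> x)"
  (* A coproduct that is multiplicative with primitive generators satisfies
     \<Delta>(x u) = (x \<otimes> 1 + 1 \<otimes> x) \<Delta>(u). *)
  define T where "T x t = sweedler t (\<lambda>a b. (\<iota> x * a) \<otimes> b + a \<otimes> (\<iota> x * b))"
    for x :: 'g and t :: "'g uea \<otimes> 'g uea"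
  have lin: "clinear (T x)" for x
    unfolding T_def by (intro clinear_intros)
  have "lie_representation T"
    unfolding lie_representation_def
  proof (intro conjI allI)
    show "cbilinear T" unfolding T_def by (intro clinear_intros)
    show "T (lie_bracket x y) t = T x (T y t) - T y (T x t)" for x y t
    proof (rule tensor_linear_eqI[where t = t])
      show "clinear (T (lie_bracket x y))" "clinear (\<lambda>t. T x (T y t) - T y (T x t))"
        unfolding T_def by (intro clinear_intros)+
      fix a b :: "'g uea"
      have pure: "T x (a \<otimes> b) = (\<iota> x * a) \<otimes> b + a \<otimes> (\<iota> x * b)" for x a b
        unfolding T_def by (intro sweedler_pure_tensor clinear_intros)
      show "T (lie_bracket x y) (a \<otimes> b) = T x (T y (a \<otimes> b)) - T y (T x (a \<otimes> b))"
        by (simp add: pure clinear_add[OF lin] uea_inj_simps algebra_simps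
            clinear_diff[OF clinear_pure_tensor(1)[OF clinear_id]]
            clinear_diff[OF clinear_pure_tensor(2)[OF clinear_id]])
    qed
  qed
  note act = left_moduleD[OF uea_action(1)[OF this]] uea_action(2)[OF this]
  define \<Delta> where "\<Delta> u = uea_action T u (1 \<otimes> 1)" for u
  have \<Delta>: "clinear \<Delta>" "\<Delta> 1 = 1 \<otimes> 1" "\<Delta> (\<iota> x * u) = T x (\<Delta> u)" for x u
    unfolding \<Delta>_def using act cbilinearD(1)[OF act(1) clinear_id] by simp_all
  have gen: "\<Delta> (\<iota> x) = \<iota> x \<otimes> 1 + 1 \<otimes> \<iota> x" for x
    using \<Delta>(3)[of x 1] by (simp add: \<Delta>(2) T_def sweedler_pure_tensor clinear_intros)
  have mult: "\<Delta> (u * v) = sweedler (\<Delta> u) (\<lambda>u1 u2. sweedler (\<Delta> v) (\<lambda>v1 v2. (u1 * v1) \<otimes> (u2 * v2)))"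
    for u v
  proof (rule uea_linear_eqI[where u = u])
    show "clinear (\<lambda>u. \<Delta> (u * v))"
      by (rule clinear_compose[OF \<Delta>(1)]) (intro clinear_intros)
    show "clinear (\<lambda>u. sweedler (\<Delta> u) (\<lambda>u1 u2. sweedler (\<Delta> v) (\<lambda>v1 v2. (u1 * v1) \<otimes> (u2 * v2))))"
      by (rule clinear_compose[OF _ \<Delta>(1)]) (intro clinear_intros)
    show "\<Delta> (1 * v) = sweedler (\<Delta> 1) (\<lambda>u1 u2. sweedler (\<Delta> v) (\<lambda>v1 v2. (u1 * v1) \<otimes> (u2 * v2)))"
      by (simp add: \<Delta>(2) sweedler_pure_tensor clinear_intros)
    fix x u
    assume "\<Delta> (u * v) =
      sweedler (\<Delta> u) (\<lambda>u1 u2. sweedler (\<Delta> v) (\<lambda>v1 v2. (u1 * v1) \<otimes> (u2 * v2)))"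
    then show "\<Delta> (\<iota> x * u * v) = sweedler (\<Delta> (\<iota> x * u)) (\<lambda>u1 u2. sweedler (\<Delta> v) (\<lambda>v1 v2.
        (u1 * v1) \<otimes> (u2 * v2)))"
      by (simp add: \<Delta>(3) mult.assoc T_def sweedler_simps clinear_intros)
  qed
  have "uea_comult = \<Delta>"
    unfolding uea_comult_def
  proof (rule the_equality)
    show "?P \<Delta>" using \<Delta> gen mult by blast
    fix \<Delta>' assume P: "?P \<Delta>'"
    show "\<Delta>' = \<Delta>"
    proof (rule ext, rule uea_linear_eqI)
      fix x u assume "\<Delta>' u = \<Delta> u"
      with P show "\<Delta>' (\<iota> x * u) = \<Delta> (\<iota> x * u)"
        by (simp add: mult gen clinear_add[OF clinear_sweedler] sweedler_pure_tensor clinear_intros)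
    qed (use P \<Delta> in auto)
  qed
  with \<Delta> gen mult show "clinear (uea_comult :: 'g uea \<Rightarrow> _)"  "uea_comult (1 :: 'g uea) = 1 \<otimes> 1"
    "uea_comult (u * v :: 'g uea) = sweedler (uea_comult u) (\<lambda>u1 u2.
      sweedler (uea_comult v) (\<lambda>v1 v2. (u1 * v1) \<otimes> (u2 * v2)))"
    "uea_comult (\<iota> x) = \<iota> x \<otimes> 1 + 1 \<otimes> \<iota> x"
    by simp_all
qed

lemma clinear_uea_comult [clinear_intros]: "clinear f \<Longrightarrow> clinear (\<lambda>a. uea_comult (f a))"
  by (rule clinear_compose[OF clinear_uea_comult'])

lemma uea_comult_gen_mult:
  "uea_comult (\<iota> x * u) = sweedler (uea_comult u) (\<lambda>u1 u2. (\<iota> x * u1) \<otimes> u2 + u1 \<otimes> (\<iota> x * u2))"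
  by (simp add: uea_comult_mult[of "\<iota> x"] uea_comult_gen sweedler_simps clinear_intros)

lemma sweedler_uea_comult_gen_mult:
  assumes "cbilinear h"
  shows "sweedler (uea_comult (\<iota> x * u)) h =
    sweedler (uea_comult u) (\<lambda>u1 u2. h (\<iota> x * u1) u2)
        + sweedler (uea_comult u) (\<lambda>u1 u2. h u1 (\<iota> x * u2))"
  using assms
  by (simp add: uea_comult_gen_mult sweedler_simps)

lemma uea_comult_coassociative:
  fixes u :: "'a::complex_lie_algebra uea"
  shows
  "sweedler (uea_comult u) (\<lambda>a1 a2. sweedler (uea_comult a1) (\<lambda>b c. b \<otimes> c \<otimes> a2)) =
   sweedler (uea_comult u) (\<lambda>a1 a2. sweedler (uea_comult a2) (\<lambda>b c. a1 \<otimes> b \<otimes> c))"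
  (is "?l u = ?r u")
proof (rule uea_linear_eqI[where u = u])
  fix x u
  assume IH: "?l u = ?r u"
  (* L is multiplication by the iterated coproduct of x; applied to the induction hypothesis it
     gives the claim for x u. *)
  define L where "L w = sweedler w (\<lambda>b cd. sweedler cd (\<lambda>c d.
    (\<iota> (x :: 'a) * b) \<otimes> c \<otimes> d + b \<otimes> (\<iota> x * c) \<otimes> d + b \<otimes> c \<otimes> (\<iota> x * d)))" for w
  have "L (?l u) = L (?r u)" by (simp only: IH)
  then show "?l (\<iota> x * u) = ?r (\<iota> x * u)"
    by (simp add: L_def sweedler_uea_comult_gen_mult sweedler_simps clinear_intros add_ac)
qed (auto intro!: clinear_intros simp: sweedler_pure_tensor clinear_intros)

text \<open>Primitive generators have symmetric coproducts. This is what relates the two sides of the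
  last axiom of a matched pair, where the factors of the coproduct occur in opposite orders.\<close>

lemma uea_comult_cocommutative:
  fixes u :: "'a::complex_lie_algebra uea"
  shows "sweedler (uea_comult u) (\<lambda>a b. b \<otimes> a) = uea_comult u"
  (is "?f u = _")
proof (rule uea_linear_eqI[where u = u])
  fix x u
  assume IH: "?f u = uea_comult u"
  define L where "L w = sweedler w (\<lambda>a b. (\<iota> (x :: 'a) * a) \<otimes> b + a \<otimes> (\<iota> x * b))" for w
  have "L (?f u) = L (uea_comult u)" by (simp only: IH)
  then show "?f (\<iota> x * u) = uea_comult (\<iota> x * u)"
    by (simp add: L_def sweedler_uea_comult_gen_mult uea_comult_gen_mult sweedler_simps
        clinear_intros add_ac)
qed (auto intro!: clinear_intros simp: sweedler_pure_tensor clinear_intros)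

lemma uea_counit:
  shows clinear_uea_counit': "clinear (uea_counit :: 'g::complex_lie_algebra uea \<Rightarrow> _)"
    and uea_counit_one [simp]: "uea_counit (1 :: 'g uea) = 1"
    and uea_counit_mult [simp]: "uea_counit (u * v :: 'g uea) = uea_counit u * uea_counit v"
    and uea_counit_gen [simp]: "uea_counit (\<iota> (x :: 'g)) = 0"
proof -
  let ?P = "\<lambda>\<epsilon> :: 'g uea \<Rightarrow> complex. clinear \<epsilon> \<and> \<epsilon> 1 = 1 \<and> (\<forall>u v. \<epsilon> (u * v) = \<epsilon> u * \<epsilon> v) \<and>
    (\<forall>x. \<epsilon> (\<iota> x) = 0)"
  define T :: "'g \<Rightarrow> complex \<Rightarrow> complex" where "T x c = 0" for x c
  have "lie_representation T"
    unfolding lie_representation_def T_def by (auto intro: clinear_intros)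
  note act = left_moduleD[OF uea_action(1)[OF this]] uea_action(2)[OF this]
  define \<epsilon> where "\<epsilon> u = uea_action T u 1" for u
  have \<epsilon>: "clinear \<epsilon>" "\<epsilon> 1 = 1" "\<epsilon> (\<iota> x * u) = 0" for x u
    unfolding \<epsilon>_def using act cbilinearD(1)[OF act(1) clinear_id] by (simp_all add: T_def)
  have mult: "\<epsilon> (u * v) = \<epsilon> u * \<epsilon> v" for u v
    by (rule uea_linear_eqI[where u = u])
      (auto simp: \<epsilon> mult.assoc intro!: clinear_mult_left clinear_compose[OF \<epsilon>(1)] clinear_intros)
  have P: "?P \<epsilon>" using \<epsilon> \<epsilon>(3)[of _ 1] mult by simp
  moreover have "\<epsilon>' = \<epsilon>" if "?P \<epsilon>'" for \<epsilon>'
    by (rule ext, rule uea_linear_eqI) (use that \<epsilon> in auto)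
  ultimately have "uea_counit = \<epsilon>"
    unfolding uea_counit_def by (rule the_equality)
  with P show "clinear (uea_counit :: 'g uea \<Rightarrow> _)" "uea_counit (1 :: 'g uea) = 1"
    "uea_counit (u * v :: 'g uea) = uea_counit u * uea_counit v" "uea_counit (\<iota> x) = 0"
    by simp_all
qed

lemma clinear_uea_counit [clinear_intros]: "clinear f \<Longrightarrow> clinear (\<lambda>a. uea_counit (f a))"
  by (rule clinear_compose[OF clinear_uea_counit'])

lemma uea_antipode:
  shows clinear_uea_antipode': "clinear (uea_antipode :: 'g::complex_lie_algebra uea \<Rightarrow> _)"
    and uea_antipode_one [simp]: "uea_antipode (1 :: 'g uea) = 1"
    and uea_antipode_mult: "uea_antipode (u * v :: 'g uea) = uea_antipode v * uea_antipode u"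
    and uea_antipode_gen: "uea_antipode (\<iota> (x :: 'g)) = - \<iota> x"
proof -
  let ?P = "\<lambda>S :: 'g uea \<Rightarrow> 'g uea. clinear S \<and> S 1 = 1 \<and> (\<forall>u v. S (u * v) = S v * S u) \<and>
    (\<forall>x. S (\<iota> x) = - \<iota> x)"
  (* S reverses products, so x u must be sent to - S(u) x. *)
  define T where "T x v = - (v * \<iota> x)" for x :: 'g and v
  have "lie_representation T"
    unfolding lie_representation_def T_def
    by (auto intro!: clinear_intros simp: uea_inj_simps algebra_simps)
  note act = left_moduleD[OF uea_action(1)[OF this]] uea_action(2)[OF this]
  define S where "S u = uea_action T u 1" for u
  have S: "clinear S" "S 1 = 1" "S (\<iota> x * u) = - (S u * \<iota> x)" for x u
    unfolding S_def using act cbilinearD(1)[OF act(1) clinear_id] by (simp_all add: T_def)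
  have gen: "S (\<iota> x) = - \<iota> x" for x using S(3)[of x 1] S(2) by simp
  have mult: "S (u * v) = S v * S u" for u v
    by (rule uea_linear_eqI[where u = u])
      (auto simp: S mult.assoc intro!: clinear_mult_right clinear_compose[OF S(1)] clinear_intros)
  have P: "?P S" using S gen mult by blast
  moreover have "S' = S" if "?P S'" for S'
    by (rule ext, rule uea_linear_eqI) (use that S in auto)
  ultimately have "uea_antipode = S"
    unfolding uea_antipode_def by (rule the_equality)
  with P show "clinear (uea_antipode :: 'g uea \<Rightarrow> _)" "uea_antipode (1 :: 'g uea) = 1"
    "uea_antipode (u * v :: 'g uea) = uea_antipode v * uea_antipode u" "uea_antipode (\<iota> x) = - \<iota> x"
    by simp_all
qed

lemma clinear_uea_antipode [clinear_intros]: "clinear f \<Longrightarrow> clinear (\<lambda>a. uea_antipode (f a))"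
  by (rule clinear_compose[OF clinear_uea_antipode'])

theorem hopf_algebra_uea:
  "hopf_algebra (uea_comult :: 'g::complex_lie_algebra uea \<Rightarrow> _) uea_counit uea_antipode"
  unfolding hopf_algebra_def
proof (intro conjI allI)
  show "clinear (uea_comult :: 'g uea \<Rightarrow> _)" "clinear (uea_counit :: 'g uea \<Rightarrow> _)"
    "clinear (uea_antipode :: 'g uea \<Rightarrow> _)"
    by (fact clinear_uea_comult' clinear_uea_counit' clinear_uea_antipode')+
  fix a b :: "'g uea"
  show "sweedler (uea_comult a) (\<lambda>a1 a2. sweedler (uea_comult a1) (\<lambda>b c. b \<otimes> c \<otimes> a2)) =
      sweedler (uea_comult a) (\<lambda>a1 a2. sweedler (uea_comult a2) (\<lambda>b c. a1 \<otimes> b \<otimes> c))"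
    by (rule uea_comult_coassociative)
  show "uea_comult (1 :: 'g uea) = 1 \<otimes> 1" by simp
  show "uea_comult (a * b) = sweedler (uea_comult a) (\<lambda>a1 a2. sweedler (uea_comult b) (\<lambda>b1 b2.
      (a1 * b1) \<otimes> (a2 * b2)))"
    by (rule uea_comult_mult)
  show "uea_counit (1 :: 'g uea) = 1" "uea_counit (a * b) = uea_counit a * uea_counit b"
    by simp_all
  note [simp] = sweedler_uea_comult_gen_mult sweedler_pure_tensor clinear_intros
    sweedler_fun_zero complex_vector.scale_zero_left sweedler_mult uea_antipode_mult
    uea_antipode_gen scaleC_one sweedler_fun_minus mult_scaleC_left mult_scaleC_right
  show "sweedler (uea_comult a) (\<lambda>a1 a2. uea_counit a1 *\<^sub>C a2) = a"
    by (rule uea_linear_eqI[where u = a])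
      (auto intro!: clinear_intros simp del: mult_scaleC_left mult_scaleC_right
        simp flip: mult_scaleC_right)
  show "sweedler (uea_comult a) (\<lambda>a1 a2. uea_counit a2 *\<^sub>C a1) = a"
    by (rule uea_linear_eqI[where u = a])
      (auto intro!: clinear_intros simp del: mult_scaleC_left mult_scaleC_right
        simp flip: mult_scaleC_right)
  show "sweedler (uea_comult a) (\<lambda>a1 a2. uea_antipode a1 * a2) = uea_counit a *\<^sub>C 1"
    by (rule uea_linear_eqI[where u = a])
      (auto intro!: clinear_intros simp: mult.assoc simp flip: sweedler_fun_add)
  show "sweedler (uea_comult a) (\<lambda>a1 a2. a1 * uea_antipode a2) = uea_counit a *\<^sub>C 1"
    by (rule uea_linear_eqI[where u = a])
      (auto intro!: clinear_intros simp: mult.assoc)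
qed

section \<open>Slices of regular maps\<close>

definition slice ::
  "('a::affine_algebraic_set \<Rightarrow> 'b::affine_algebraic_set \<Rightarrow> 'c::affine_algebraic_set) \<Rightarrow>
   'a \<Rightarrow> 'c polyfun \<Rightarrow> 'b polyfun"
  where "slice h x f = Abs_polyfun (\<lambda>y. pf_eval f (h x y))"

context
  fixes h :: "'a::affine_algebraic_set \<Rightarrow> 'b::affine_algebraic_set \<Rightarrow> 'c::affine_algebraic_set"
  assumes h: "regular_map2 h"
begin

lemma slice_sweedler:
  "slice h x f = sweedler (split_function (\<lambda>x y. pf_eval f (h x y))) (\<lambda>a b. pf_eval a x *\<^sub>C b)"
  unfolding slice_def by (rule split_function_slice[OF regular_map2_pullback[OF h]])

lemma pf_eval_slice: "pf_eval (slice h x f) y = pf_eval f (h x y)"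
  by (simp add: slice_sweedler pf_eval_sweedler sweedler_pf_eval
      eval_at_split_function[OF regular_map2_pullback[OF h]])

end

text \<open>Differentiating a regular map along its second argument gives a polynomial function of the
  first one.\<close>

lemma pf_eval_lie_apply_slice:
  fixes h :: "'a::affine_algebraic_set \<Rightarrow> 'b::affine_algebraic_group \<Rightarrow> 'c::affine_algebraic_set"
  assumes "regular_map2 h"
  shows "pf_eval (sweedler (split_function (\<lambda>x y. pf_eval f (h x y)))
      (\<lambda>a b. lie_apply X b *\<^sub>C a)) x = lie_apply X (slice h x f)"
  by (simp add: slice_sweedler[OF assms] pf_eval_sweedler lie_apply_sweedler mult.commute)

lemma lie_apply_one [simp]: "lie_apply X 1 = 0"
  using lie_apply_simps(3)[of X 1 1] by simp

lemma lie_apply_sum [simp]: "lie_apply X (\<Sum>i\<in>I. f i) = (\<Sum>i\<in>I. lie_apply X (f i))"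
  by (rule clinear_sum[OF clinear_lie_apply])

lemma pf_eval_sum [simp]: "pf_eval (\<Sum>i\<in>I. f i) x = (\<Sum>i\<in>I. pf_eval (f i) x)"
  by (rule clinear_sum[OF clinear_pf_eval[OF clinear_id]])

lemma lie_apply_sum_left: "lie_apply (\<Sum>i\<in>I. X i) f = (\<Sum>i\<in>I. lie_apply (X i) f)"
  by (rule clinear_sum[OF clinear_lie_apply_arg[OF clinear_id]])

text \<open>By Gauss elimination. Coordinates with respect to a basis of the Lie algebra are therefore
  values of derivations on suitable functions.\<close>

lemma dual_functions:
  fixes B :: "'a::affine_algebraic_group lie_algebra set"
  assumes "finite B" "complex_vector.independent B"
  shows "\<exists>d. \<forall>X\<in>B. \<forall>Y\<in>B. lie_apply X (d Y) = (if X = Y then 1 else 0)"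
  using assms
proof (induction B rule: finite_induct)
  case empty
  then show ?case by simp
next
  case (insert Y B)
  then have ind: "complex_vector.independent B" and Y: "Y \<notin> complex_vector.span B"
    using complex_vector.independent_insert[of Y B] by auto
  from insert.IH[OF ind] obtain d
    where d: "\<And>X Z. X \<in> B \<Longrightarrow> Z \<in> B \<Longrightarrow> lie_apply X (d Z) = (if X = Z then 1 else 0)" by blast
  (* Y agrees with W on the span of the dual functions found so far, so a function that
     distinguishes them becomes the dual function of Y after a correction in this span and
     rescaling. *)
  define W where "W = (\<Sum>Z\<in>B. lie_apply Y (d Z) *\<^sub>C Z)"
  have "W \<in> complex_vector.span B"
    unfolding W_def by (intro complex_vector.span_sum complex_vector.span_scale
        complex_vector.span_base)
  with Y have "Y \<noteq> W" by auto
  then obtain f where f: "lie_apply Y f \<noteq> lie_apply W f" using lie_algebra_eqI by blast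
  define g where "g = f - (\<Sum>Z\<in>B. lie_apply Z f *\<^sub>C d Z)"
  have gB: "lie_apply X g = 0" if "X \<in> B" for X
    using that insert.hyps by (simp add: g_def d if_distrib sum.delta' cong: if_cong)
  have gY: "lie_apply Y g \<noteq> 0"
    using f by (simp add: g_def W_def lie_apply_sum_left mult.commute)
  define e where "e = inverse (lie_apply Y g) *\<^sub>C g"
  have e: "lie_apply Y e = 1" "X \<in> B \<Longrightarrow> lie_apply X e = 0" for X
    using gY gB by (simp_all add: e_def)
  define d' where "d' Z = (if Z = Y then e else d Z - lie_apply Y (d Z) *\<^sub>C e)" for Z
  have "\<forall>X\<in>insert Y B. \<forall>Z\<in>insert Y B. lie_apply X (d' Z) = (if X = Z then 1 else 0)"
    using e d insert.hyps by (auto simp: d'_def)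
  then show ?case by blast
qed

section \<open>The action and the coaction of the Lie algebra\<close>

locale group_matched_pair =
  fixes lact :: "'g2::affine_algebraic_group \<Rightarrow> 'g1::affine_algebraic_group \<Rightarrow> 'g1"
    and ract :: "'g2 \<Rightarrow> 'g1 \<Rightarrow> 'g2"
    and B :: "'g1 lie_algebra set"
  assumes mp: "matched_pair_of_groups lact ract"
    and indep: "complex_vector.independent B" and span: "complex_vector.span B = UNIV"
begin

abbreviation "lie_act \<equiv> lie_action_on_functions ract"
abbreviation "group_act \<equiv> group_action_on_lie lact"
abbreviation "coeff \<equiv> matrix_coefficient lact B"

lemma group_laws:
  "lact (x * y) a = lact x (lact y a)" "lact 1 a = a"
  "ract x (a * b) = ract (ract x a) b" "ract x 1 = x"
  "lact x (a * b) = lact x a * lact (ract x a) b" "lact x 1 = 1"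
  "ract (x * y) a = ract x (lact y a) * ract y a" "ract 1 a = 1"
  using mp by (simp_all add: matched_pair_of_groups_def)

lemma regular: "regular_map2 lact" "regular_map2 ract"
  using mp by (simp_all add: matched_pair_of_groups_def)

lemmas pf_eval_slices [simp] = pf_eval_slice[OF regular(1)] pf_eval_slice[OF regular(2)]

lemma slice_simps:
  "slice lact x (f + g) = slice lact x f + slice lact x g"
  "slice lact x (c *\<^sub>C f) = c *\<^sub>C slice lact x f"
  "slice lact x (f * g) = slice lact x f * slice lact x g"
  "slice lact x (\<Sum>i\<in>I. F i) = (\<Sum>i\<in>I. slice lact x (F i))"
  "slice ract x (f' + g') = slice ract x f' + slice ract x g'"
  "slice ract x (c *\<^sub>C f') = c *\<^sub>C slice ract x f'"
  "slice ract x (f' * g') = slice ract x f' * slice ract x g'"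
  "slice ract x 1 = 1"
  by (auto intro!: polyfun_eqI)

lemma pf_eval_lie_act [simp]: "pf_eval (lie_act X f) x = lie_apply X (slice ract x f)"
  unfolding lie_action_on_functions_def by (rule pf_eval_lie_apply_slice[OF regular(2)])

lemma lie_act_mult: "lie_act X (f * g) = lie_act X f * g + f * lie_act X g"
  by (rule polyfun_eqI) (simp add: slice_simps group_laws algebra_simps)

lemma lie_act_one [simp]: "lie_act X 1 = 0"
  by (rule polyfun_eqI) (simp add: slice_simps)

lemma lie_act_at_one: "pf_eval (lie_act X f) 1 = 0"
proof -
  have "slice ract 1 f = pf_eval f 1 *\<^sub>C 1"
    by (rule polyfun_eqI) (simp add: group_laws)
  then show ?thesis by simp
qed

lemma clinear_lie_act [clinear_intros]:
  "clinear F \<Longrightarrow> clinear (\<lambda>a. lie_act X (F a))" "clinear G \<Longrightarrow> clinear (\<lambda>a. lie_act (G a) f)"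
  by (auto intro!: clinearI polyfun_eqI simp: clinear_add clinear_scaleC slice_simps)

lemmas lie_act_sweedler = clinear_apply_sweedler[OF clinear_lie_act(1)[OF clinear_id]]

text \<open>Since \<open>(x \<triangleleft> a) \<triangleleft> b = x \<triangleleft> (a b)\<close>, the orbit map \<open>a \<mapsto> x \<triangleleft> a\<close> relates the left invariant vector
  field of \<open>Y\<close> to the action of \<open>Y\<close>. So the action preserves brackets because left invariant
  fields do.\<close>

lemma slice_lie_act: "slice ract x (lie_act Y f) = left_invariant_field Y (slice ract x f)"
proof (rule polyfun_eqI)
  fix a
  have "slice ract (ract x a) f = left_translate a (slice ract x f)"
    by (rule polyfun_eqI) (simp add: group_laws)
  then show "pf_eval (slice ract x (lie_act Y f)) a =
      pf_eval (left_invariant_field Y (slice ract x f)) a"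
    by simp
qed

lemma lie_representation_lie_act: "lie_representation lie_act"
  unfolding lie_representation_def
  by (auto intro!: clinear_intros polyfun_eqI simp: slice_lie_act)

lemma lie_apply_group_act [simp]: "lie_apply (group_act x X) f = lie_apply X (slice lact x f)"
proof -
  have "derivation_at_one (\<lambda>f. lie_apply X (slice lact x f))"
    unfolding derivation_at_one_def
    by (auto intro!: clinearI simp: slice_simps group_laws scaleC_complex_def)
  then show ?thesis
    by (simp add: group_action_on_lie_def Abs_lie_algebra_inverse flip: slice_def)
qed

lemma group_act_mult: "group_act (x * y) X = group_act x (group_act y X)"
proof (rule lie_algebra_eqI)
  fix f
  have "slice lact (x * y) f = slice lact y (slice lact x f)"
    by (rule polyfun_eqI) (simp add: group_laws)
  then show "lie_apply (group_act (x * y) X) f = lie_apply (group_act x (group_act y X)) f"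
    by simp
qed

lemma group_act_one: "group_act 1 X = X"
proof (rule lie_algebra_eqI)
  fix f
  have "slice lact 1 f = f" by (rule polyfun_eqI) (simp add: group_laws)
  then show "lie_apply (group_act 1 X) f = lie_apply X f" by simp
qed

lemma finite_B: "finite B"
  by (rule finite_lie_algebra_basis[OF indep])

lemma lie_algebra_expand: "(\<Sum>Y\<in>B. complex_vector.representation B X Y *\<^sub>C Y) = X"
  by (rule complex_vector.sum_representation_eq[OF indep]) (auto simp: span finite_B)

text \<open>The coordinates of \<open>x \<triangleright> X\<close> are its values on dual functions and therefore polynomial in \<open>x\<close>.
  Only this makes the value of \<open>Abs_polyfun\<close> in the definition of the coefficients meaningful.\<close>

lemma pf_eval_coeff:
  "pf_eval (coeff X Y) x = complex_vector.representation B (group_act x X) Y"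
proof -
  have "\<exists>p :: 'g2 polyfun. \<forall>x. complex_vector.representation B (group_act x X) Y = pf_eval p x"
  proof (cases "Y \<in> B")
    case True
    obtain d where d: "\<And>Z W. Z \<in> B \<Longrightarrow> W \<in> B \<Longrightarrow> lie_apply Z (d W) = (if Z = W then 1 else 0)"
      using dual_functions[OF finite_B indep] by blast
    have "complex_vector.representation B Z Y = lie_apply Z (d Y)" for Z
      by (subst (2) lie_algebra_expand[of Z, symmetric])
        (use True finite_B in \<open>simp add: lie_apply_sum_left d if_distrib sum.delta cong: if_cong\<close>)
    then show ?thesis
      by (intro exI allI) (simp, rule pf_eval_lie_apply_slice[OF regular(1), symmetric])
  next
    case False
    then have "complex_vector.representation B Z Y = 0" for Z
      using complex_vector.representation_ne_zero by blast
    then show ?thesis by (intro exI[of _ 0]) simp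
  qed
  then obtain p :: "'g2 polyfun"
    where "\<And>x. complex_vector.representation B (group_act x X) Y = pf_eval p x" by blast
  then show ?thesis
    unfolding matrix_coefficient_def by (simp add: pf_eval_Abs_eq[of _ p])
qed

lemma group_act_expand: "group_act x X = (\<Sum>Y\<in>B. pf_eval (coeff X Y) x *\<^sub>C Y)"
  by (simp add: pf_eval_coeff lie_algebra_expand)

lemma clinear_group_act [clinear_intros]: "clinear F \<Longrightarrow> clinear (\<lambda>a. group_act x (F a))"
  by (auto intro!: clinearI lie_algebra_eqI simp: clinear_add clinear_scaleC)

lemma clinear_coeff [clinear_intros]: "clinear F \<Longrightarrow> clinear (\<lambda>a. coeff (F a) Y)"
  by (intro clinearI polyfun_eqI)
    (simp_all add: pf_eval_coeff clinear_add clinear_scaleC clinear_add[OF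
        clinear_group_act[OF clinear_id]]
      clinear_scaleC[OF clinear_group_act[OF clinear_id]]
      complex_vector.representation_add[OF indep] complex_vector.representation_scale[OF indep]
          span)

text \<open>This is the law \<open>x \<triangleright> (a b) = (x \<triangleright> a) ((x \<triangleleft> a) \<triangleright> b)\<close> differentiated in \<open>b\<close> along \<open>Y\<close>, with
  \<open>(x \<triangleleft> a) \<triangleright> Y\<close> expanded in the basis.\<close>

lemma left_invariant_field_slice:
  "left_invariant_field Y (slice lact x g) =
    (\<Sum>Z\<in>B. slice ract x (coeff Y Z) * slice lact x (left_invariant_field Z g))"
proof (rule polyfun_eqI)
  fix a
  have "left_translate a (slice lact x g) = slice lact (ract x a) (left_translate (lact x a) g)"
    by (rule polyfun_eqI) (simp add: group_laws)
  then have "pf_eval (left_invariant_field Y (slice lact x g)) a =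
      lie_apply (group_act (ract x a) Y) (left_translate (lact x a) g)"
    by simp
  also have "\<dots> = (\<Sum>Z\<in>B. pf_eval (coeff Y Z) (ract x a) * lie_apply Z (left_translate (lact x a) g))"
    by (subst group_act_expand) (simp only: lie_apply_sum_left lie_apply_ops)
  finally show "pf_eval (left_invariant_field Y (slice lact x g)) a =
      pf_eval (\<Sum>Z\<in>B. slice ract x (coeff Y Z) * slice lact x (left_invariant_field Z g)) a"
    by simp
qed

text \<open>The map \<open>a \<mapsto> x \<triangleright> a\<close> is in general not a homomorphism, so its differential respects brackets
  only up to corrections. Differentiating the previous lemma along \<open>X\<close> gives, by the product rule,
  the term \<open>(x \<triangleright> X) (x \<triangleright> Y)\<close> of the bracket and the derivative of the coefficients of \<open>x \<triangleright> Y\<close>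
  along \<open>X\<close>; the claim is the antisymmetric part.\<close>

lemma group_act_lie_bracket:
  "group_act x (lie_bracket X Y) = lie_bracket (group_act x X) (group_act x Y)
    + (\<Sum>Z\<in>B. pf_eval (lie_act X (coeff Y Z)) x *\<^sub>C Z)
    - (\<Sum>Z\<in>B. pf_eval (lie_act Y (coeff X Z)) x *\<^sub>C Z)"
proof (rule lie_algebra_eqI)
  fix g
  have half: "lie_apply X (left_invariant_field Y (slice lact x g)) =
      (\<Sum>Z\<in>B. pf_eval (lie_act X (coeff Y Z)) x * lie_apply Z g) +
      lie_apply (group_act x X) (left_invariant_field (group_act x Y) g)" for X Y
  proof -
    have "left_invariant_field (group_act x Y) g =
        (\<Sum>Z\<in>B. pf_eval (coeff Y Z) x *\<^sub>C left_invariant_field Z g)"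
      by (rule polyfun_eqI) (subst group_act_expand,
          simp only: pf_eval_left_invariant_field lie_apply_sum_left lie_apply_ops pf_eval_sum
              pf_eval_simps)
    then show ?thesis
      unfolding left_invariant_field_slice
      by (simp add: group_laws sum.distrib slice_simps)
  qed
  show "lie_apply (group_act x (lie_bracket X Y)) g =
      lie_apply (lie_bracket (group_act x X) (group_act x Y)
    + (\<Sum>Z\<in>B. pf_eval (lie_act X (coeff Y Z)) x *\<^sub>C Z)
    - (\<Sum>Z\<in>B. pf_eval (lie_act Y (coeff X Z)) x *\<^sub>C Z)) g"
    using half[of X Y] half[of Y X]
    by (simp add: lie_apply_sum_left clinear_diff[OF clinear_lie_apply_arg[OF clinear_id]]
        del: pf_eval_lie_act)
qed

end

section \<open>Existence and uniqueness of the extensions\<close>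

context group_matched_pair
begin

definition uea_act :: "'g1 lie_algebra uea \<Rightarrow> 'g2 polyfun \<Rightarrow> 'g2 polyfun"
  where "uea_act = uea_action lie_act"

lemma extends_lie_action_uea_act: "extends_lie_action ract uea_act"
  unfolding extends_lie_action_def uea_act_def using uea_action[OF lie_representation_lie_act]
      by blast

text \<open>What the rule for the coaction of a product prescribes for the coaction of \<open>X * v\<close>, as an
  operator on the coaction of \<open>v\<close>.\<close>

definition lie_coact_action ::
  "'g1 lie_algebra \<Rightarrow> 'g1 lie_algebra uea \<otimes> 'g2 polyfun \<Rightarrow> 'g1 lie_algebra uea \<otimes> 'g2 polyfun"
  where "lie_coact_action X t = sweedler t (\<lambda>v f.
    (\<Sum>Z\<in>B. (\<iota> Z * v) \<otimes> (coeff X Z * f)) + v \<otimes> lie_act X f)"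

lemma lie_coact_action_pure:
  "lie_coact_action X (v \<otimes> f) = (\<Sum>Z\<in>B. (\<iota> Z * v) \<otimes> (coeff X Z * f)) + v \<otimes> lie_act X f"
  unfolding lie_coact_action_def by (intro sweedler_pure_tensor clinear_intros)

lemma clinear_lie_coact_action [clinear_intros]:
  "clinear F \<Longrightarrow> clinear (\<lambda>a. lie_coact_action X (F a))"
  "clinear G \<Longrightarrow> clinear (\<lambda>a. lie_coact_action (G a) t)"
  unfolding lie_coact_action_def by (intro clinear_intros; assumption)+

lemmas lie_coact_action_sweedler = clinear_apply_sweedler[OF clinear_lie_coact_action(1)[OF
    clinear_id]]

lemma eval_at_lie_coact_action_pure:
  "eval_at x (lie_coact_action X (v \<otimes> f)) =
    pf_eval f x *\<^sub>C (\<iota> (group_act x X) * v) + pf_eval (lie_act X f) x *\<^sub>C v"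
  by (subst group_act_expand)
    (simp add: lie_coact_action_pure uea_inj_sum uea_inj_simps sum_distrib_right mult_scaleC_left
      complex_vector.scale_sum_right scaleC_scaleC mult.commute)

text \<open>At a point \<open>x\<close> the operator is multiplication by \<open>x \<triangleright> X\<close> plus differentiation along \<open>X\<close>. In
  the commutator the mixed terms cancel, except for the derivatives of the coefficients of \<open>x \<triangleright> Y\<close>
  along \<open>X\<close> and of \<open>x \<triangleright> X\<close> along \<open>Y\<close>, and these are the corrections in \<open>group_act_lie_bracket\<close>.\<close>

lemma lie_representation_lie_coact_action: "lie_representation lie_coact_action"
  unfolding lie_representation_def
proof (intro conjI allI)
  show "cbilinear lie_coact_action" by (intro clinear_intros)
  fix X Y t
  show "lie_coact_action (lie_bracket X Y) t =
      lie_coact_action X (lie_coact_action Y t) - lie_coact_action Y (lie_coact_action X t)"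
  proof (rule tensor_linear_eqI[where t = t])
    show "clinear (lie_coact_action (lie_bracket X Y))"
      "clinear (\<lambda>t. lie_coact_action X (lie_coact_action Y t)
          - lie_coact_action Y (lie_coact_action X t))"
      by (intro clinear_intros)+
    fix v f
    have half: "eval_at x (lie_coact_action X (lie_coact_action Y (v \<otimes> f))) =
        pf_eval f x *\<^sub>C (\<iota> (group_act x X) * \<iota> (group_act x Y) * v)
        + pf_eval f x *\<^sub>C (\<iota> (\<Sum>Z\<in>B. pf_eval (lie_act X (coeff Y Z)) x *\<^sub>C Z) * v)
        + pf_eval (lie_act X f) x *\<^sub>C (\<iota> (group_act x Y) * v)
        + pf_eval (lie_act Y f) x *\<^sub>C (\<iota> (group_act x X) * v)
        + pf_eval (lie_act X (lie_act Y f)) x *\<^sub>C v" for X Y x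
    proof -
      have "eval_at x (lie_coact_action X (lie_coact_action Y (v \<otimes> f))) =
        (\<Sum>Z\<in>B. eval_at x (lie_coact_action X ((\<iota> Z * v) \<otimes> (coeff Y Z * f))))
        + eval_at x (lie_coact_action X (v \<otimes> lie_act Y f))"
        by (subst lie_coact_action_pure)
          (simp add: clinear_add[OF clinear_lie_coact_action(1)[OF clinear_id]]
            clinear_sum[OF clinear_lie_coact_action(1)[OF clinear_id]])
      also have "(\<Sum>Z\<in>B. eval_at x (lie_coact_action X ((\<iota> Z * v) \<otimes> (coeff Y Z * f)))) =
          pf_eval f x *\<^sub>C (\<iota> (group_act x X) * (\<iota> (\<Sum>Z\<in>B. pf_eval (coeff Y Z) x *\<^sub>C Z)) * v)
          + pf_eval f x *\<^sub>C (\<iota> (\<Sum>Z\<in>B. pf_eval (lie_act X (coeff Y Z)) x *\<^sub>C Z) * v)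
          + pf_eval (lie_act X f) x *\<^sub>C (\<iota> (\<Sum>Z\<in>B. pf_eval (coeff Y Z) x *\<^sub>C Z) * v)"
        by (simp add: eval_at_lie_coact_action_pure lie_act_mult uea_inj_sum uea_inj_simps
          sum_distrib_left sum_distrib_right mult_scaleC_left mult_scaleC_right sum.distrib
          complex_vector.scale_sum_right scaleC_scaleC scaleC_add_left mult.commute mult.assoc
          del: pf_eval_lie_act)
      finally show ?thesis
        by (simp add: eval_at_lie_coact_action_pure group_act_expand[symmetric] add_ac
            del: pf_eval_lie_act)
    qed
    show "lie_coact_action (lie_bracket X Y) (v \<otimes> f) =
      lie_coact_action X (lie_coact_action Y (v \<otimes> f))
          - lie_coact_action Y (lie_coact_action X (v \<otimes> f))"
    proof (rule eval_at_eqI)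
      fix x
      have bracket: "lie_act (lie_bracket X Y) f =
          lie_act X (lie_act Y f) - lie_act Y (lie_act X f)"
        using lie_representation_lie_act by (simp add: lie_representation_def)
      show "eval_at x (lie_coact_action (lie_bracket X Y) (v \<otimes> f)) = eval_at x
        (lie_coact_action X (lie_coact_action Y (v \<otimes> f))
            - lie_coact_action Y (lie_coact_action X (v \<otimes> f)))"
        unfolding clinear_diff[OF clinear_eval_at[OF clinear_id]] half eval_at_lie_coact_action_pure
          group_act_lie_bracket bracket
        by (simp add: uea_inj_simps clinear_diff[OF clinear_uea_inj[OF clinear_id]] algebra_simps
          scaleC_add_right complex_vector.scale_right_diff_distrib
              complex_vector.scale_left_diff_distrib
          del: pf_eval_lie_act)
    qed
  qed
qed

definition uea_coact :: "'g1 lie_algebra uea \<Rightarrow> 'g1 lie_algebra uea \<otimes> 'g2 polyfun"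
  where "uea_coact u = uea_action lie_coact_action u (1 \<otimes> 1)"

lemma uea_coact:
  "clinear uea_coact" "uea_coact 1 = 1 \<otimes> 1" "uea_coact (\<iota> X * u) = lie_coact_action X (uea_coact u)"
proof -
  note act = left_moduleD[OF uea_action(1)[OF lie_representation_lie_coact_action]]
    uea_action(2)[OF lie_representation_lie_coact_action]
  show "clinear uea_coact" "uea_coact 1 = 1 \<otimes> 1"
    "uea_coact (\<iota> X * u) = lie_coact_action X (uea_coact u)"
    unfolding uea_coact_def using act cbilinearD(1)[OF act(1) clinear_id] by simp_all
qed

end

locale group_matched_pair_act = group_matched_pair lact ract B
  for lact :: "'g2::affine_algebraic_group \<Rightarrow> 'g1::affine_algebraic_group \<Rightarrow> 'g1"
    and ract B +
  fixes act
  assumes ext_act: "extends_lie_action ract act"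
begin

lemma act: "cbilinear act" "act 1 f = f" "act (u * v) f = act u (act v f)" "act (\<iota> X) f =
    lie_act X f"
  using ext_act by (simp_all add: extends_lie_action_def left_module_def)

lemmas clinear_act [clinear_intros] = cbilinearD(1,2)[OF act(1)]

lemma act_unique: "act u f = uea_act u f"
proof (rule uea_linear_eqI[where f = "\<lambda>u. act u f" and g = "\<lambda>u. uea_act u f"])
  note uea_act = left_moduleD[OF uea_action(1)[OF lie_representation_lie_act]]
    uea_action(2)[OF lie_representation_lie_act]
  show "clinear (\<lambda>u. uea_act u f)"
    unfolding uea_act_def by (rule cbilinearD(1)[OF uea_act(1) clinear_id])
  show "act 1 f = uea_act 1 f" by (simp add: act uea_act_def uea_act)
  show "act (\<iota> X * u) f = uea_act (\<iota> X * u) f" if "act u f = uea_act u f" for X u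
    using that by (simp add: act uea_act_def uea_act)
qed (intro clinear_intros)

lemma linear_eq_on_basis:
  assumes "clinear F" "clinear G" "\<And>Y. Y \<in> B \<Longrightarrow> F Y = G Y"
  shows "F X = G X"
proof -
  have "F (\<Sum>Y\<in>B. complex_vector.representation B X Y *\<^sub>C Y) =
      G (\<Sum>Y\<in>B. complex_vector.representation B X Y *\<^sub>C Y)"
    using assms by (simp add: clinear_sum clinear_scaleC)
  then show ?thesis by (simp add: lie_algebra_expand)
qed

text \<open>The coproduct \<open>X \<otimes> 1 + 1 \<otimes> X\<close> leaves two terms in the rule for the coaction of a product;
  they are the two terms of \<open>lie_coact_action\<close>. Consequently there is at most one extension.\<close>

lemma extends_lie_coaction_gen_mult:
  assumes "extends_lie_coaction lact B act coact"
  shows "coact (\<iota> X * u) = lie_coact_action X (coact u)"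
proof -
  from assms have lin: "clinear coact" and one: "coact 1 = 1 \<otimes> 1"
    and gen: "\<And>X. X \<in> B \<Longrightarrow> coact (\<iota> X) = (\<Sum>Y\<in>B. \<iota> Y \<otimes> coeff X Y)"
    and mult: "\<And>u v. coact (u * v) = sweedler (uea_comult u) (\<lambda>u1 u2. sweedler (coact u1) (\<lambda>a f.
      sweedler (coact v) (\<lambda>b g. (a * b) \<otimes> (f * act u2 g))))"
    by (simp_all add: extends_lie_coaction_def coaction_multiplicative_def)
  note lin' [clinear_intros] = clinear_compose[OF lin]
  have coact_gen: "coact (\<iota> X) = (\<Sum>Y\<in>B. \<iota> Y \<otimes> coeff X Y)" for X
  proof (rule linear_eq_on_basis[where X = X])
    show "clinear (\<lambda>X. coact (\<iota> X))" "clinear (\<lambda>X. \<Sum>Y\<in>B. \<iota> Y \<otimes> coeff X Y)"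
      by (intro clinear_intros)+
  qed (use gen in auto)
  have "coact (\<iota> X * u) =
    sweedler (coact (\<iota> X)) (\<lambda>a f. sweedler (coact u) (\<lambda>b g. (a * b) \<otimes> (f * g)))
    + sweedler (coact u) (\<lambda>b g. b \<otimes> lie_act X g)"
    by (simp add: mult uea_comult_gen sweedler_simps clinear_intros one act)
  then show ?thesis
    unfolding coact_gen lie_coact_action_def
    by (simp add: sweedler_sum sweedler_simps sweedler_fun_sum clinear_intros)
qed

lemma extends_lie_coaction_unique:
  assumes "extends_lie_coaction lact B act coact"
  shows "coact = uea_coact"
proof
  from assms have "clinear coact" "coact 1 = 1 \<otimes> 1"
    by (simp_all add: extends_lie_coaction_def coaction_multiplicative_def)
  note coact = this extends_lie_coaction_gen_mult[OF assms]
  show "coact u = uea_coact u" for u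
    by (rule uea_linear_eqI[where f = coact and g = uea_coact])
      (simp_all add: coact uea_coact)
qed

lemma clinear_uea_coact [clinear_intros]: "clinear F \<Longrightarrow> clinear (\<lambda>a. uea_coact (F a))"
  by (rule clinear_compose[OF uea_coact(1)])

text \<open>Replacing \<open>u\<close> by \<open>X * u\<close> applies \<open>lie_coact_action X\<close> to either side: on the right, the
  derivative along \<open>X\<close> of a product splits into the two terms that come from the coproduct of \<open>X *
  u\<close>.\<close>

lemma uea_coact_mult:
  "uea_coact (u * v) = sweedler (uea_comult u) (\<lambda>u1 u2. sweedler (uea_coact u1) (\<lambda>a f.
      sweedler (uea_coact v) (\<lambda>b g. (a * b) \<otimes> (f * act u2 g))))"
proof (rule uea_linear_eqI[where u = u])
  fix X u
  assume IH: "uea_coact (u * v) = sweedler (uea_comult u) (\<lambda>u1 u2. sweedler (uea_coact u1) (\<lambda>a f.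
      sweedler (uea_coact v) (\<lambda>b g. (a * b) \<otimes> (f * act u2 g))))"
  show "uea_coact (\<iota> X * u * v) = sweedler (uea_comult (\<iota> X * u)) (\<lambda>u1 u2. sweedler (uea_coact u1)
      (\<lambda>a f.
      sweedler (uea_coact v) (\<lambda>b g. (a * b) \<otimes> (f * act u2 g))))"
    unfolding mult.assoc uea_coact(3) IH
    by (simp add: sweedler_uea_comult_gen_mult clinear_intros lie_coact_action_sweedler
      lie_coact_action_pure uea_coact(3) lie_coact_action_def[of X "uea_coact _"] sweedler_simps
      sweedler_sum sweedler_fun_sum act(3,4) lie_act_mult pure_tensor_simps mult.assoc add_ac)
qed (auto intro!: clinear_intros simp: uea_coact(2) sweedler_pure_tensor clinear_intros act)

lemma extends_lie_coaction_uea_coact: "extends_lie_coaction lact B act uea_coact"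
  unfolding extends_lie_coaction_def coaction_multiplicative_def
proof (intro conjI ballI allI)
  show "uea_coact (\<iota> X) = (\<Sum>Y\<in>B. \<iota> Y \<otimes> coeff X Y)" for X
    using uea_coact(3)[of X 1]
    by (simp add: uea_coact(2) lie_coact_action_pure clinear_0[OF clinear_pure_tensor(2)[OF
        clinear_id]])
qed (fact uea_coact uea_coact_mult)+

end

section \<open>The matched pair axioms\<close>

context group_matched_pair_act
begin

text \<open>The extension of \<open>x \<triangleright> X\<close> from the Lie algebra to its enveloping algebra.\<close>

abbreviation act_on :: "'g2 \<Rightarrow> 'g1 lie_algebra uea \<Rightarrow> 'g1 lie_algebra uea"
  where "act_on x u \<equiv> eval_at x (uea_coact u)"

text \<open>The derivative, along the vector field of \<open>X\<close> at the point \<open>x\<close>, of the \<open>V\<close>-valued function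
  that \<open>t\<close> represents.\<close>

definition lie_eval :: "'g1 lie_algebra \<Rightarrow> 'g2 \<Rightarrow> 'v::complex_vector \<otimes> 'g2 polyfun \<Rightarrow> 'v"
  where "lie_eval X x t = sweedler t (\<lambda>v f. pf_eval (lie_act X f) x *\<^sub>C v)"

lemma clinear_lie_eval [clinear_intros]: "clinear F \<Longrightarrow> clinear (\<lambda>a. lie_eval X x (F a))"
  unfolding lie_eval_def by (intro clinear_intros)

lemma lie_eval_pure [simp]: "lie_eval X x (v \<otimes> f) = pf_eval (lie_act X f) x *\<^sub>C v"
  unfolding lie_eval_def by (intro sweedler_pure_tensor clinear_intros)

lemmas lie_eval_sweedler = clinear_apply_sweedler[OF clinear_lie_eval[OF clinear_id]]

lemma eval_at_product:
  "eval_at x s \<otimes> eval_at x t =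
    sweedler s (\<lambda>v f. sweedler t (\<lambda>w g. (pf_eval f x * pf_eval g x) *\<^sub>C (v \<otimes> w)))"
  unfolding eval_at_def clinear_apply_sweedler[OF clinear_pure_tensor(1)[OF clinear_id]]
  unfolding clinear_apply_sweedler[OF clinear_pure_tensor(2)[OF clinear_id]]
  by (simp add: pure_tensor_simps scaleC_scaleC)

text \<open>The product rule for derivatives of vector-valued functions.\<close>

lemma lie_eval_product:
  "lie_eval X x (sweedler s (\<lambda>v f. sweedler t (\<lambda>w g. (v \<otimes> w) \<otimes> (f * g)))) =
    lie_eval X x s \<otimes> eval_at x t + eval_at x s \<otimes> lie_eval X x t"
proof -
  note l = clinear_apply_sweedler[OF clinear_pure_tensor(1)[OF clinear_id]]
    and r = clinear_apply_sweedler[OF clinear_pure_tensor(2)[OF clinear_id]]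
  show ?thesis
    unfolding lie_eval_sweedler unfolding lie_eval_def eval_at_def l unfolding r
    by (simp add: pure_tensor_simps scaleC_scaleC lie_act_mult scaleC_add_left sweedler_fun_add
        sweedler_pure_tensor clinear_intros mult.commute add.commute del: pf_eval_lie_act)
qed

lemma linear_eval_at:
  assumes "clinear L"
  shows "L (eval_at x t) = sweedler t (\<lambda>v f. pf_eval f x *\<^sub>C L v)"
  by (simp add: eval_at_def clinear_apply_sweedler[OF assms] clinear_scaleC[OF assms])

text \<open>This is how an induction hypothesis is differentiated: it is used to rewrite the tensor on
  the right, which represents the function \<open>x \<mapsto> L (eval_at x t)\<close>.\<close>

lemma linear_lie_eval:
  assumes "clinear L"
  shows "L (lie_eval X x t) = lie_eval X x (sweedler t (\<lambda>v f. L v \<otimes> f))"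
  by (simp add: lie_eval_sweedler lie_eval_def[of _ _ t]
      clinear_apply_sweedler[OF assms] clinear_scaleC[OF assms])

lemma act_on_gen:
  "act_on x (\<iota> X * u) = \<iota> (group_act x X) * act_on x u + lie_eval X x (uea_coact u)"
proof -
  have "eval_at x (lie_coact_action X t) = \<iota> (group_act x X) * eval_at x t + lie_eval X x t" for t
    by (rule tensor_linear_eqI[where t = t])
      (auto intro!: clinear_intros simp: eval_at_lie_coact_action_pure mult_scaleC_right
        simp del: pf_eval_lie_act)
  then show ?thesis by (simp add: uea_coact(3))
qed

lemma act_on_one [simp]: "act_on x 1 = 1"
  by (simp add: uea_coact(2) scaleC_one)

text \<open>In \<open>(x y) \<triangleleft> a = (x \<triangleleft> (y \<triangleright> a)) (y \<triangleleft> a)\<close> the variable \<open>a\<close> occurs in both factors. The two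
  summands are the derivatives of \<open>g ((x y) \<triangleleft> a)\<close> at \<open>a = 1\<close> with respect to each of them.\<close>

lemma lie_act_product:
  "pf_eval (lie_act X g) (x * y) =
    pf_eval (lie_act (group_act y X) (right_translate y g)) x
        + pf_eval (lie_act X (left_translate x g)) y"
proof -
  have "slice ract (x * y) g = sweedler (pf_comult g)
      (\<lambda>a b. slice lact y (slice ract x a) * slice ract y b)"
    by (rule polyfun_eqI) (simp add: pf_eval_sweedler group_laws)
  moreover have "slice ract x (right_translate y g) =
      sweedler (pf_comult g) (\<lambda>a b. pf_eval b y *\<^sub>C slice ract x a)"
    by (rule polyfun_eqI) (simp add: pf_eval_sweedler)
  moreover have "slice ract y (left_translate x g) =
      sweedler (pf_comult g) (\<lambda>a b. pf_eval a x *\<^sub>C slice ract y b)"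
    by (rule polyfun_eqI) (simp add: pf_eval_sweedler)
  ultimately show ?thesis
    by (simp add: lie_apply_sweedler slice_simps group_laws sweedler_fun_add
      clinear_apply_sweedler[of "slice lact y"] clinearI sweedler_fun_add mult.commute add.commute)
qed

text \<open>In the step to \<open>X * u\<close> the induction hypothesis is used as an identity of functions of \<open>x\<close>
  and as one of functions of \<open>y\<close>. Differentiated along \<open>y \<triangleright> X\<close> and along \<open>X\<close>, the two contribute
  the summands in \<open>lie_act_product\<close>.\<close>

lemma act_on_mult: "act_on x (act_on y u) = act_on (x * y) u"
proof -
  let ?l = "\<lambda>(i :: 'g2 \<times> 'g2) u. act_on (fst i) (act_on (snd i) u)"
  let ?r = "\<lambda>(i :: 'g2 \<times> 'g2) u. act_on (fst i * snd i) u"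
  have "?l (x, y) u = ?r (x, y) u"
  proof (rule uea_linear_family_eqI[where f = ?l and g = ?r])
    fix X u and i :: "'g2 \<times> 'g2"
    assume "\<And>i. ?l i u = ?r i u"
    then have IH: "act_on x (act_on y u) = act_on (x * y) u" for x y by (metis fst_conv snd_conv)
    obtain x y where i: "i = (x, y)" by (cases i)
    have 1: "uea_coact (act_on y u) = sweedler (uea_coact u) (\<lambda>v f. v \<otimes> right_translate y f)"
      by (rule eval_at_eqI) (simp add: IH eval_at_sweedler, simp add: eval_at_def)
    have 2: "sweedler (uea_coact u) (\<lambda>v f. act_on x v \<otimes> f) =
        sweedler (uea_coact u) (\<lambda>v f. v \<otimes> left_translate x f)"
    proof (rule eval_at_eqI)
      fix y
      have "eval_at y (sweedler (uea_coact u) (\<lambda>v f. act_on x v \<otimes> f)) = act_on x (act_on y u)"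
        by (simp add: eval_at_sweedler linear_eval_at[of "\<lambda>u. act_on x u" y] clinear_intros)
      then show "eval_at y (sweedler (uea_coact u) (\<lambda>v f. act_on x v \<otimes> f)) =
          eval_at y (sweedler (uea_coact u) (\<lambda>v f. v \<otimes> left_translate x f))"
        unfolding IH by (simp add: eval_at_sweedler) (simp add: eval_at_def)
    qed
    have "act_on x (act_on y (\<iota> X * u)) = \<iota> (group_act (x * y) X) * act_on (x * y) u
      + lie_eval (group_act y X) x (uea_coact (act_on y u))
      + lie_eval X y (sweedler (uea_coact u) (\<lambda>v f. act_on x v \<otimes> f))"
      by (simp add: act_on_gen[of y] clinear_add[OF uea_coact(1)] act_on_gen[of x] IH group_act_mult
        linear_lie_eval[of "\<lambda>u. act_on x u"] clinear_intros)
    also have "\<dots> = act_on (x * y) (\<iota> X * u)"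
      unfolding 1 2 act_on_gen[of "x * y"]
      by (simp add: lie_eval_sweedler lie_eval_def[of _ "x * y"]
        lie_act_product[of X _ x y] add.assoc scaleC_add_left sweedler_fun_add del: pf_eval_lie_act)
    finally show "?l i (\<iota> X * u) = ?r i (\<iota> X * u)" by (simp add: i)
  qed (auto intro!: clinear_intros)
  then show ?thesis by simp
qed

text \<open>Since \<open>1 \<triangleleft> a = 1\<close>, derivatives at the identity vanish.\<close>

lemma act_on_by_one: "act_on 1 u = u"
  by (rule uea_linear_eqI[where u = u])
    (auto intro!: clinear_intros simp: act_on_gen group_act_one lie_eval_def lie_act_at_one
      complex_vector.scale_zero_left sweedler_fun_zero simp del: pf_eval_lie_act)

lemma uea_comult_act_on:
  "uea_comult (act_on x u) = sweedler (uea_comult u) (\<lambda>u1 u2. act_on x u1 \<otimes> act_on x u2)"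
proof (rule uea_linear_family_eqI[where u = u and i = x])
  fix X u x
  assume IH: "\<And>x. uea_comult (act_on x u) = sweedler (uea_comult u)
      (\<lambda>u1 u2. act_on x u1 \<otimes> act_on x u2)"
  have 1: "sweedler (uea_coact u) (\<lambda>v f. uea_comult v \<otimes> f) = sweedler (uea_comult u) (\<lambda>u1 u2.
    sweedler (uea_coact u1) (\<lambda>v f. sweedler (uea_coact u2) (\<lambda>w g. (v \<otimes> w) \<otimes> (f * g))))"
  proof (rule eval_at_eqI)
    fix x
    have "eval_at x (sweedler (uea_coact u) (\<lambda>v f. uea_comult v \<otimes> f)) = uea_comult (act_on x u)"
      by (simp add: eval_at_sweedler linear_eval_at[of uea_comult] clinear_uea_comult')
    also have "\<dots> = eval_at x (sweedler (uea_comult u) (\<lambda>u1 u2.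
      sweedler (uea_coact u1) (\<lambda>v f. sweedler (uea_coact u2) (\<lambda>w g. (v \<otimes> w) \<otimes> (f * g)))))"
      unfolding IH
      by (simp add: eval_at_sweedler eval_at_product)
    finally show "eval_at x (sweedler (uea_coact u) (\<lambda>v f. uea_comult v \<otimes> f)) = \<dots>" .
  qed
  show "uea_comult (act_on x (\<iota> X * u)) = sweedler (uea_comult (\<iota> X * u))
      (\<lambda>u1 u2. act_on x u1 \<otimes> act_on x u2)"
    unfolding sweedler_uea_comult_gen_mult
    by (simp add: act_on_gen clinear_add[OF clinear_uea_comult'] uea_comult_gen_mult IH
      linear_lie_eval[OF clinear_uea_comult'] 1
      lie_eval_sweedler[of _ _ "uea_comult _"] lie_eval_product sweedler_simps clinear_intros pure_tensor_simps add_ac sweedler_uea_comult_gen_mult)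
qed (auto intro!: clinear_intros simp: sweedler_pure_tensor clinear_intros)

lemma uea_counit_act_on: "uea_counit (act_on x u) = uea_counit u"
proof (rule uea_linear_family_eqI[where u = u and i = x])
  fix X u x
  assume IH: "\<And>x. uea_counit (act_on x u) = uea_counit u"
  have "sweedler (uea_coact u) (\<lambda>v f. uea_counit v \<otimes> f) = uea_counit u \<otimes> 1"
    by (rule eval_at_eqI)
      (simp add: eval_at_sweedler scaleC_one IH flip: linear_eval_at[OF clinear_uea_counit'])
  then show "uea_counit (act_on x (\<iota> X * u)) = uea_counit (\<iota> X * u)"
    by (simp add: act_on_gen clinear_add[OF clinear_uea_counit']
        linear_lie_eval[OF clinear_uea_counit']
      complex_vector.scale_zero_left del: pf_eval_lie_act)
qed (auto intro!: clinear_intros)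

lemma act_mult: "act u (f * g) = sweedler (uea_comult u) (\<lambda>u1 u2. act u1 f * act u2 g)"
  by (rule uea_linear_eqI[where u = u])
    (auto intro!: clinear_intros simp: act sweedler_pure_tensor clinear_intros lie_act_sweedler
      sweedler_uea_comult_gen_mult lie_act_mult sweedler_fun_add)

lemma act_unit: "act u 1 = uea_counit u *\<^sub>C 1"
  by (rule uea_linear_eqI[where u = u])
    (auto intro!: clinear_intros simp: act clinear_scaleC[OF clinear_lie_act(1)[OF clinear_id]]
      scaleC_one complex_vector.scale_zero_left complex_vector.scale_zero_right)

lemma pf_counit_act: "pf_counit (act u f) = uea_counit u * pf_counit f"
  unfolding pf_counit_def
  by (rule uea_linear_eqI[where u = u])
    (auto intro!: clinear_intros simp: act lie_act_at_one simp del: pf_eval_lie_act)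

text \<open>This is the axiom for \<open>\<Delta>(u \<triangleright> f)\<close> at a pair of points. As in \<open>act_on_mult\<close>, the induction
  hypothesis is differentiated both as a function of \<open>x\<close> and as a function of \<open>y\<close>, and the
  summands are combined with \<open>lie_act_product\<close>.\<close>

lemma act_product:
  "pf_eval (act u f) (x * y) = sweedler (uea_comult u) (\<lambda>u1 u2. sweedler (uea_coact u1) (\<lambda>a k.
    sweedler (pf_comult f) (\<lambda>f1 f2. pf_eval (act a f1) x * (pf_eval k y * pf_eval (act u2 f2) y))))"
proof -
  let ?l = "\<lambda>(i :: 'g2 \<times> 'g2) u. pf_eval (act u f) (fst i * snd i)"
  let ?r = "\<lambda>(i :: 'g2 \<times> 'g2) u. sweedler (uea_comult u) (\<lambda>u1 u2. sweedler (uea_coact u1) (\<lambda>a k.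
    sweedler (pf_comult f) (\<lambda>f1 f2. pf_eval (act a f1) (fst i) *
      (pf_eval k (snd i) * pf_eval (act u2 f2) (snd i)))))"
  have "?l (x, y) u = ?r (x, y) u"
  proof (rule uea_linear_family_eqI[where f = ?l and g = ?r])
    fix X u and i :: "'g2 \<times> 'g2"
    assume "\<And>i. ?l i u = ?r i u"
    then have IH: "pf_eval (act u f) (x * y) = sweedler (uea_comult u)
        (\<lambda>u1 u2. sweedler (uea_coact u1) (\<lambda>a k.
        sweedler (pf_comult f) (\<lambda>f1 f2. pf_eval (act a f1) x * (pf_eval k y * pf_eval
            (act u2 f2) y))))"
      for x y by (metis fst_conv snd_conv)
    obtain x y where i: "i = (x, y)" by (cases i)
    have R: "right_translate y (act u f) = sweedler (uea_comult u) (\<lambda>u1 u2. sweedler (uea_coact u1)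
        (\<lambda>a k.
        sweedler (pf_comult f) (\<lambda>f1 f2. (pf_eval k y * pf_eval (act u2 f2) y) *\<^sub>C act a f1)))"
      by (rule polyfun_eqI) (simp add: IH pf_eval_sweedler mult.commute)
    have L: "left_translate x (act u f) = sweedler (uea_comult u) (\<lambda>u1 u2. sweedler (uea_coact u1)
        (\<lambda>a k.
        sweedler (pf_comult f) (\<lambda>f1 f2. pf_eval (act a f1) x *\<^sub>C (k * act u2 f2))))"
      by (rule polyfun_eqI) (simp add: IH pf_eval_sweedler)
    have group_act: "pf_eval (lie_act (group_act y X) g) x =
        (\<Sum>Z\<in>B. pf_eval (coeff X Z) y * pf_eval (lie_act Z g) x)" for g
      by (subst group_act_expand) (simp add: clinear_sum[OF clinear_lie_act(2)[OF clinear_id]]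
        clinear_scaleC[OF clinear_lie_act(2)[OF clinear_id]] del: pf_eval_lie_act)
    note lie_act_scaleC = clinear_scaleC[OF clinear_lie_act(1)[OF clinear_id]]
    have "pf_eval (act (\<iota> X * u) f) (x * y) =
        pf_eval (lie_act (group_act y X) (right_translate y (act u f))) x +
        pf_eval (lie_act X (left_translate x (act u f))) y"
      by (simp add: act(3,4) lie_act_product del: pf_eval_lie_act)
    also have "\<dots> = ?r (x, y) (\<iota> X * u)"
      unfolding R L
      by (simp add: group_act lie_act_sweedler lie_act_scaleC lie_act_mult pf_eval_sweedler
        sweedler_uea_comult_gen_mult clinear_intros uea_coact(3) lie_coact_action_def sweedler_simps
        sweedler_sum sweedler_fun_sum act(3,4) sum_distrib_left sum_distrib_right distrib_left
            distrib_right
        mult_ac add_ac del: pf_eval_lie_act)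
    finally show "?l i (\<iota> X * u) = ?r i (\<iota> X * u)" by (simp add: i)
  qed (auto intro!: clinear_intros simp: uea_coact sweedler_simps clinear_intros act)
  then show ?thesis by simp
qed

theorem matched_pair_of_hopf_algebras_uea_coact:
  "matched_pair_of_hopf_algebras (pf_comult :: 'g2 polyfun \<Rightarrow> _) pf_counit pf_antipode
    uea_comult uea_counit uea_antipode act uea_coact"
  unfolding matched_pair_of_hopf_algebras_def
proof (intro conjI allI)
  show "hopf_algebra (pf_comult :: 'g2 polyfun \<Rightarrow> _) pf_counit pf_antipode"
    by (rule hopf_algebra_polyfun)
  show "hopf_algebra (uea_comult :: 'g1 lie_algebra uea \<Rightarrow> _) uea_counit uea_antipode"
    by (rule hopf_algebra_uea)
  show "left_module_algebra uea_comult uea_counit act"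
    using ext_act act_mult act_unit by (simp add: left_module_algebra_def extends_lie_action_def)
  show "right_comodule_coalgebra (pf_comult :: 'g2 polyfun \<Rightarrow> _) pf_counit uea_comult uea_counit
      uea_coact"
    unfolding right_comodule_coalgebra_def right_comodule_def
  proof (intro conjI allI)
    fix u
    show "clinear uea_coact" by (rule uea_coact)
    show "sweedler (uea_coact u) (\<lambda>u0 u1. sweedler (uea_coact u0) (\<lambda>v f. v \<otimes> f \<otimes> u1)) =
        sweedler (uea_coact u) (\<lambda>u0 u1. sweedler (pf_comult u1) (\<lambda>f g. u0 \<otimes> f \<otimes> g))"
    proof (rule eval_at_eqI2)
      fix x y :: 'g2
      have "sweedler (pf_comult g) (\<lambda>a b. (pf_eval a x * pf_eval b y) *\<^sub>C v) =
          pf_eval g (x * y) *\<^sub>C v"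
        for g and v :: "'g1 lie_algebra uea"
        by (simp add: clinear_apply_sweedler[OF clinear_scaleC_left[OF clinear_id], symmetric])
      moreover have "sweedler (uea_coact u) (\<lambda>u0 u1. sweedler (uea_coact u0)
          (\<lambda>v f. (pf_eval f x * pf_eval u1 y) *\<^sub>C v)) = act_on x (act_on y u)"
        by (subst linear_eval_at, intro clinear_intros)
          (simp add: eval_at_def sweedler_fun_scaleC[symmetric] scaleC_scaleC mult.commute)
      moreover have "sweedler (uea_coact u) (\<lambda>v f. pf_eval f (x * y) *\<^sub>C v) = act_on (x * y) u"
        by (simp add: eval_at_def)
      ultimately show "sweedler (sweedler (uea_coact u) (\<lambda>u0 u1. sweedler (uea_coact u0)
          (\<lambda>v f. v \<otimes> f \<otimes> u1)))
          (\<lambda>v w. pf_eval (eval_at y w) x *\<^sub>C v) =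
        sweedler (sweedler (uea_coact u) (\<lambda>u0 u1. sweedler (pf_comult u1) (\<lambda>f g. u0 \<otimes> f \<otimes> g)))
          (\<lambda>v w. pf_eval (eval_at y w) x *\<^sub>C v)"
        by (simp add: sweedler_simps clinear_intros mult.commute act_on_mult)
    qed
    show "sweedler (uea_coact u) (\<lambda>u0 u1. pf_counit u1 *\<^sub>C u0) = u"
      using act_on_by_one[of u] by (simp add: eval_at_def pf_counit_def)
    show "sweedler (uea_coact u) (\<lambda>u0 f. sweedler (uea_comult u0) (\<lambda>v w. v \<otimes> w \<otimes> f)) =
        sweedler (uea_comult u) (\<lambda>u1 u2. sweedler (uea_coact u1) (\<lambda>v f. sweedler (uea_coact u2)
            (\<lambda>w g.
           v \<otimes> w \<otimes> (f * g))))"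
    proof (rule eval_at_eqI_inner)
      fix x
      have "sweedler (uea_coact u) (\<lambda>u0 f. sweedler (uea_comult u0)
          (\<lambda>v w. pf_eval f x *\<^sub>C (v \<otimes> w))) =
          uea_comult (act_on x u)"
        by (simp add: linear_eval_at[OF clinear_uea_comult'] sweedler_fun_scaleC)
      moreover have "sweedler (uea_comult u) (\<lambda>u1 u2. sweedler (uea_coact u1)
          (\<lambda>v f. sweedler (uea_coact u2)
          (\<lambda>w g. (pf_eval f x * pf_eval g x) *\<^sub>C (v \<otimes> w)))) =
          sweedler (uea_comult u) (\<lambda>u1 u2. act_on x u1 \<otimes> act_on x u2)"
        by (simp add: eval_at_product)
      ultimately show "sweedler (sweedler (uea_coact u) (\<lambda>u0 f. sweedler (uea_comult u0)
          (\<lambda>v w. v \<otimes> w \<otimes> f)))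
          (\<lambda>v w. v \<otimes> eval_at x w) =
        sweedler (sweedler (uea_comult u) (\<lambda>u1 u2. sweedler (uea_coact u1)
            (\<lambda>v f. sweedler (uea_coact u2) (\<lambda>w g.
           v \<otimes> w \<otimes> (f * g))))) (\<lambda>v w. v \<otimes> eval_at x w)"
        by (simp add: sweedler_simps clinear_intros pure_tensor_simps uea_comult_act_on
          del: sweedler_fun_scaleC)
    qed
    show "sweedler (uea_coact u) (\<lambda>u0 f. uea_counit u0 *\<^sub>C f) = uea_counit u *\<^sub>C 1"
    proof (rule polyfun_eqI)
      fix x
      show "pf_eval (sweedler (uea_coact u) (\<lambda>u0 f. uea_counit u0 *\<^sub>C f)) x =
          pf_eval (uea_counit u *\<^sub>C 1) x"
        using uea_counit_act_on[of x u]
        by (simp add: pf_eval_sweedler linear_eval_at[OF clinear_uea_counit'] scaleC_complex_def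
            mult.commute)
    qed
  qed
  show "coaction_multiplicative uea_comult act uea_coact"
    using extends_lie_coaction_uea_coact by (simp add: extends_lie_coaction_def)
  fix u f
  show "pf_counit (act u f) = uea_counit u * pf_counit f" by (rule pf_counit_act)
  show "pf_comult (act u f) = sweedler (uea_comult u) (\<lambda>u1 u2. sweedler (uea_coact u1) (\<lambda>u10 u11.
      sweedler (pf_comult f) (\<lambda>f1 f2. act u10 f1 \<otimes> (u11 * act u2 f2))))"
    by (intro eval_at_eqI polyfun_eqI) (simp add: act_product eval_at_sweedler pf_eval_sweedler
        mult_ac)
  have "sweedler (sweedler (uea_comult u) (\<lambda>a b. b \<otimes> a))
      (\<lambda>u1 u2. sweedler (uea_coact u2) (\<lambda>u20 u21. u20 \<otimes> (act u1 f * u21))) =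
    sweedler (uea_comult u) (\<lambda>u1 u2. sweedler (uea_coact u1) (\<lambda>u10 u11. u10 \<otimes> (u11 * act u2 f)))"
    by (simp add: sweedler_simps clinear_intros mult.commute)
  then show "sweedler (uea_comult u) (\<lambda>u1 u2. sweedler (uea_coact u2)
      (\<lambda>u20 u21. u20 \<otimes> (act u1 f * u21))) =
    sweedler (uea_comult u) (\<lambda>u1 u2. sweedler (uea_coact u1) (\<lambda>u10 u11. u10 \<otimes> (u11 * act u2 f)))"
    by (simp add: uea_comult_cocommutative)
qed

end

theorem theorem3p2p19:
  fixes lact :: "'g2::affine_algebraic_group \<Rightarrow> 'g1::affine_algebraic_group \<Rightarrow> 'g1"
    and ract :: "'g2 \<Rightarrow> 'g1 \<Rightarrow> 'g2"
    and B :: "'g1 lie_algebra set"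
  assumes "matched_pair_of_groups lact ract"
    and "complex_vector.independent B" and "complex_vector.span B = UNIV"
  shows "(\<exists>!act. extends_lie_action ract act) \<and>
    (\<forall>act. extends_lie_action ract act \<longrightarrow>
      (\<exists>!coact. extends_lie_coaction lact B act coact) \<and>
      (\<forall>coact. extends_lie_coaction lact B act coact \<longrightarrow>
        matched_pair_of_hopf_algebras
          (pf_comult :: 'g2 polyfun \<Rightarrow> _) pf_counit pf_antipode
          (uea_comult :: 'g1 lie_algebra uea \<Rightarrow> _) uea_counit uea_antipode act coact))"
proof (intro conjI allI impI)
  interpret group_matched_pair lact ract B
    by (rule group_matched_pair.intro) (fact assms)+
  show "\<exists>!act. extends_lie_action ract act"
  proof (rule ex1I[where P = "extends_lie_action ract", OF extends_lie_action_uea_act])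
    fix act assume "extends_lie_action ract act"
    then interpret group_matched_pair_act lact ract B act
      by unfold_locales
    show "act = uea_act" by (intro ext act_unique)
  qed
  fix act assume "extends_lie_action ract act"
  then interpret group_matched_pair_act lact ract B act
    by unfold_locales
  show "\<exists>!coact. extends_lie_coaction lact B act coact"
    using extends_lie_coaction_uea_coact extends_lie_coaction_unique by blast
  fix coact assume "extends_lie_coaction lact B act coact"
  then show "matched_pair_of_hopf_algebras
      (pf_comult :: 'g2 polyfun \<Rightarrow> _) pf_counit pf_antipode
      (uea_comult :: 'g1 lie_algebra uea \<Rightarrow> _) uea_counit uea_antipode act coact"
    using matched_pair_of_hopf_algebras_uea_coact extends_lie_coaction_unique by blast
qed

end
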